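(* Let $g=2k$ or $g=2k+1$ with $k$ an integer, and let $p\ge 0$ be an integer with $p\le k-3$. Suppose that property $N_p$ holds for the Prym-canonical binary curve $\tilde C\subset\mathbb{P}^{g-3}$ of genus $g-1$, embedded by $|\omega_{\tilde C}\otimes A'|$, for a generic choice of its parameters $a'_{i,j}$ ($1\le i\le g-2$, $j=1,2$). Then property $N_p$ holds for the Prym-canonical binary curve $C\subset\mathbb{P}^{g-2}$ of genus $g$, embedded by $|\omega_C\otimes A|$, for a generic choice of its parameters $a_{i,j}$ ($1\le i\le g-1$, $j=1,2$).
   Context: We work over $\mathbb{C}$. A binary curve of genus $g$ is a stable curve consisting of two smooth rational components $C_1,C_2$ meeting transversally at $g+1$ points. Koszul cohomology: for a projective curve $C$ and a line bundle $L$ on $C$, $K_{p,q}(C,L)$ is the cohomology at the middle term of $$\Lambda^{p+1}H^0(L)\otimes H^0(L^{q-1})\to \Lambda^{p}H^0(L)\otimes H^0(L^{q})\to \Lambda^{p-1}H^0(L)\otimes H^0(L^{q+1}),$$ where the maps are $s_1\wedge\dots\wedge s_m\otimes u\mapsto\sum_{l}(-1)^l s_1\wedge\dots\wedge\hat{s_l}\wedge\dots\wedge s_m\otimes(s_lu)$. For a curve embedded by $|\omega_C\otimes A|$, property $N_p$ means $K_{p,2}(C,\omega_C\otimes A)=0$. Prym-canonical binary curves of genus $g$ (the same construction is used for every genus; for genus $g-1$ replace $g$ by $g-1$ throughout, including in the definition of $k$): let $k=\lfloor g/2\rfloor$, let $a_{i,j}\in\mathbb{C}$ ($1\le i\le g-1$,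 $j=1,2$) be parameters, $M_j(t,u)=\prod_{r=1}^{g-1}(t-a_{r,j}u)$, $A_j=\prod_{i=1}^{g-1}a_{i,j}$, $d_2$ a nonzero constant and $d_1=-d_2A_1/A_2$. For $j=1,2$ let $C_j$ be the image of $\phi_j:\mathbb{P}^1\to\mathbb{P}^{g-2}$, $$\phi_j(t,u)=\Big[\tfrac{tM_j(t,u)}{t-a_{1,j}u},\dots,\tfrac{tM_j(t,u)}{t-a_{k,j}u},\tfrac{-M_j(t,u)d_ja_{k+1,j}u}{A_j(t-a_{k+1,j}u)},\dots,\tfrac{-M_j(t,u)d_ja_{g-1,j}u}{A_j(t-a_{g-1,j}u)}\Big].$$ Then $\phi_1,\phi_2$ both send $[a_{l,j},1]$ to the $l$-th coordinate point $P_l$ ($1\le l\le g-1$), $[0,1]$ to $P_g=[0,\dots,0,1,\dots,1]$ ($k$ zeros), and $[1,0]$ to $P_{g+1}=[1,\dots,1,0,\dots,0]$ ($k$ ones). It is known that for a general choice of the $a_{i,j}$, $C=C_1\cup C_2$ is a binary curve of genus $g$ with nodes $P_1,\dots,P_{g+1}$, embedded by the complete linear system $|\omega_C\otimes A|$ with $A\in\mathrm{Pic}^0(C)$ nontrivial and $A^{\otimes 2}\cong\mathcal{O}_C$; under $\mathrm{Pic}^0(C)\cong(\mathbb{C}^* )^{g+1}/\mathbb{C}^*$ the bundle $A$ corresponds to $[(h_1,\dots,h_{g+1})]$ with $h_i=1$ for $i\le k$, $h_i=-1$ for $k+1\le i\le g$, $h_{g+1}=1$. Such a curve $C\subset\mathbb{P}^{g-2}$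 is called here a Prym-canonical binary curve of genus $g$. "Generic choice of the parameters" means for all parameters in a nonempty Zariski open subset of the parameter space $\mathbb{C}^{2(g-1)}$. *)

theory Defs
  imports "HOL-Analysis.Analysis" "HOL-Library.Function_Algebras"
begin

section \<open>Complex vector spaces of functions\<close>

text \<open>Sections, coordinate vectors and Koszul chains are complex-valued functions; addition and
  multiplication are pointwise, from Function_Algebras.\<close>

definition cscale :: "complex \<Rightarrow> ('x \<Rightarrow> complex) \<Rightarrow> 'x \<Rightarrow> complex" where
  "cscale c f = (\<lambda>x. c * f x)"

interpretation cfun: vector_space cscale
  by unfold_locales (auto simp: cscale_def fun_eq_iff algebra_simps)


section \<open>Koszul cohomology\<close>

text \<open>For subspaces \<open>V\<close> and \<open>W\<close> of a function algebra, \<open>\<Lambda>\<^sup>m V \<otimes> W\<close> is presented as the space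
  \<open>koszul_chains m V W\<close> of formal linear combinations of symbols
  \<open>v\<^sub>1 \<and> \<dots> \<and> v\<^sub>m \<otimes> w\<close> (a list \<open>v\<close> of length \<open>m\<close> and \<open>w\<close>), modulo the subspace
  \<open>koszul_relations m V W\<close> generated by the multilinearity and alternation relations.\<close>

type_synonym 'x koszul_chain = "('x \<Rightarrow> complex) list \<times> ('x \<Rightarrow> complex) \<Rightarrow> complex"

definition symb :: "('x \<Rightarrow> complex) list \<Rightarrow> ('x \<Rightarrow> complex) \<Rightarrow> 'x koszul_chain" where
  "symb v w = (\<lambda>z. if z = (v, w) then 1 else 0)"

definition koszul_chains ::
    "nat \<Rightarrow> ('x \<Rightarrow> complex) set \<Rightarrow> ('x \<Rightarrow> complex) set \<Rightarrow> 'x koszul_chain set" where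
  "koszul_chains m V W = cfun.span {symb v w | v w. length v = m \<and> set v \<subseteq> V \<and> w \<in> W}"

definition koszul_relations ::
    "nat \<Rightarrow> ('x \<Rightarrow> complex) set \<Rightarrow> ('x \<Rightarrow> complex) set \<Rightarrow> 'x koszul_chain set" where
  "koszul_relations m V W = cfun.span
     ({symb (v[i := cscale a s + cscale b t]) w
          - cscale a (symb (v[i := s]) w) - cscale b (symb (v[i := t]) w) | v i a b s t w.
          length v = m \<and> set v \<subseteq> V \<and> i < m \<and> s \<in> V \<and> t \<in> V \<and> w \<in> W}
      \<union> {symb v (cscale a w + cscale b w')
          - cscale a (symb v w) - cscale b (symb v w') | v a b w w'.
          length v = m \<and> set v \<subseteq> V \<and> w \<in> W \<and> w' \<in> W}
      \<union> {symb v w | v w.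
          length v = m \<and> set v \<subseteq> V \<and> \<not> distinct v \<and> w \<in> W})"

text \<open>List positions start at 0, hence the exponent \<open>Suc l\<close>.  The differential is zero on
  \<open>\<Lambda>\<^sup>0 V \<otimes> W\<close>.\<close>

definition koszul_symb :: "('x \<Rightarrow> complex) list \<Rightarrow> ('x \<Rightarrow> complex) \<Rightarrow> 'x koszul_chain" where
  "koszul_symb v w =
     (\<Sum>l<length v. cscale ((-1) ^ Suc l) (symb (take l v @ drop (Suc l) v) (v ! l * w)))"

definition koszul_map :: "'x koszul_chain \<Rightarrow> 'x koszul_chain" where
  "koszul_map x = (\<Sum>z | x z \<noteq> 0. cscale (x z) (koszul_symb (fst z) (snd z)))"

text \<open>\<open>H q\<close> stands for \<open>H\<^sup>0(L\<^sup>q)\<close>.  Cycles and boundaries are taken in the presenting space of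
  \<open>\<Lambda>\<^sup>p H\<^sup>0(L) \<otimes> H\<^sup>0(L\<^sup>q)\<close>, so both contain the relations and \<open>K\<^bsub>p,q\<^esub>\<close> is their quotient;
  \<open>q \<ge> 1\<close> is assumed.\<close>

definition koszul_cycles ::
    "(nat \<Rightarrow> ('x \<Rightarrow> complex) set) \<Rightarrow> nat \<Rightarrow> nat \<Rightarrow> 'x koszul_chain set" where
  "koszul_cycles H p q =
     {x \<in> koszul_chains p (H 1) (H q).
        koszul_map x \<in> koszul_relations (p - 1) (H 1) (H (q + 1))}"

definition koszul_boundaries ::
    "(nat \<Rightarrow> ('x \<Rightarrow> complex) set) \<Rightarrow> nat \<Rightarrow> nat \<Rightarrow> 'x koszul_chain set" where
  "koszul_boundaries H p q =
     {x \<in> koszul_chains p (H 1) (H q).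
        \<exists>y \<in> koszul_chains (p + 1) (H 1) (H (q - 1)).
          x - koszul_map y \<in> koszul_relations p (H 1) (H q)}"

definition koszul_vanishes :: "(nat \<Rightarrow> ('x \<Rightarrow> complex) set) \<Rightarrow> nat \<Rightarrow> nat \<Rightarrow> bool" where
  "koszul_vanishes H p q \<longleftrightarrow> koszul_cycles H p q \<subseteq> koszul_boundaries H p q"


section \<open>Line bundles on a binary curve\<close>

text \<open>A binary curve is two copies of \<open>\<P>\<^sup>1\<close>, indexed by \<open>branch\<close>, with the point \<open>x l Br1\<close>
  glued to \<open>x l Br2\<close> for \<open>l = 1, \<dots>, g + 1\<close>.  Points of \<open>\<P>\<^sup>1\<close> are given by nonzero pairs
  \<open>(t, u)\<close>.\<close>

datatype branch = Br1 | Br2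

type_synonym curve_section = "branch \<times> complex \<times> complex \<Rightarrow> complex"

definition binary_form :: "nat \<Rightarrow> (complex \<times> complex \<Rightarrow> complex) \<Rightarrow> bool" where
  "binary_form n f \<longleftrightarrow> (\<exists>c. \<forall>t u. f (t, u) = (\<Sum>i\<le>n. c i * t ^ i * u ^ (n - i)))"

definition vanishing_form :: "complex \<times> complex \<Rightarrow> complex \<times> complex \<Rightarrow> complex" where
  "vanishing_form = (\<lambda>(x, y) (t, u). y * t - x * u)"

text \<open>A \<open>q\<close>-differential on \<open>\<P>\<^sup>1\<close> with poles of order at most \<open>q\<close> at the points
  \<open>x 1, \<dots>, x (g + 1)\<close> is uniquely
  \<open>F (u dt - t du)\<^sup>q / (\<Prod>r. vanishing_form (x r))\<^sup>q\<close> with \<open>F\<close> a binary form of degree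
  \<open>q (g - 1)\<close>.  As \<open>u dt - t du\<close> agrees with the differential of \<open>vanishing_form (x l)\<close> at
  \<open>x l\<close> (in the chart fixing one homogeneous coordinate of \<open>x l\<close>), the number below is its leading
  coefficient at \<open>x l\<close>, which is the residue if \<open>q = 1\<close>.\<close>

definition node_residue ::
    "nat \<Rightarrow> (nat \<Rightarrow> complex \<times> complex) \<Rightarrow> nat \<Rightarrow> (complex \<times> complex \<Rightarrow> complex) \<Rightarrow> nat \<Rightarrow> complex" where
  "node_residue g x q F l = F (x l) / (\<Prod>r\<in>{1..g + 1} - {l}. vanishing_form (x r) (x l)) ^ q"

text \<open>\<open>H\<^sup>0(C, (\<omega>\<^sub>C \<otimes> A)\<^sup>q)\<close>.  Sections of \<open>\<omega>\<^sub>C\<close> are pairs of differentials on the branches with at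
  most simple poles at the nodes and with opposite residues at the two points over each node;
  the class of \<open>(h\<^sub>1, \<dots>, h\<^bsub>g+1\<^esub>)\<close> corresponds to the bundle \<open>A\<close> whose local sections are pairs of
  functions with \<open>f\<^sub>1 = h\<^sub>l f\<^sub>2\<close> at the \<open>l\<close>-th node.\<close>

definition twisted_canonical_sections ::
    "nat \<Rightarrow> (nat \<Rightarrow> branch \<Rightarrow> complex \<times> complex) \<Rightarrow> (nat \<Rightarrow> complex) \<Rightarrow> nat \<Rightarrow> curve_section set" where
  "twisted_canonical_sections g x h q =
     {s. (\<forall>j. binary_form (q * (g - 1)) (\<lambda>z. s (j, z))) \<and>
         (\<forall>l\<in>{1..g + 1}.
            node_residue g (\<lambda>r. x r Br1) q (\<lambda>z. s (Br1, z)) l =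
            (- h l) ^ q * node_residue g (\<lambda>r. x r Br2) q (\<lambda>z. s (Br2, z)) l)}"


section \<open>Generic choice of parameters\<close>

type_synonym params = "nat \<times> branch \<Rightarrow> complex"

definition param_space :: "nat \<Rightarrow> params set" where
  "param_space n = {1..n} \<times> UNIV \<rightarrow>\<^sub>E UNIV"

inductive_set poly_functions :: "nat \<Rightarrow> (params \<Rightarrow> complex) set" for n where
  const: "(\<lambda>a. c) \<in> poly_functions n"
| var: "i \<in> {1..n} \<Longrightarrow> (\<lambda>a. a (i, j)) \<in> poly_functions n"
| add: "F \<in> poly_functions n \<Longrightarrow> G \<in> poly_functions n \<Longrightarrow> (\<lambda>a. F a + G a) \<in> poly_functions n"
| mult: "F \<in> poly_functions n \<Longrightarrow> G \<in> poly_functions n \<Longrightarrow> (\<lambda>a. F a * G a) \<in> poly_functions n"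

definition zariski_open :: "nat \<Rightarrow> params set \<Rightarrow> bool" where
  "zariski_open n U \<longleftrightarrow>
     (\<exists>S \<subseteq> poly_functions n. U = param_space n - {a \<in> param_space n. \<forall>F\<in>S. F a = 0})"

definition generically :: "nat \<Rightarrow> (params \<Rightarrow> bool) \<Rightarrow> bool" where
  "generically n P \<longleftrightarrow> (\<exists>U. zariski_open n U \<and> U \<noteq> {} \<and> (\<forall>a\<in>U. P a))"


section \<open>Prym-canonical binary curves\<close>

definition prym_node :: "nat \<Rightarrow> params \<Rightarrow> nat \<Rightarrow> branch \<Rightarrow> complex \<times> complex" where
  "prym_node g a l j = (if l \<le> g - 1 then (a (l, j), 1) else if l = g then (0, 1) else (1, 0))"

definition prym_h :: "nat \<Rightarrow> nat \<Rightarrow> complex" where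
  "prym_h g l = (if l \<le> g div 2 then 1 else if l \<le> g then -1 else 1)"

definition prym_sections :: "nat \<Rightarrow> params \<Rightarrow> nat \<Rightarrow> curve_section set" where
  "prym_sections g a q = twisted_canonical_sections g (prym_node g a) (prym_h g) q"

definition property_N :: "nat \<Rightarrow> nat \<Rightarrow> params \<Rightarrow> bool" where
  "property_N p g a \<longleftrightarrow> koszul_vanishes (prym_sections g a) p 2"

definition param_prod :: "nat \<Rightarrow> params \<Rightarrow> branch \<Rightarrow> complex" where
  "param_prod g a j = (\<Prod>i\<in>{1..g - 1}. a (i, j))"

primrec branch_const :: "nat \<Rightarrow> complex \<Rightarrow> params \<Rightarrow> branch \<Rightarrow> complex" where
  "branch_const g d a Br1 = - d * param_prod g a Br1 / param_prod g a Br2"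
| "branch_const g d a Br2 = d"

text \<open>Homogeneous coordinates on \<open>\<P>\<^bsup>g-2\<^esup>\<close> are indexed by \<open>1, \<dots>, g - 1\<close>; vectors are zero
  elsewhere.  The polynomial \<open>M\<^sub>j / (t - a\<^bsub>i,j\<^esub> u)\<close> is written as a product.\<close>

definition prym_map ::
    "nat \<Rightarrow> complex \<Rightarrow> params \<Rightarrow> branch \<Rightarrow> complex \<times> complex \<Rightarrow> nat \<Rightarrow> complex" where
  "prym_map g d a j = (\<lambda>(t, u) i.
     let N = (\<Prod>r\<in>{1..g - 1} - {i}. t - a (r, j) * u) in
     if i \<in> {1..g div 2} then t * N
     else if i \<in> {g div 2 + 1..g - 1} then
       - (N * branch_const g d a j * a (i, j) * u) / param_prod g a j
     else 0)"

definition node_image :: "nat \<Rightarrow> nat \<Rightarrow> nat \<Rightarrow> complex" where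
  "node_image g l = (\<lambda>i.
     if l \<le> g - 1 then (if i = l then 1 else 0)
     else if l = g then (if i \<in> {g div 2 + 1..g - 1} then 1 else 0)
     else (if i \<in> {1..g div 2} then 1 else 0))"

text \<open>Points of \<open>\<P>\<^bsup>g-2\<^esup>\<close> and lines in it are represented by the corresponding linear subspaces.\<close>

definition prym_component :: "nat \<Rightarrow> complex \<Rightarrow> params \<Rightarrow> branch \<Rightarrow> (nat \<Rightarrow> complex) set set" where
  "prym_component g d a j = {cfun.span {prym_map g d a j z} | z. z \<noteq> (0, 0)}"

definition partial_t ::
    "(complex \<times> complex \<Rightarrow> nat \<Rightarrow> complex) \<Rightarrow> complex \<times> complex \<Rightarrow> nat \<Rightarrow> complex" where
  "partial_t f = (\<lambda>(t, u) i. deriv (\<lambda>s. f (s, u) i) t)"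

definition partial_u ::
    "(complex \<times> complex \<Rightarrow> nat \<Rightarrow> complex) \<Rightarrow> complex \<times> complex \<Rightarrow> nat \<Rightarrow> complex" where
  "partial_u f = (\<lambda>(t, u) i. deriv (\<lambda>s. f (t, s) i) u)"

text \<open>By Euler's formula this subspace contains \<open>f z\<close>; it has dimension 2 exactly if the induced map
  of projective spaces is defined and immersive at \<open>z\<close>, and is then the embedded tangent line.\<close>

definition tangent_line ::
    "(complex \<times> complex \<Rightarrow> nat \<Rightarrow> complex) \<Rightarrow> complex \<times> complex \<Rightarrow> (nat \<Rightarrow> complex) set" where
  "tangent_line f z = cfun.span {partial_t f z, partial_u f z}"

definition embeds_line :: "(complex \<times> complex \<Rightarrow> nat \<Rightarrow> complex) \<Rightarrow> bool" where
  "embeds_line f \<longleftrightarrow>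
     (\<forall>z. z \<noteq> (0, 0) \<longrightarrow> f z \<noteq> 0 \<and> cfun.dim (tangent_line f z) = 2) \<and>
     (\<forall>z w. z \<noteq> (0, 0) \<longrightarrow> w \<noteq> (0, 0) \<longrightarrow> cfun.span {f z} = cfun.span {f w} \<longrightarrow>
        vanishing_form z w = 0)"

text \<open>The sections \<open>s\<^sub>1, \<dots>, s\<^bsub>g-1\<^esub>\<close> are a basis of \<open>H\<^sup>0(C, \<omega>\<^sub>C \<otimes> A)\<close>, and the map they define
  restricts to the given parametrization on each component.\<close>

definition given_by_complete_system :: "nat \<Rightarrow> complex \<Rightarrow> params \<Rightarrow> bool" where
  "given_by_complete_system g d a \<longleftrightarrow>
     (\<exists>(s :: nat \<Rightarrow> curve_section) c.
        inj_on s {1..g - 1} \<and> cfun.independent (s ` {1..g - 1}) \<and>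
        cfun.span (s ` {1..g - 1}) = prym_sections g a 1 \<and>
        (\<forall>j. c j \<noteq> 0 \<and> (\<forall>i\<in>{1..g - 1}. \<forall>z. s i (j, z) = c j * prym_map g d a j z i)))"

definition prym_canonical_binary_curve :: "nat \<Rightarrow> complex \<Rightarrow> params \<Rightarrow> bool" where
  "prym_canonical_binary_curve g d a \<longleftrightarrow>
     (\<forall>j. inj_on (\<lambda>i. a (i, j)) {1..g - 1} \<and> (\<forall>i\<in>{1..g - 1}. a (i, j) \<noteq> 0)) \<and>
     (\<forall>j. embeds_line (prym_map g d a j)) \<and>
     (\<forall>l\<in>{1..g + 1}. \<forall>j.
        cfun.span {prym_map g d a j (prym_node g a l j)} = cfun.span {node_image g l}) \<and>
     inj_on (\<lambda>l. cfun.span {node_image g l}) {1..g + 1} \<and>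
     prym_component g d a Br1 \<inter> prym_component g d a Br2 =
       (\<lambda>l. cfun.span {node_image g l}) ` {1..g + 1} \<and>
     (\<forall>l\<in>{1..g + 1}.
        tangent_line (prym_map g d a Br1) (prym_node g a l Br1) \<noteq>
        tangent_line (prym_map g d a Br2) (prym_node g a l Br2)) \<and>
     given_by_complete_system g d a"

end

theory Submission
  imports Defs "HOL-Computational_Algebra.Polynomial"
begin

text \<open>Let \<open>R\<^sub>q\<close> be the sections of \<open>(\<omega>\<^sub>C \<otimes> A)\<^sup>q\<close> and let \<open>B\<^sub>q\<close> be the larger space of pairs of forms of
degree \<open>q (g - 1)\<close> on the two lines, with no condition at the nodes. A pair lies in \<open>R\<^sub>q\<close> when its
gluing defect, one linear functional for each node, vanishes at every node; multiplying with
\<open>v \<in> R\<^sub>1\<close> multiplies the defect at a node by the value of \<open>v\<close> there.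

Before gluing there is no obstruction: \<open>R\<^sub>1\<close> contains two sections without a common zero on either
line, and the Koszul complex of \<open>B\<close> is then exact at \<open>\<Lambda>\<^sup>p R\<^sub>1 \<otimes> B\<^sub>2\<close> (\<open>koszul_exact_of_pencil\<close>). A
cycle over \<open>R\<^sub>2\<close> is therefore the boundary of some \<open>Y \<in> \<Lambda>\<^sup>p\<^sup>+\<^sup>1 R\<^sub>1 \<otimes> B\<^sub>1\<close>, and only the defects
of \<open>Y\<close> keep it from having coefficients in \<open>R\<^sub>1\<close>. The defect at a node \<open>l\<close> is an element of
\<open>\<Lambda>\<^sup>p\<^sup>+\<^sup>1 R\<^sub>1\<close>; the boundary of \<open>Y\<close> has no defect, so contraction with the value at \<open>l\<close> kills it,
and it is a combination of wedges \<open>u\<close> of sections that vanish at \<open>l\<close>. Hence property \<open>N\<^sub>p\<close> holds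
as soon as the differential of \<open>u \<otimes> b\<close> is a boundary over \<open>R\<close> whenever the \<open>p + 1\<close> factors of \<open>u\<close>
vanish at \<open>l\<close> and \<open>b\<close> has defect 1 at \<open>l\<close> and 0 elsewhere
(\<open>koszul_vanishes_of_node_contributions\<close>).

If the factors of \<open>u\<close> vanish at a second node \<open>P\<close> too, this element comes from the partial
normalization at \<open>P\<close>: sections that vanish at \<open>P\<close> are the sections of the partial normalization
times the equation of \<open>P\<close>. There the element is a cycle, so it is a boundary if \<open>N\<^sub>p\<close> holds for
the partial normalization (\<open>node_contribution_from_normalization\<close>). By multilinearity the factors
may be taken from a spanning set \<open>s\<^sub>i - c\<^sub>i s\<^sub>i\<^sub>0\<close> of the sections vanishing at \<open>l\<close>, where
\<open>s\<^sub>1, \<dots>, s\<^bsub>g-1\<^esub>\<close> are the coordinates; each of these vanishes at every node \<open>P\<^sub>r\<close> with \<open>r < g\<close>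
other than \<open>P\<^sub>i\<close> and \<open>P\<^sub>i\<^sub>0\<close>. So \<open>p + 1\<close> factors all vanish at some \<open>P\<close> from a given set of
\<open>k \<ge> p + 3\<close> nodes (\<open>property_N_of_normalizations\<close>). The nodes to use are those whose removal
leaves a Prym-canonical binary curve of genus \<open>g - 1\<close> with the same gluing signs: the first \<open>k\<close> if
\<open>g = 2k\<close>, and \<open>k + 1, \<dots>, 2k\<close> if \<open>g = 2k + 1\<close>.

The curve itself is studied through one observation: up to a constant, each coordinate of the
parametrization is the differential with just two nonzero residues (\<open>prym_map_residue_pair\<close>). It
is a Prym-canonical binary curve once the parameters on each line are distinct and nonzero and no
affine map takes the first three parameters of one line to those of the other. All conditions are
nonvanishing conditions for polynomials in the parameters, and finitely many nonzero polynomials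
have a common point where none of them vanishes.\<close>

section \<open>Linear maps on formal Koszul chains\<close>

text \<open>Chains and sections are functions, but the algebra below is done without evaluating them;
pointwise expansion is switched off for the simplifier.\<close>

lemmas fun_apply = plus_fun_apply zero_fun_apply times_fun_apply minus_apply uminus_apply

declare fun_apply [simp del]

lemma vector_space_pair_cscale: "vector_space_pair cscale cscale"
  by (simp add: vector_space_pair_def cfun.vector_space_axioms)

lemma linear_cscaleI:
  assumes "\<And>x y. f (x + y) = f x + f y" and "\<And>c x. f (cscale c x) = cscale c (f x)"
  shows "Vector_Spaces.linear cscale cscale f"
  using assms by (simp add: Vector_Spaces.linear_iff cfun.vector_space_axioms)

lemma cscale_minus_one: "cscale (-1) x = - x"
  by (auto simp: cscale_def fun_eq_iff fun_apply)

lemma mult_cscale_right: "f * cscale c w = cscale c (f * w)"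
  by (auto simp: cscale_def fun_eq_iff fun_apply)

lemma mult_cscale_left: "cscale c f * w = cscale c (f * w)"
  by (auto simp: cscale_def fun_eq_iff fun_apply)

lemma cscale_apply: "cscale c f x = c * f x"
  by (simp add: cscale_def)

text \<open>The linear extension of a map given on symbols.\<close>

definition lift ::
    "(('x \<Rightarrow> complex) list \<Rightarrow> ('x \<Rightarrow> complex) \<Rightarrow> 'z \<Rightarrow> complex) \<Rightarrow> 'x koszul_chain \<Rightarrow> 'z \<Rightarrow> complex"
  where "lift \<phi> x = (\<Sum>z | x z \<noteq> 0. cscale (x z) (\<phi> (fst z) (snd z)))"

lemma koszul_map_eq_lift: "koszul_map = lift koszul_symb"
  by (simp add: fun_eq_iff koszul_map_def lift_def)

text \<open>Operations change the length of the lists, so they are compared on the span of symbols of all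
lengths.\<close>

definition all_chains :: "'x koszul_chain set" where
  "all_chains = cfun.span {symb v w | v w. True}"

lemma koszul_chains_subset_all: "koszul_chains m V W \<subseteq> all_chains"
  unfolding koszul_chains_def all_chains_def by (rule cfun.span_mono) auto

lemma subspace_all_chains: "cfun.subspace all_chains"
  by (simp add: all_chains_def)

lemma subspace_koszul_chains: "cfun.subspace (koszul_chains m V W)"
  by (simp add: koszul_chains_def)

lemma subspace_koszul_relations: "cfun.subspace (koszul_relations m V W)"
  by (simp add: koszul_relations_def)

lemmas koszul_relations_closed =
  cfun.subspace_0[OF subspace_koszul_relations]
  cfun.subspace_add[OF subspace_koszul_relations]
  cfun.subspace_diff[OF subspace_koszul_relations]
  cfun.subspace_neg[OF subspace_koszul_relations]
  cfun.subspace_scale[OF subspace_koszul_relations]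

lemmas koszul_chains_closed =
  cfun.subspace_0[OF subspace_koszul_chains]
  cfun.subspace_add[OF subspace_koszul_chains]
  cfun.subspace_diff[OF subspace_koszul_chains]
  cfun.subspace_neg[OF subspace_koszul_chains]
  cfun.subspace_scale[OF subspace_koszul_chains]

lemmas all_chains_closed =
  cfun.subspace_0[OF subspace_all_chains]
  cfun.subspace_add[OF subspace_all_chains]
  cfun.subspace_diff[OF subspace_all_chains]
  cfun.subspace_neg[OF subspace_all_chains]
  cfun.subspace_scale[OF subspace_all_chains]

lemma symb_in_all: "symb v w \<in> all_chains"
  unfolding all_chains_def by (rule cfun.span_base) auto

lemma symb_in_chains:
  "length v = m \<Longrightarrow> set v \<subseteq> V \<Longrightarrow> w \<in> W \<Longrightarrow> symb v w \<in> koszul_chains m V W"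
  unfolding koszul_chains_def by (rule cfun.span_base) auto

lemma koszul_chains_mono:
  "V \<subseteq> V' \<Longrightarrow> W \<subseteq> W' \<Longrightarrow> koszul_chains m V W \<subseteq> koszul_chains m V' W'"
  unfolding koszul_chains_def by (rule cfun.span_mono) blast

lemma koszul_relations_mono:
  "V \<subseteq> V' \<Longrightarrow> W \<subseteq> W' \<Longrightarrow> koszul_relations m V W \<subseteq> koszul_relations m V' W'"
  unfolding koszul_relations_def by (rule cfun.span_mono) blast

lemma koszul_chains_induct [consumes 1, case_names zero step]:
  assumes "x \<in> koszul_chains m V W"
    and "P 0"
    and "\<And>c v w y. length v = m \<Longrightarrow> set v \<subseteq> V \<Longrightarrow> w \<in> W \<Longrightarrow> y \<in> koszul_chains m V W \<Longrightarrow> P y \<Longrightarrow>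
           P (cscale c (symb v w) + y)"
  shows "P x"
proof -
  have "x \<in> koszul_chains m V W \<and> P x"
    using assms(1)[unfolded koszul_chains_def]
  proof (induction rule: cfun.span_induct_alt)
    case base
    then show ?case by (simp add: assms(2) koszul_chains_closed)
  next
    case (step c x y)
    then obtain v w where "x = symb v w" "length v = m" "set v \<subseteq> V" "w \<in> W" by auto
    with step show ?case
      by (auto intro!: assms(3) koszul_chains_closed symb_in_chains)
  qed
  then show ?thesis ..
qed

lemma all_chains_induct [consumes 1, case_names zero step]:
  assumes "x \<in> all_chains"
    and "P 0"
    and "\<And>c v w y. y \<in> all_chains \<Longrightarrow> P y \<Longrightarrow> P (cscale c (symb v w) + y)"
  shows "P x"
proof -
  have "x \<in> all_chains \<and> P x"
    using assms(1)[unfolded all_chains_def]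
  proof (induction rule: cfun.span_induct_alt)
    case base
    then show ?case by (simp add: assms(2) all_chains_closed)
  next
    case (step c x y)
    then show ?case
      by (auto intro!: assms(3) all_chains_closed symb_in_all)
  qed
  then show ?thesis ..
qed

lemma finite_support: "x \<in> all_chains \<Longrightarrow> finite {z. x z \<noteq> 0}"
  unfolding all_chains_def
proof (induction rule: cfun.span_induct_alt)
  case base
  then show ?case by (simp add: fun_apply)
next
  case (step c x y)
  then obtain v w where "x = symb v w" by auto
  then have "{z. (cscale c x + y) z \<noteq> 0} \<subseteq> insert (v, w) {z. y z \<noteq> 0}"
    by (auto simp: cscale_def symb_def fun_apply split: if_splits)
  then show ?case using step by (meson finite_insert finite_subset)
qed

lemma lift_superset:
  assumes "finite A" "{z. x z \<noteq> 0} \<subseteq> A"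
  shows "lift \<phi> x = (\<Sum>z\<in>A. cscale (x z) (\<phi> (fst z) (snd z)))"
  unfolding lift_def using assms
  by (intro sum.mono_neutral_left) (auto simp: cfun.scale_zero_left)

lemma lift_zero [simp]: "lift \<phi> 0 = 0"
  by (simp add: lift_def fun_apply)

lemma lift_step:
  assumes "y \<in> all_chains"
  shows "lift \<phi> (cscale c (symb v w) + y) = cscale c (\<phi> v w) + lift \<phi> y"
proof -
  let ?A = "insert (v, w) {z. y z \<noteq> 0}"
  have fin: "finite ?A" using finite_support[OF assms] by simp
  have sub: "{z. (cscale c (symb v w) + y) z \<noteq> 0} \<subseteq> ?A"
    by (auto simp: cscale_def symb_def fun_apply split: if_splits)
  have "lift \<phi> (cscale c (symb v w) + y) =
      (\<Sum>z\<in>?A. cscale ((cscale c (symb v w) + y) z) (\<phi> (fst z) (snd z)))"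
    by (rule lift_superset[OF fin sub])
  also have "\<dots> = (\<Sum>z\<in>?A. cscale (c * symb v w z) (\<phi> (fst z) (snd z)))
      + (\<Sum>z\<in>?A. cscale (y z) (\<phi> (fst z) (snd z)))"
    by (simp add: cscale_apply fun_apply cfun.scale_left_distrib sum.distrib)
  also have "(\<Sum>z\<in>?A. cscale (y z) (\<phi> (fst z) (snd z))) = lift \<phi> y"
    by (rule lift_superset[symmetric, OF fin]) auto
  also have "(\<Sum>z\<in>?A. cscale (c * symb v w z) (\<phi> (fst z) (snd z))) =
      (\<Sum>z\<in>{(v, w)}. cscale (c * symb v w z) (\<phi> (fst z) (snd z)))"
    using fin by (intro sum.mono_neutral_right) (auto simp: symb_def cfun.scale_zero_left)
  finally show ?thesis by (simp add: symb_def)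
qed

lemma lift_symb [simp]: "lift \<phi> (symb v w) = \<phi> v w"
  using lift_step[of 0 \<phi> 1 v w] by (simp add: all_chains_closed)

lemma lift_add:
  assumes "x \<in> all_chains" "y \<in> all_chains"
  shows "lift \<phi> (x + y) = lift \<phi> x + lift \<phi> y"
  using assms(1)
  by (induction rule: all_chains_induct)
     (simp_all add: lift_step add.assoc all_chains_closed assms(2))

lemma lift_cscale:
  assumes "x \<in> all_chains"
  shows "lift \<phi> (cscale a x) = cscale a (lift \<phi> x)"
  using assms
  by (induction rule: all_chains_induct)
     (simp_all add: lift_step all_chains_closed cfun.scale_right_distrib)

lemma lift_diff:
  assumes "x \<in> all_chains" "y \<in> all_chains"
  shows "lift \<phi> (x - y) = lift \<phi> x - lift \<phi> y"
  using lift_add[OF assms(1) all_chains_closed(5)[OF assms(2)], of \<phi> "-1"]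
    lift_cscale[OF assms(2), of \<phi> "-1"]
  by (simp add: cscale_minus_one)

lemma lift_minus:
  assumes "x \<in> all_chains"
  shows "lift \<phi> (- x) = - lift \<phi> x"
  using lift_cscale[OF assms, of \<phi> "-1"] by (simp add: cscale_minus_one)

lemma lift_sum:
  assumes "\<And>i. i \<in> I \<Longrightarrow> x i \<in> all_chains"
  shows "lift \<phi> (\<Sum>i\<in>I. x i) = (\<Sum>i\<in>I. lift \<phi> (x i))"
  using assms
proof (induction I rule: infinite_finite_induct)
  case (insert i I)
  then show ?case
    by (simp add: lift_add cfun.subspace_sum[OF subspace_all_chains])
qed auto

lemma lift_mem:
  assumes "x \<in> koszul_chains m V W" "cfun.subspace T"
    and "\<And>v w. length v = m \<Longrightarrow> set v \<subseteq> V \<Longrightarrow> w \<in> W \<Longrightarrow> \<phi> v w \<in> T"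
  shows "lift \<phi> x \<in> T"
  using assms(1)
proof (induction rule: koszul_chains_induct)
  case zero
  then show ?case by (simp add: cfun.subspace_0 assms(2))
next
  case (step c v w y)
  then show ?case
    using koszul_chains_subset_all[of m V W]
    by (auto simp: lift_step intro!: cfun.subspace_add cfun.subspace_scale assms)
qed

lemma lift_in_all:
  assumes "x \<in> all_chains" "\<And>v w. \<phi> v w \<in> all_chains"
  shows "lift \<phi> x \<in> all_chains"
  using assms(1)
  by (induction rule: all_chains_induct)
     (auto simp: lift_step intro!: all_chains_closed assms(2))

lemma lift_lift:
  assumes "x \<in> all_chains" "\<And>v w. \<phi> v w \<in> all_chains"
  shows "lift \<psi> (lift \<phi> x) = lift (\<lambda>v w. lift \<psi> (\<phi> v w)) x"
  using assms(1)
proof (induction rule: all_chains_induct)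
  case zero
  then show ?case by simp
next
  case (step c v w y)
  then show ?case
    using lift_in_all[OF step(1) assms(2)] assms(2)[of v w]
    by (simp add: lift_step lift_add lift_cscale all_chains_closed)
qed

lemma lift_congruent:
  assumes "x \<in> koszul_chains m V W" "cfun.subspace T"
    and "\<And>v w. length v = m \<Longrightarrow> set v \<subseteq> V \<Longrightarrow> w \<in> W \<Longrightarrow> \<phi> v w - \<psi> v w \<in> T"
  shows "lift \<phi> x - lift \<psi> x \<in> T"
proof -
  have "lift (\<lambda>v w. \<phi> v w - \<psi> v w) x = lift \<phi> x - lift \<psi> x"
    by (simp add: lift_def sum_subtractf cfun.scale_right_diff_distrib)
  then show ?thesis using lift_mem[OF assms(1,2), of "\<lambda>v w. \<phi> v w - \<psi> v w"] assms(3) by simp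
qed

lemma lift_plus: "lift (\<lambda>v w. \<phi> v w + \<psi> v w) x = lift \<phi> x + lift \<psi> x"
  by (simp add: lift_def sum.distrib cfun.scale_right_distrib)

lemma lift_minus_fun: "lift (\<lambda>v w. - \<phi> v w) x = - lift \<phi> x"
  by (simp add: lift_def sum_negf)

lemma lift_ident: "x \<in> all_chains \<Longrightarrow> lift symb x = x"
  by (induction rule: all_chains_induct) (simp_all add: lift_step)

text \<open>A map given on symbols descends to \<open>\<Lambda>\<^sup>m V \<otimes> W\<close>, modulo \<open>T\<close> in the target, when it satisfies
  the defining relations modulo \<open>T\<close>.\<close>

definition respects_relations ::
    "nat \<Rightarrow> ('x \<Rightarrow> complex) set \<Rightarrow> ('x \<Rightarrow> complex) set \<Rightarrow> ('z \<Rightarrow> complex) set \<Rightarrow>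
     (('x \<Rightarrow> complex) list \<Rightarrow> ('x \<Rightarrow> complex) \<Rightarrow> 'z \<Rightarrow> complex) \<Rightarrow> bool" where
  "respects_relations m V W T \<phi> \<longleftrightarrow>
     (\<forall>v i a b s t w. length v = m \<longrightarrow> set v \<subseteq> V \<longrightarrow> i < m \<longrightarrow> s \<in> V \<longrightarrow> t \<in> V \<longrightarrow> w \<in> W \<longrightarrow>
        \<phi> (v[i := cscale a s + cscale b t]) w
          - cscale a (\<phi> (v[i := s]) w) - cscale b (\<phi> (v[i := t]) w) \<in> T) \<and>
     (\<forall>v a b w w'. length v = m \<longrightarrow> set v \<subseteq> V \<longrightarrow> w \<in> W \<longrightarrow> w' \<in> W \<longrightarrow>
        \<phi> v (cscale a w + cscale b w') - cscale a (\<phi> v w) - cscale b (\<phi> v w') \<in> T) \<and>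
     (\<forall>v w. length v = m \<longrightarrow> set v \<subseteq> V \<longrightarrow> \<not> distinct v \<longrightarrow> w \<in> W \<longrightarrow> \<phi> v w \<in> T)"

lemma symb_respects_relations: "respects_relations m V W (koszul_relations m V W) symb"
  unfolding respects_relations_def koszul_relations_def
  by (intro conjI allI impI; rule cfun.span_base; blast)

lemmas symb_slot = symb_respects_relations[unfolded respects_relations_def, THEN conjunct1, rule_format]
lemmas symb_coeff = symb_respects_relations[unfolded respects_relations_def, THEN conjunct2, THEN conjunct1, rule_format]
lemmas symb_repeat = symb_respects_relations[unfolded respects_relations_def, THEN conjunct2, THEN conjunct2, rule_format]

lemma lift_relations:
  assumes x: "x \<in> koszul_relations m V W" and T: "cfun.subspace T"
    and r: "respects_relations m V W T \<phi>"
  shows "lift \<phi> x \<in> T"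
proof -
  have "x \<in> all_chains \<and> lift \<phi> x \<in> T"
    using x[unfolded koszul_relations_def]
  proof (induction rule: cfun.span_induct_alt)
    case base
    then show ?case by (simp add: all_chains_closed cfun.subspace_0 T)
  next
    case (step c x y)
    have "x \<in> all_chains \<and> lift \<phi> x \<in> T"
      using step(1)
      by (elim UnE CollectE exE conjE)
         (use r in \<open>auto simp: respects_relations_def lift_diff lift_cscale symb_in_all all_chains_closed\<close>)
    with step(2) show ?case
      by (auto simp: lift_add lift_cscale all_chains_closed intro!: cfun.subspace_add cfun.subspace_scale T)
  qed
  then show ?thesis ..
qed

section \<open>Operations on Koszul chains\<close>

definition chain_map ::
    "(('x \<Rightarrow> complex) \<Rightarrow> 'y \<Rightarrow> complex) \<Rightarrow> (('x \<Rightarrow> complex) \<Rightarrow> 'y \<Rightarrow> complex) \<Rightarrow>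
     'x koszul_chain \<Rightarrow> 'y koszul_chain" where
  "chain_map \<theta> S = lift (\<lambda>v w. symb (map \<theta> v) (S w))"

abbreviation coeff_map ::
    "(('x \<Rightarrow> complex) \<Rightarrow> 'x \<Rightarrow> complex) \<Rightarrow> 'x koszul_chain \<Rightarrow> 'x koszul_chain" where
  "coeff_map \<equiv> chain_map (\<lambda>v. v)"

definition wedge :: "('x \<Rightarrow> complex) \<Rightarrow> 'x koszul_chain \<Rightarrow> 'x koszul_chain" where
  "wedge f = lift (\<lambda>v w. symb (f # v) w)"

lemma chain_map_symb [simp]: "chain_map \<theta> S (symb v w) = symb (map \<theta> v) (S w)"
  by (simp add: chain_map_def)

lemma wedge_symb [simp]: "wedge f (symb v w) = symb (f # v) w"
  by (simp add: wedge_def)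

lemma koszul_map_symb [simp]: "koszul_map (symb v w) = koszul_symb v w"
  by (simp add: koszul_map_eq_lift)

lemma wedge_in_all: "x \<in> all_chains \<Longrightarrow> wedge f x \<in> all_chains"
  unfolding wedge_def by (erule lift_in_all) (rule symb_in_all)

lemma chain_map_in_all: "x \<in> all_chains \<Longrightarrow> chain_map \<theta> S x \<in> all_chains"
  unfolding chain_map_def by (erule lift_in_all) (rule symb_in_all)

lemma koszul_symb_in_all: "koszul_symb v w \<in> all_chains"
  unfolding koszul_symb_def
  by (intro cfun.subspace_sum[OF subspace_all_chains] all_chains_closed symb_in_all)

lemma koszul_map_in_all: "x \<in> all_chains \<Longrightarrow> koszul_map x \<in> all_chains"
  unfolding koszul_map_eq_lift by (erule lift_in_all) (rule koszul_symb_in_all)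

lemmas wedge_add = lift_add[where \<phi> = "\<lambda>v w. symb (f # v) w" for f, folded wedge_def]
lemmas wedge_diff = lift_diff[where \<phi> = "\<lambda>v w. symb (f # v) w" for f, folded wedge_def]
lemmas wedge_minus = lift_minus[where \<phi> = "\<lambda>v w. symb (f # v) w" for f, folded wedge_def]
lemmas chain_map_add = lift_add[where \<phi> = "\<lambda>v w. symb (map \<theta> v) (S w)" for \<theta> S, folded chain_map_def]
lemmas chain_map_diff = lift_diff[where \<phi> = "\<lambda>v w. symb (map \<theta> v) (S w)" for \<theta> S, folded chain_map_def]
lemmas chain_map_minus = lift_minus[where \<phi> = "\<lambda>v w. symb (map \<theta> v) (S w)" for \<theta> S, folded chain_map_def]
lemmas koszul_map_add = lift_add[where \<phi> = koszul_symb, folded koszul_map_eq_lift]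
lemmas koszul_map_diff = lift_diff[where \<phi> = koszul_symb, folded koszul_map_eq_lift]
lemmas koszul_map_minus = lift_minus[where \<phi> = koszul_symb, folded koszul_map_eq_lift]
lemmas koszul_map_sum = lift_sum[where \<phi> = koszul_symb, folded koszul_map_eq_lift]
lemmas koszul_map_cscale = lift_cscale[where \<phi> = koszul_symb, folded koszul_map_eq_lift]

lemma wedge_chains:
  assumes "x \<in> koszul_chains m V W" "f \<in> V"
  shows "wedge f x \<in> koszul_chains (Suc m) V W"
  unfolding wedge_def
  by (rule lift_mem[OF assms(1) subspace_koszul_chains]) (use assms(2) in \<open>auto intro!: symb_in_chains\<close>)

lemma chain_map_chains:
  assumes "x \<in> koszul_chains m V W" "\<And>v. v \<in> V \<Longrightarrow> \<theta> v \<in> V'" "\<And>w. w \<in> W \<Longrightarrow> S w \<in> W'"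
  shows "chain_map \<theta> S x \<in> koszul_chains m V' W'"
  unfolding chain_map_def
  by (rule lift_mem[OF assms(1) subspace_koszul_chains]) (auto simp: subset_iff intro!: symb_in_chains assms(2,3))

definition linear_into :: "('x \<Rightarrow> complex) set \<Rightarrow> ('y \<Rightarrow> complex) set \<Rightarrow> (('x \<Rightarrow> complex) \<Rightarrow> 'y \<Rightarrow> complex) \<Rightarrow> bool" where
  "linear_into W W' S \<longleftrightarrow> (\<forall>w\<in>W. S w \<in> W') \<and>
     (\<forall>w\<in>W. \<forall>w'\<in>W. \<forall>a b. S (cscale a w + cscale b w') = cscale a (S w) + cscale b (S w'))"

lemma chain_map_relations:
  assumes x: "x \<in> koszul_relations m V W" and "linear_into V V' \<theta>" "linear_into W W' S"
  shows "chain_map \<theta> S x \<in> koszul_relations m V' W'"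
  unfolding chain_map_def
proof (rule lift_relations[OF x subspace_koszul_relations])
  show "respects_relations m V W (koszul_relations m V' W') (\<lambda>v w. symb (map \<theta> v) (S w))"
    using assms(2,3)
    by (auto simp: respects_relations_def linear_into_def map_update distinct_map subset_iff
        intro!: symb_slot symb_coeff symb_repeat)
qed

lemma wedge_relations:
  assumes "x \<in> koszul_relations m V W" "f \<in> V"
  shows "wedge f x \<in> koszul_relations (Suc m) V W"
  unfolding wedge_def
proof (rule lift_relations[OF assms(1) subspace_koszul_relations])
  have "symb (f # v[i := cscale a s + cscale b t]) w - cscale a (symb (f # v[i := s]) w)
      - cscale b (symb (f # v[i := t]) w) \<in> koszul_relations (Suc m) V W"
    if "length v = m" "set v \<subseteq> V" "i < m" "s \<in> V" "t \<in> V" "w \<in> W" for v i a b s t w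
    using symb_slot[of "f # v" "Suc m" V "Suc i" s t w W a b] that assms(2) by simp
  moreover have "symb (f # v) w \<in> koszul_relations (Suc m) V W"
    if "length v = m" "set v \<subseteq> V" "\<not> distinct v" "w \<in> W" for v w
    using that assms(2) by (intro symb_repeat) auto
  ultimately show "respects_relations m V W (koszul_relations (Suc m) V W) (\<lambda>v w. symb (f # v) w)"
    using assms(2) by (auto simp: respects_relations_def intro!: symb_coeff)
qed

text \<open>Expand the symbol with the repeated entry \<open>a + b\<close> in its first two positions.\<close>

lemma symb_swap:
  assumes "cfun.subspace V" "a \<in> V" "b \<in> V" "set v \<subseteq> V" "w \<in> W"
  shows "symb (a # b # v) w + symb (b # a # v) w \<in> koszul_relations (Suc (Suc (length v))) V W"
proof -
  let ?R = "koszul_relations (Suc (Suc (length v))) V W"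
  have ab: "a + b \<in> V" using assms by (simp add: cfun.subspace_add)
  have h0: "symb ((a + b) # c # v) w - symb (a # c # v) w - symb (b # c # v) w \<in> ?R" if "c \<in> V" for c
    using symb_slot[of "a # c # v" _ V 0 a b w W 1 1] assms that by simp
  have h1: "symb (c # (a + b) # v) w - symb (c # a # v) w - symb (c # b # v) w \<in> ?R" if "c \<in> V" for c
    using symb_slot[of "c # a # v" _ V 1 a b w W 1 1] assms that by simp
  have h2: "symb (c # c # v) w \<in> ?R" if "c \<in> V" for c
    using assms that by (intro symb_repeat) auto
  have eq: "symb (a # b # v) w + symb (b # a # v) w =
      symb ((a + b) # (a + b) # v) w
      - (symb ((a + b) # (a + b) # v) w - symb (a # (a + b) # v) w - symb (b # (a + b) # v) w)
      - (symb (a # (a + b) # v) w - symb (a # a # v) w - symb (a # b # v) w)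
      - (symb (b # (a + b) # v) w - symb (b # a # v) w - symb (b # b # v) w)
      - symb (a # a # v) w - symb (b # b # v) w"
    by (simp add: algebra_simps)
  show ?thesis unfolding eq
    by (intro koszul_relations_closed h0 h1 h2 assms ab)
qed

lemma wedge_wedge_swap:
  assumes "x \<in> koszul_chains m V W" "cfun.subspace V" "a \<in> V" "b \<in> V"
  shows "wedge a (wedge b x) + wedge b (wedge a x) \<in> koszul_relations (Suc (Suc m)) V W"
proof -
  have x: "x \<in> all_chains" using assms(1) koszul_chains_subset_all by blast
  have "wedge a (wedge b x) + wedge b (wedge a x)
      = lift (\<lambda>v w. symb (a # b # v) w + symb (b # a # v) w) x"
    unfolding wedge_def by (simp add: lift_lift x symb_in_all lift_plus)
  also have "\<dots> \<in> koszul_relations (Suc (Suc m)) V W"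
    using assms(2-) symb_swap
    by (intro lift_mem[OF assms(1) subspace_koszul_relations]) blast
  finally show ?thesis .
qed

lemma wedge_wedge_self:
  assumes "x \<in> koszul_chains m V W" "a \<in> V"
  shows "wedge a (wedge a x) \<in> koszul_relations (Suc (Suc m)) V W"
proof -
  have x: "x \<in> all_chains" using assms(1) koszul_chains_subset_all by blast
  have "wedge a (wedge a x) = lift (\<lambda>v w. symb (a # a # v) w) x"
    unfolding wedge_def by (simp add: lift_lift x symb_in_all)
  also have "\<dots> \<in> koszul_relations (Suc (Suc m)) V W"
    using assms(2-)
    by (intro lift_mem[OF assms(1) subspace_koszul_relations] symb_repeat) auto
  finally show ?thesis .
qed

lemma koszul_symb_Nil [simp]: "koszul_symb [] w = 0"
  by (simp add: koszul_symb_def)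

text \<open>Most facts on the differential are proved by induction along this recursion.\<close>

lemma koszul_symb_Cons:
  "koszul_symb (a # v) w = - symb v (a * w) - wedge a (koszul_symb v w)"
proof -
  have "wedge a (koszul_symb v w) =
      (\<Sum>l<length v. cscale ((-1) ^ Suc l) (symb (a # take l v @ drop (Suc l) v) (v ! l * w)))"
    unfolding koszul_symb_def wedge_def
    by (simp add: lift_sum lift_cscale lift_minus symb_in_all all_chains_closed)
  then show ?thesis
    unfolding koszul_symb_def
    by (simp add: sum.lessThan_Suc_shift cscale_minus_one[symmetric] cfun.scale_sum_right del: cfun.scale_minus_left sum.lessThan_Suc)
qed

lemma koszul_symb_chains:
  assumes "set v \<subseteq> V" "\<And>a. a \<in> set v \<Longrightarrow> a * w \<in> W"
  shows "koszul_symb v w \<in> koszul_chains (length v - 1) V W"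
proof -
  have "symb (take l v @ drop (Suc l) v) (v ! l * w) \<in> koszul_chains (length v - 1) V W"
    if "l < length v" for l
    using assms that set_take_subset[of l v] set_drop_subset[of "Suc l" v]
    by (intro symb_in_chains) auto
  then show ?thesis
    unfolding koszul_symb_def
    by (intro cfun.subspace_sum[OF subspace_koszul_chains] koszul_chains_closed) auto
qed

lemma koszul_map_chains:
  assumes "x \<in> koszul_chains m V W" "\<And>v w. v \<in> V \<Longrightarrow> w \<in> W \<Longrightarrow> v * w \<in> W'"
  shows "koszul_map x \<in> koszul_chains (m - 1) V W'"
  unfolding koszul_map_eq_lift
  by (rule lift_mem[OF assms(1) subspace_koszul_chains]) (use koszul_symb_chains assms(2) in blast)

lemma koszul_map_degree_zero:
  assumes "x \<in> koszul_chains 0 V W"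
  shows "koszul_map x = 0"
proof -
  have "koszul_map x \<in> {0}"
    unfolding koszul_map_eq_lift
    by (rule lift_mem[OF assms]) (auto simp: cfun.subspace_def)
  then show ?thesis by simp
qed

text \<open>Wedging with \<open>a\<close> is a contracting homotopy for multiplication by \<open>a\<close>, up to sign.\<close>

lemma koszul_map_wedge:
  assumes "x \<in> all_chains"
  shows "koszul_map (wedge a x) = - coeff_map ((*) a) x - wedge a (koszul_map x)"
proof -
  have "koszul_map (wedge a x) = lift (\<lambda>v w. - symb v (a * w) + - wedge a (koszul_symb v w)) x"
    using assms by (simp add: koszul_map_eq_lift wedge_def[of a] lift_lift symb_in_all koszul_symb_Cons)
  also have "\<dots> = - coeff_map ((*) a) x - wedge a (koszul_map x)"
    unfolding lift_plus lift_minus_fun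
    using assms by (simp add: koszul_map_eq_lift wedge_def chain_map_def lift_lift koszul_symb_in_all)
  finally show ?thesis .
qed

lemma koszul_map_chain_map:
  assumes "x \<in> all_chains" "\<And>v w. S' (v * w) = \<theta> v * S w"
  shows "koszul_map (chain_map \<theta> S x) = chain_map \<theta> S' (koszul_map x)"
proof -
  have "koszul_symb (map \<theta> v) (S w) = chain_map \<theta> S' (koszul_symb v w)" for v w
    unfolding koszul_symb_def chain_map_def
    by (simp add: lift_sum lift_cscale lift_minus symb_in_all all_chains_closed assms(2) take_map drop_map)
  then show ?thesis
    using assms(1) unfolding koszul_map_eq_lift chain_map_def
    by (simp add: lift_lift symb_in_all koszul_symb_in_all)
qed

lemma wedge_coeff_map:
  assumes "x \<in> all_chains"
  shows "wedge a (coeff_map S x) = coeff_map S (wedge a x)"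
  using assms unfolding wedge_def chain_map_def by (simp add: lift_lift symb_in_all)

text \<open>The square of the differential is zero already on symbols, without using the relations: in the
recursion, the two terms with multiplication by \<open>a\<close> cancel because this multiplication commutes
with the differential.\<close>

lemma koszul_map_koszul_symb: "koszul_map (koszul_symb v w) = 0"
proof (induction v arbitrary: w)
  case Nil
  then show ?case by (simp add: koszul_map_eq_lift)
next
  case (Cons a v)
  have "koszul_map (koszul_symb (a # v) w) =
      - koszul_symb v (a * w) + coeff_map ((*) a) (koszul_symb v w)
      + wedge a (koszul_map (koszul_symb v w))"
    by (simp add: koszul_symb_Cons koszul_map_diff koszul_map_minus koszul_map_wedge symb_in_all
        koszul_symb_in_all wedge_in_all all_chains_closed)
  also have "coeff_map ((*) a) (koszul_symb v w) = koszul_symb v (a * w)"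
    using koszul_map_chain_map[of "symb v w" "(*) a" "\<lambda>v. v" "(*) a"]
    by (simp add: symb_in_all mult.left_commute)
  finally show ?case using Cons by (simp add: wedge_def)
qed

lemma koszul_map_koszul_map:
  assumes "x \<in> all_chains"
  shows "koszul_map (koszul_map x) = 0"
proof -
  have "koszul_map (koszul_map x) = lift (\<lambda>v w. koszul_map (koszul_symb v w)) x"
    using assms by (simp add: koszul_map_eq_lift lift_lift koszul_symb_in_all)
  then show ?thesis by (simp add: koszul_map_koszul_symb lift_def)
qed

section \<open>The differential modulo the relations\<close>

text \<open>By the recursion, the differential of a symbol that starts with \<open>b\<close> is minus the left side, so
this is the case of a repetition of the first entry; moving \<open>b\<close> past \<open>c\<close> reduces it to a shorter
list.\<close>

lemma koszul_symb_repeat_aux: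
  assumes V: "cfun.subspace V" and W: "\<And>v. v \<in> V \<Longrightarrow> v * w \<in> W"
    and "set v \<subseteq> V" "b \<in> set v"
  shows "wedge b (koszul_symb v w) + symb v (b * w) \<in> koszul_relations (length v) V W"
  using assms(3,4)
proof (induction v)
  case (Cons c v)
  define K where "K = koszul_symb v w"
  have K: "K \<in> koszul_chains (length v - 1) V W"
    unfolding K_def by (rule koszul_symb_chains) (use Cons.prems W in auto)
  have K0: "K = 0" if "v = []" using that by (simp add: K_def)
  have Kall: "K \<in> all_chains" using K koszul_chains_subset_all by blast
  have c: "c \<in> V" and b: "b \<in> V" and v: "set v \<subseteq> V" using Cons.prems by auto
  have eq: "wedge b (koszul_symb (c # v) w) + symb (c # v) (b * w)
      = - symb (b # v) (c * w) - wedge b (wedge c K) + symb (c # v) (b * w)"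
    by (simp add: koszul_symb_Cons K_def wedge_diff wedge_minus symb_in_all all_chains_closed
        wedge_in_all koszul_symb_in_all)
  show ?case
  proof (cases "b = c")
    case True
    have "wedge b (wedge b K) \<in> koszul_relations (length (c # v)) V W"
    proof (cases "v = []")
      case True
      then show ?thesis by (simp add: K0 wedge_def koszul_relations_closed)
    next
      case False
      then show ?thesis using wedge_wedge_self[OF K b] by simp
    qed
    then show ?thesis unfolding eq using True by (simp add: koszul_relations_closed)
  next
    case False
    then have bv: "b \<in> set v" using Cons.prems by simp
    then have "v \<noteq> []" by auto
    then have 1: "wedge b (wedge c K) + wedge c (wedge b K) \<in> koszul_relations (length (c # v)) V W"
      using wedge_wedge_swap[OF K V b c] by simp
    have 2: "wedge c (wedge b K + symb v (b * w)) \<in> koszul_relations (length (c # v)) V W"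
      using wedge_relations[OF Cons.IH[OF v bv] c] by (simp add: K_def)
    have 3: "symb (b # v) (c * w) \<in> koszul_relations (length (c # v)) V W"
      using bv b v c W by (intro symb_repeat) auto
    have "- symb (b # v) (c * w) - (wedge b (wedge c K) + wedge c (wedge b K))
        + wedge c (wedge b K + symb v (b * w)) \<in> koszul_relations (length (c # v)) V W"
      by (intro koszul_relations_closed 1 2 3)
    then show ?thesis unfolding eq
      by (simp add: wedge_add Kall wedge_in_all symb_in_all algebra_simps)
  qed
qed simp

lemma koszul_symb_slot:
  assumes W: "\<And>v. v \<in> V \<Longrightarrow> v * w \<in> W"
    and "set v \<subseteq> V" "i < length v" "s \<in> V" "t \<in> V"
  shows "koszul_symb (v[i := cscale a s + cscale b t]) w
          - cscale a (koszul_symb (v[i := s]) w) - cscale b (koszul_symb (v[i := t]) w)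
        \<in> koszul_relations (length v - 1) V W"
  using assms(2,3)
proof (induction v arbitrary: i)
  case (Cons c v)
  then have v: "set v \<subseteq> V" and c: "c \<in> V" by auto
  show ?case
  proof (cases i)
    case 0
    define K where "K = koszul_symb v w"
    have K: "K \<in> koszul_chains (length v - 1) V W"
      unfolding K_def by (rule koszul_symb_chains) (use Cons.prems W in auto)
    have 1: "symb v ((cscale a s + cscale b t) * w) - cscale a (symb v (s * w)) - cscale b (symb v (t * w))
        \<in> koszul_relations (length v) V W"
      using symb_coeff[of v "length v" V "s * w" W "t * w" a b] v W assms(4,5)
      by (simp add: distrib_right mult_cscale_left)
    have 2: "wedge (cscale a s + cscale b t) K - cscale a (wedge s K) - cscale b (wedge t K)
        \<in> koszul_relations (length v) V W"
    proof (cases "v = []")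
      case True
      then show ?thesis by (simp add: K_def wedge_def koszul_relations_closed)
    next
      case False
      have "lift (\<lambda>v w. symb ((cscale a s + cscale b t) # v) w) K
          - lift (\<lambda>v w. cscale a (symb (s # v) w) + cscale b (symb (t # v) w)) K
          \<in> koszul_relations (length v) V W"
      proof (rule lift_congruent[OF K subspace_koszul_relations])
        fix u w' assume u: "length u = length v - 1" "set u \<subseteq> V" "w' \<in> W"
        show "symb ((cscale a s + cscale b t) # u) w'
            - (cscale a (symb (s # u) w') + cscale b (symb (t # u) w')) \<in> koszul_relations (length v) V W"
          using symb_slot[of "s # u" "length v" V 0 s t w' W a b] u assms(4,5) False
          by (simp add: diff_diff_eq)
      qed
      moreover have "lift (\<lambda>v w. cscale a (symb (s # v) w) + cscale b (symb (t # v) w)) K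
          = cscale a (wedge s K) + cscale b (wedge t K)"
        by (simp add: lift_plus wedge_def lift_def cfun.scale_sum_right mult.commute)
      ultimately show ?thesis by (simp add: wedge_def diff_diff_eq)
    qed
    have "- (symb v ((cscale a s + cscale b t) * w) - cscale a (symb v (s * w)) - cscale b (symb v (t * w)))
        - (wedge (cscale a s + cscale b t) K - cscale a (wedge s K) - cscale b (wedge t K))
        \<in> koszul_relations (length v) V W"
      by (intro koszul_relations_closed 1 2)
    then show ?thesis
      using 0 by (simp add: koszul_symb_Cons K_def cfun.scale_right_diff_distrib algebra_simps)
  next
    case (Suc i')
    define u where "u r = v[i' := r]" for r
    have i': "i' < length v" using Cons.prems Suc by simp
    then have "v \<noteq> []" by auto
    have 1: "symb (u (cscale a s + cscale b t)) (c * w)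
        - cscale a (symb (u s) (c * w)) - cscale b (symb (u t) (c * w)) \<in> koszul_relations (length v) V W"
      unfolding u_def using v i' c W assms by (intro symb_slot) auto
    have 2: "wedge c (koszul_symb (u (cscale a s + cscale b t)) w
        - cscale a (koszul_symb (u s) w) - cscale b (koszul_symb (u t) w)) \<in> koszul_relations (length v) V W"
      using wedge_relations[OF Cons.IH[OF v i'] c] \<open>v \<noteq> []\<close> by (simp add: u_def)
    have 3: "koszul_symb ((c # v)[i := r]) w = - symb (u r) (c * w) - wedge c (koszul_symb (u r) w)" for r
      by (simp add: Suc koszul_symb_Cons u_def)
    have eq: "koszul_symb ((c # v)[i := cscale a s + cscale b t]) w
        - cscale a (koszul_symb ((c # v)[i := s]) w) - cscale b (koszul_symb ((c # v)[i := t]) w)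
      = - (symb (u (cscale a s + cscale b t)) (c * w)
          - cscale a (symb (u s) (c * w)) - cscale b (symb (u t) (c * w)))
        - wedge c (koszul_symb (u (cscale a s + cscale b t)) w
            - cscale a (koszul_symb (u s) w) - cscale b (koszul_symb (u t) w))"
      unfolding 3
      by (simp add: wedge_diff wedge_def[of c] lift_diff lift_add lift_cscale koszul_symb_in_all
          all_chains_closed diff_diff_eq cfun.scale_right_diff_distrib algebra_simps)
    show ?thesis unfolding eq length_Cons diff_Suc_1 by (intro koszul_relations_closed 1 2)
  qed
qed simp

lemma koszul_symb_coeff:
  assumes W: "\<And>v w. v \<in> V \<Longrightarrow> w \<in> W \<Longrightarrow> v * w \<in> W'"
    and "set v \<subseteq> V" "w \<in> W" "w' \<in> W"
  shows "koszul_symb v (cscale a w + cscale b w')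
          - cscale a (koszul_symb v w) - cscale b (koszul_symb v w')
        \<in> koszul_relations (length v - 1) V W'"
  using assms(2)
proof (induction v)
  case Nil
  then show ?case by (simp add: koszul_relations_closed)
next
  case (Cons c v)
  then have v: "set v \<subseteq> V" and c: "c \<in> V" by auto
  have 1: "symb v (c * (cscale a w + cscale b w')) - cscale a (symb v (c * w)) - cscale b (symb v (c * w'))
      \<in> koszul_relations (length v) V W'"
    using symb_coeff[of v "length v" V "c * w" W' "c * w'" a b] v c W assms(3,4)
    by (simp add: distrib_left mult_cscale_right)
  have 2: "wedge c (koszul_symb v (cscale a w + cscale b w')
      - cscale a (koszul_symb v w) - cscale b (koszul_symb v w')) \<in> koszul_relations (length v) V W'"
  proof (cases "v = []")
    case True
    then show ?thesis by (simp add: wedge_def koszul_relations_closed)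
  next
    case False
    then show ?thesis using wedge_relations[OF Cons.IH[OF v] c] by simp
  qed
  have eq: "koszul_symb (c # v) (cscale a w + cscale b w')
      - cscale a (koszul_symb (c # v) w) - cscale b (koszul_symb (c # v) w')
    = - (symb v (c * (cscale a w + cscale b w')) - cscale a (symb v (c * w)) - cscale b (symb v (c * w')))
      - wedge c (koszul_symb v (cscale a w + cscale b w')
          - cscale a (koszul_symb v w) - cscale b (koszul_symb v w'))"
    by (simp add: koszul_symb_Cons wedge_def[of c] lift_diff lift_add lift_cscale koszul_symb_in_all
        all_chains_closed diff_diff_eq cfun.scale_right_diff_distrib algebra_simps)
  show ?case unfolding eq length_Cons diff_Suc_1 by (intro koszul_relations_closed 1 2)
qed

lemma koszul_symb_repeat:
  assumes V: "cfun.subspace V" and W: "\<And>v. v \<in> V \<Longrightarrow> v * w \<in> W"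
    and "set v \<subseteq> V" "\<not> distinct v"
  shows "koszul_symb v w \<in> koszul_relations (length v - 1) V W"
  using assms(3,4)
proof (induction v)
  case (Cons c v)
  then have v: "set v \<subseteq> V" and c: "c \<in> V" and ne: "v \<noteq> []" by auto
  show ?case
  proof (cases "c \<in> set v")
    case True
    have eq: "koszul_symb (c # v) w = - (wedge c (koszul_symb v w) + symb v (c * w))"
      by (simp add: koszul_symb_Cons)
    show ?thesis
      using koszul_relations_closed(4)[OF koszul_symb_repeat_aux[OF V W v True]]
      unfolding eq by simp
  next
    case False
    then have d: "\<not> distinct v" using Cons.prems by simp
    have "symb v (c * w) \<in> koszul_relations (length v) V W"
      using v d c W by (intro symb_repeat) auto
    moreover have "wedge c (koszul_symb v w) \<in> koszul_relations (length v) V W"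
      using wedge_relations[OF Cons.IH[OF v d] c] ne by simp
    ultimately show ?thesis
      unfolding koszul_symb_Cons by (simp add: koszul_relations_closed)
  qed
qed simp

lemma koszul_map_relations:
  assumes "x \<in> koszul_relations m V W" "cfun.subspace V" "\<And>v w. v \<in> V \<Longrightarrow> w \<in> W \<Longrightarrow> v * w \<in> W'"
  shows "koszul_map x \<in> koszul_relations (m - 1) V W'"
  unfolding koszul_map_eq_lift
proof (rule lift_relations[OF assms(1) subspace_koszul_relations])
  show "respects_relations m V W (koszul_relations (m - 1) V W') koszul_symb"
    unfolding respects_relations_def
    using assms(2,3) koszul_symb_slot[of V _ W'] koszul_symb_coeff[of V W W'] koszul_symb_repeat[of V _ W']
    by (intro conjI allI impI) auto
qed

lemma linear_into_of_linear:
  assumes "Vector_Spaces.linear cscale cscale g" "g ` UNIV \<subseteq> W'"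
  shows "linear_into W W' g"
  using assms by (auto simp: linear_into_def Vector_Spaces.linear_iff)

lemma chain_map_cong:
  assumes "x \<in> koszul_chains m V W" "\<And>w. w \<in> W \<Longrightarrow> S w = S' w"
  shows "chain_map \<theta> S x = chain_map \<theta> S' x"
proof -
  have "chain_map \<theta> S x - chain_map \<theta> S' x \<in> {0}"
    unfolding chain_map_def
    by (rule lift_congruent[OF assms(1)]) (use assms(2) in \<open>auto simp: cfun.subspace_def\<close>)
  then show ?thesis by simp
qed

lemma coeff_map_ident: "x \<in> all_chains \<Longrightarrow> coeff_map (\<lambda>w. w) x = x"
  by (simp add: chain_map_def lift_ident)

lemma coeff_map_coeff_map:
  assumes "x \<in> all_chains"
  shows "coeff_map S (coeff_map S' x) = coeff_map (\<lambda>w. S (S' w)) x"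
  using assms by (simp add: chain_map_def lift_lift symb_in_all)

text \<open>Tensoring with the subspace \<open>W0\<close> loses no relations: apply a linear projection onto \<open>W0\<close> to the
coefficients.\<close>

lemma relations_restrict_coefficients:
  assumes x: "x \<in> koszul_relations m V W" and x0: "x \<in> koszul_chains m V W0" and W0: "cfun.subspace W0"
  shows "x \<in> koszul_relations m V W0"
proof -
  obtain g where g: "Vector_Spaces.linear cscale cscale g" "g ` UNIV \<subseteq> W0" "\<forall>w\<in>W0. g w = w"
    using vector_space_pair.linear_exists_left_inverse_on[OF vector_space_pair_cscale
        linear_cscaleI[of "\<lambda>w. w"] W0] by auto
  have "coeff_map g x \<in> koszul_relations m V W0"
    by (rule chain_map_relations[OF x _ linear_into_of_linear[OF g(1,2)]]) (simp add: linear_into_def)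
  moreover have "coeff_map g x = x"
    using chain_map_cong[OF x0, of g "\<lambda>w. w" "\<lambda>v. v"] g(3) coeff_map_ident x0 koszul_chains_subset_all
    by (metis subsetD)
  ultimately show ?thesis by simp
qed

lemma symb_zero_coeff:
  assumes "set v \<subseteq> V" "w \<in> W" "length v = m"
  shows "symb v 0 \<in> koszul_relations m V W"
  using symb_coeff[of v m V w W w 0 0] assms by simp

section \<open>Exactness from a coprime pencil\<close>

lemma linear_times: "Vector_Spaces.linear cscale cscale ((*) (f :: 'x \<Rightarrow> complex))"
  by (rule linear_cscaleI) (simp_all add: distrib_left mult_cscale_right)

lemma linear_into_times:
  assumes "\<And>w. w \<in> W \<Longrightarrow> f * w \<in> W'"
  shows "linear_into W W' ((*) f)"
  using assms by (simp add: linear_into_def distrib_left mult_cscale_right)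

lemma linear_into_ident: "linear_into V V (\<lambda>v. v)"
  by (simp add: linear_into_def)

text \<open>Multiplication by \<open>f\<close> is injective on \<open>B\<close>, so it has a linear left inverse; applied to
coefficients, this cancels \<open>f\<close> from a relation.\<close>

lemma division_exists:
  assumes B: "cfun.subspace B" and reg: "\<And>w. w \<in> B \<Longrightarrow> f * w = 0 \<Longrightarrow> w = 0"
  shows "\<exists>D. Vector_Spaces.linear cscale cscale D \<and> range D \<subseteq> B \<and> (\<forall>w\<in>B. D (f * w) = w)"
proof -
  have "inj_on ((*) f) B"
  proof (rule inj_onI)
    fix x y assume "x \<in> B" "y \<in> B" "f * x = f * y"
    then show "x = y"
      using reg[of "x - y"] B by (simp add: cfun.subspace_diff right_diff_distrib)
  qed
  then show ?thesis
    using vector_space_pair.linear_exists_left_inverse_on[OF vector_space_pair_cscale linear_times B]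
    by blast
qed

lemma linear_at:
  assumes "Vector_Spaces.linear cscale cscale D"
  shows "D (x + y) = D x + D y" "D (x - y) = D x - D y" "D (cscale c x) = cscale c (D x)" "D 0 = 0"
proof -
  have add: "D (x + y) = D x + D y" and scl: "D (cscale c x) = cscale c (D x)" for x y c
    using assms by (auto simp: Vector_Spaces.linear_iff)
  show "D (x + y) = D x + D y" "D (cscale c x) = cscale c (D x)" by (rule add, rule scl)
  show "D (x - y) = D x - D y"
    using add[of x "cscale (-1) y"] scl[of "-1" y] by (simp add: cscale_minus_one)
  show "D 0 = 0" using scl[of 0 0] by simp
qed

lemma koszul_map_coeff_times:
  "x \<in> all_chains \<Longrightarrow> koszul_map (coeff_map ((*) f) x) = coeff_map ((*) f) (koszul_map x)"
  by (rule koszul_map_chain_map) (simp_all add: mult.left_commute)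

text \<open>The only syzygies of \<open>f1\<close>, \<open>f2\<close> are the Koszul ones, and this persists after tensoring with an
exterior power. Since tensor products are only presented by generators and relations, the argument
on elements is expressed by linear maps on coefficients: \<open>E\<close> takes \<open>f1 u + f2 v\<close> to the part of
\<open>u\<close> that is not divisible by \<open>f2\<close>, which depends on \<open>f1 u + f2 v\<close> only.\<close>

lemma coprime_syzygy:
  assumes B: "cfun.subspace B1" "cfun.subspace B2" "cfun.subspace B3"
    and f1: "\<And>w. w \<in> B1 \<Longrightarrow> f1 * w \<in> B2" "\<And>w. w \<in> B2 \<Longrightarrow> f1 * w \<in> B3"
    and f2: "\<And>w. w \<in> B1 \<Longrightarrow> f2 * w \<in> B2" "\<And>w. w \<in> B2 \<Longrightarrow> f2 * w \<in> B3"
    and syz: "\<And>u v. u \<in> B2 \<Longrightarrow> v \<in> B2 \<Longrightarrow> f1 * u + f2 * v = 0 \<Longrightarrow> \<exists>c\<in>B1. u = f2 * c"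
    and reg: "\<And>w. w \<in> B1 \<union> B2 \<Longrightarrow> f2 * w = 0 \<Longrightarrow> w = 0"
    and x: "x \<in> koszul_chains m V B2" and y: "y \<in> koszul_chains m V B2"
    and rel: "coeff_map ((*) f1) x + coeff_map ((*) f2) y \<in> koszul_relations m V B3"
  shows "\<exists>c\<in>koszul_chains m V B1. x - coeff_map ((*) f2) c \<in> koszul_relations m V B2 \<and>
    y + coeff_map ((*) f1) c \<in> koszul_relations m V B2"
proof -
  have all: "x \<in> all_chains" "y \<in> all_chains" using x y koszul_chains_subset_all by blast+
  have "\<exists>D. Vector_Spaces.linear cscale cscale D \<and> range D \<subseteq> B1 \<and> (\<forall>w\<in>B1. D (f2 * w) = w)"
    by (rule division_exists[OF B(1)], rule reg[OF UnI1])
  then obtain D where D: "Vector_Spaces.linear cscale cscale D" "range D \<subseteq> B1" "\<forall>w\<in>B1. D (f2 * w) = w"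
    by (elim exE conjE)
  have "\<exists>D. Vector_Spaces.linear cscale cscale D \<and> range D \<subseteq> B2 \<and> (\<forall>w\<in>B2. D (f2 * w) = w)"
    by (rule division_exists[OF B(2)], rule reg[OF UnI2])
  then obtain D' where D': "Vector_Spaces.linear cscale cscale D'" "range D' \<subseteq> B2" "\<forall>w\<in>B2. D' (f2 * w) = w"
    by (elim exE conjE)
  note lin = linear_at[OF D(1)]
  define Y where "Y = {f1 * u + f2 * v | u v. u \<in> B2 \<and> v \<in> B2}"
  define P where "P z e \<longleftrightarrow> (\<exists>u\<in>B2. \<exists>v\<in>B2. z = f1 * u + f2 * v \<and> e = u - f2 * D u)" for z e
  \<comment> \<open>Well defined, because \<open>f1 * u + f2 * v\<close> determines \<open>u\<close> up to multiples of \<open>f2\<close>.\<close>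
  define E where "E z = (SOME e. P z e)" for z
  have E: "E (f1 * u + f2 * v) = u - f2 * D u" if uv: "u \<in> B2" "v \<in> B2" for u v
  proof -
    have "P (f1 * u + f2 * v) (u - f2 * D u)" using that unfolding P_def by blast
    then have "P (f1 * u + f2 * v) (E (f1 * u + f2 * v))" unfolding E_def
      by (rule someI[of "P (f1 * u + f2 * v)"])
    then obtain u' v' where *: "u' \<in> B2" "v' \<in> B2" "f1 * u + f2 * v = f1 * u' + f2 * v'"
      "E (f1 * u + f2 * v) = u' - f2 * D u'" unfolding P_def by blast
    have "f1 * (u - u') + f2 * (v - v') = 0" using *(3) by (simp add: algebra_simps)
    then obtain c where c: "c \<in> B1" "u - u' = f2 * c"
      using syz cfun.subspace_diff[OF B(2) uv(1) *(1)] cfun.subspace_diff[OF B(2) uv(2) *(2)]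
      by blast
    then have "D u - D u' = c" using D(3) lin(2)[of u u'] by simp
    then have "u - u' = f2 * D u - f2 * D u'" using c by (simp add: right_diff_distrib[symmetric])
    then have "u - f2 * D u = u' - f2 * D u'" by (simp add: algebra_simps)
    then show ?thesis using *(4) by simp
  qed
  have sub2: "\<And>a b u u'. u \<in> B2 \<Longrightarrow> u' \<in> B2 \<Longrightarrow> cscale a u + cscale b u' \<in> B2"
    using B(2) by (simp add: cfun.subspace_add cfun.subspace_scale)
  have comb: "cscale a (f1 * u + f2 * v) + cscale b (f1 * u' + f2 * v')
      = f1 * (cscale a u + cscale b u') + f2 * (cscale a v + cscale b v')" for a b u v u' v'
    by (simp add: distrib_left mult_cscale_right cfun.scale_right_distrib add_ac)
  have subY: "cfun.subspace Y"
    unfolding cfun.subspace_def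
  proof (intro conjI ballI allI)
    have "f1 * 0 + f2 * 0 \<in> Y" unfolding Y_def using cfun.subspace_0[OF B(2)] by blast
    then show "0 \<in> Y" by simp
  next
    fix z z' assume "z \<in> Y" "z' \<in> Y"
    then obtain u v u' v' where z: "z = f1 * u + f2 * v" "u \<in> B2" "v \<in> B2"
      and z': "z' = f1 * u' + f2 * v'" "u' \<in> B2" "v' \<in> B2" unfolding Y_def by auto
    have "z + z' = f1 * (u + u') + f2 * (v + v')" unfolding z z' by (simp add: algebra_simps)
    then show "z + z' \<in> Y" unfolding Y_def using z z' cfun.subspace_add[OF B(2)] by blast
  next
    fix c z assume "z \<in> Y"
    then obtain u v where z: "z = f1 * u + f2 * v" "u \<in> B2" "v \<in> B2" unfolding Y_def by auto
    have "cscale c z = f1 * cscale c u + f2 * cscale c v"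
      unfolding z by (simp add: mult_cscale_right cfun.scale_right_distrib)
    then show "cscale c z \<in> Y" unfolding Y_def using z cfun.subspace_scale[OF B(2)] by blast
  qed
  have linE: "linear_into Y B2 E"
    unfolding linear_into_def
  proof (intro conjI ballI allI)
    fix z assume "z \<in> Y"
    then show "E z \<in> B2"
      using E cfun.subspace_diff[OF B(2) _ f2(1)] subsetD[OF D(2) rangeI] by (auto simp: Y_def)
  next
    fix z z' a b assume "z \<in> Y" "z' \<in> Y"
    then obtain u v u' v' where z: "z = f1 * u + f2 * v" "u \<in> B2" "v \<in> B2"
      and z': "z' = f1 * u' + f2 * v'" "u' \<in> B2" "v' \<in> B2" unfolding Y_def by auto
    show "E (cscale a z + cscale b z') = cscale a (E z) + cscale b (E z')"
      unfolding z(1) z'(1) comb E[OF z(2,3)] E[OF z'(2,3)]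
        E[OF sub2[OF z(2) z'(2)] sub2[OF z(3) z'(3)]]
      by (simp add: lin distrib_left mult_cscale_right cfun.scale_right_diff_distrib)
  qed
  have E1: "E (f1 * w) = w - f2 * D w" and E2: "E (f2 * w) = 0" if "w \<in> B2" for w
    using E[of w 0] E[of 0 w] that B(2) by (simp_all add: cfun.subspace_0 lin)
  have Y1: "f1 * w \<in> Y" and Y2: "f2 * w \<in> Y" if "w \<in> B2" for w
  proof -
    have "f1 * w + f2 * 0 \<in> Y" "f1 * 0 + f2 * w \<in> Y"
      unfolding Y_def using that cfun.subspace_0[OF B(2)] by blast+
    then show "f1 * w \<in> Y" "f2 * w \<in> Y" by simp_all
  qed
  define c where "c = coeff_map D x"
  have c: "c \<in> koszul_chains m V B1"
    unfolding c_def using D(2) by (intro chain_map_chains[OF x]) auto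
  then have call: "c \<in> all_chains" using koszul_chains_subset_all by blast
  have "coeff_map ((*) f1) x + coeff_map ((*) f2) y \<in> koszul_relations m V Y"
    by (intro relations_restrict_coefficients[OF rel _ subY] koszul_chains_closed
        chain_map_chains[OF x] chain_map_chains[OF y] Y1 Y2)
  then have "coeff_map E (coeff_map ((*) f1) x + coeff_map ((*) f2) y) \<in> koszul_relations m V B2"
    by (rule chain_map_relations[OF _ linear_into_ident linE])
  moreover have "coeff_map E (coeff_map ((*) f1) x) = coeff_map (\<lambda>w. w - f2 * D w) x"
    using chain_map_cong[OF x, of "\<lambda>w. E (f1 * w)" "\<lambda>w. w - f2 * D w" "\<lambda>v. v"] E1
    by (simp add: coeff_map_coeff_map all)
  moreover have "coeff_map E (coeff_map ((*) f2) y) = coeff_map (\<lambda>w. 0) y"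
    using chain_map_cong[OF y, of "\<lambda>w. E (f2 * w)" "\<lambda>w. 0" "\<lambda>v. v"] E2
    by (simp add: coeff_map_coeff_map all)
  ultimately have 1: "coeff_map (\<lambda>w. w - f2 * D w) x + coeff_map (\<lambda>w. 0) y \<in> koszul_relations m V B2"
    by (simp add: chain_map_add all chain_map_in_all)
  have 2: "coeff_map (\<lambda>w. 0) y \<in> koszul_relations m V B2"
    unfolding chain_map_def
    by (rule lift_mem[OF y subspace_koszul_relations]) (auto intro!: symb_zero_coeff)
  have 3: "x - coeff_map ((*) f2) c - coeff_map (\<lambda>w. w - f2 * D w) x \<in> koszul_relations m V B2"
  proof -
    have "lift (\<lambda>v w. symb v w) x - lift (\<lambda>v w. symb v (f2 * D w) + symb v (w - f2 * D w)) x
        \<in> koszul_relations m V B2"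
    proof (rule lift_congruent[OF x subspace_koszul_relations])
      fix v w assume vw: "length v = m" "set v \<subseteq> V" "w \<in> B2"
      then have "f2 * D w \<in> B2" using D(2) f2(1) by auto
      then show "symb v w - (symb v (f2 * D w) + symb v (w - f2 * D w)) \<in> koszul_relations m V B2"
        using symb_coeff[of v m V "f2 * D w" B2 "w - f2 * D w" 1 1] vw B(2)
        by (simp add: cfun.subspace_diff diff_diff_eq)
    qed
    then show ?thesis
      by (simp add: lift_plus lift_ident all c_def coeff_map_coeff_map diff_diff_eq)
         (simp add: chain_map_def)
  qed
  have A: "x - coeff_map ((*) f2) c \<in> koszul_relations m V B2"
    using koszul_relations_closed(2)[OF 3 koszul_relations_closed(3)[OF 1 2]] by simp
  have "coeff_map ((*) f1) (x - coeff_map ((*) f2) c) \<in> koszul_relations m V B3"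
    by (rule chain_map_relations[OF A linear_into_ident linear_into_times[OF f1(2)]])
  then have "(coeff_map ((*) f1) x + coeff_map ((*) f2) y)
      - coeff_map ((*) f1) (x - coeff_map ((*) f2) c) \<in> koszul_relations m V B3"
    by (rule koszul_relations_closed(3)[OF rel])
  also have "(coeff_map ((*) f1) x + coeff_map ((*) f2) y) - coeff_map ((*) f1) (x - coeff_map ((*) f2) c)
      = coeff_map ((*) f2) (y + coeff_map ((*) f1) c)"
    by (simp add: chain_map_diff chain_map_add all call chain_map_in_all coeff_map_coeff_map
        mult.left_commute add.commute)
  finally have "coeff_map D' (coeff_map ((*) f2) (y + coeff_map ((*) f1) c)) \<in> koszul_relations m V B2"
    by (rule chain_map_relations[OF _ linear_into_ident linear_into_of_linear[OF D'(1,2)]])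
  moreover have yc: "y + coeff_map ((*) f1) c \<in> koszul_chains m V B2"
    by (intro koszul_chains_closed y chain_map_chains[OF c] f1)
  moreover from yc have ycall: "y + coeff_map ((*) f1) c \<in> all_chains" using koszul_chains_subset_all by blast
  moreover have "coeff_map (\<lambda>w. D' (f2 * w)) (y + coeff_map ((*) f1) c) = y + coeff_map ((*) f1) c"
    using chain_map_cong[OF yc, of "\<lambda>w. D' (f2 * w)" "\<lambda>w. w"] D'(3) coeff_map_ident[OF ycall] by simp
  ultimately have "y + coeff_map ((*) f1) c \<in> koszul_relations m V B2"
    by (simp add: coeff_map_coeff_map)
  with c A show ?thesis by blast
qed

text \<open>A coprime pencil makes \<open>B / (f1, f2) B\<close> vanish in degree 2. In terms of elements: write a cycle as
\<open>x = f1 a + f2 b\<close>. The homotopy formula replaces it by \<open>f1 \<and> da + f2 \<and> db\<close> up to sign and a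
boundary, where \<open>f1 da + f2 db = 0\<close>; so \<open>da = f2 c\<close> and \<open>db = - f1 c\<close>, and the remaining term is
the boundary of \<open>f1 \<and> f2 \<and> c\<close>.\<close>

lemma koszul_exact_of_pencil:
  assumes V: "cfun.subspace V" "f1 \<in> V" "f2 \<in> V"
    and B: "cfun.subspace B1" "cfun.subspace B2" "cfun.subspace B3"
    and mult: "\<And>v w. v \<in> V \<Longrightarrow> w \<in> B1 \<Longrightarrow> v * w \<in> B2" "\<And>v w. v \<in> V \<Longrightarrow> w \<in> B2 \<Longrightarrow> v * w \<in> B3"
    and gen: "\<And>w. w \<in> B2 \<Longrightarrow> \<exists>a\<in>B1. \<exists>b\<in>B1. w = f1 * a + f2 * b"
    and syz: "\<And>u v. u \<in> B2 \<Longrightarrow> v \<in> B2 \<Longrightarrow> f1 * u + f2 * v = 0 \<Longrightarrow> \<exists>c\<in>B1. u = f2 * c"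
    and reg: "\<And>w. w \<in> B1 \<union> B2 \<Longrightarrow> f2 * w = 0 \<Longrightarrow> w = 0"
    and x: "x \<in> koszul_chains p V B2" and cycle: "koszul_map x \<in> koszul_relations (p - 1) V B3"
  shows "\<exists>y\<in>koszul_chains (Suc p) V B1. x - koszul_map y \<in> koszul_relations p V B2"
proof -
  have xall: "x \<in> all_chains" using x koszul_chains_subset_all by blast
  obtain S1 S2 where S: "\<And>w. w \<in> B2 \<Longrightarrow> S1 w \<in> B1 \<and> S2 w \<in> B1 \<and> w = f1 * S1 w + f2 * S2 w"
    using gen by metis
  \<comment> \<open>The coefficients are split generator by generator; \<open>S1\<close> and \<open>S2\<close> need not be linear.\<close>
  define a b where "a = coeff_map S1 x" and "b = coeff_map S2 x"
  have a: "a \<in> koszul_chains p V B1" and b: "b \<in> koszul_chains p V B1"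
    unfolding a_def b_def using S by (auto intro!: chain_map_chains[OF x])
  then have all: "a \<in> all_chains" "b \<in> all_chains" using koszul_chains_subset_all by blast+
  note f = mult(1)[OF V(2)] mult(2)[OF V(2)] mult(1)[OF V(3)] mult(2)[OF V(3)]
  have split: "x - (coeff_map ((*) f1) a + coeff_map ((*) f2) b) \<in> koszul_relations p V B2"
  proof -
    have "lift (\<lambda>v w. symb v w) x - lift (\<lambda>v w. symb v (f1 * S1 w) + symb v (f2 * S2 w)) x
        \<in> koszul_relations p V B2"
    proof (rule lift_congruent[OF x subspace_koszul_relations])
      fix v w assume vw: "length v = p" "set v \<subseteq> V" "w \<in> B2"
      then show "symb v w - (symb v (f1 * S1 w) + symb v (f2 * S2 w)) \<in> koszul_relations p V B2"
        using symb_coeff[of v p V "f1 * S1 w" B2 "f2 * S2 w" 1 1] S[of w] f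
        by (simp add: diff_diff_eq)
    qed
    then show ?thesis
      by (simp add: lift_plus lift_ident xall a_def b_def coeff_map_coeff_map) (simp add: chain_map_def)
  qed
  define da db where "da = koszul_map a" and "db = koszul_map b"
  have d: "da \<in> koszul_chains (p - 1) V B2" "db \<in> koszul_chains (p - 1) V B2"
    unfolding da_def db_def by (rule koszul_map_chains[OF a mult(1)], assumption+)
                               (rule koszul_map_chains[OF b mult(1)], assumption+)
  then have dall: "da \<in> all_chains" "db \<in> all_chains" using koszul_chains_subset_all by blast+
  have "koszul_map (coeff_map ((*) f1) a + coeff_map ((*) f2) b)
      = coeff_map ((*) f1) da + coeff_map ((*) f2) db"
    by (simp add: koszul_map_add chain_map_in_all all da_def db_def
        koszul_map_coeff_times)
  then have "koszul_map x - (coeff_map ((*) f1) da + coeff_map ((*) f2) db) \<in> koszul_relations (p - 1) V B3"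
    using koszul_map_relations[OF split V(1) mult(2)]
    by (simp add: koszul_map_diff xall all chain_map_in_all all_chains_closed)
  then have rel: "coeff_map ((*) f1) da + coeff_map ((*) f2) db \<in> koszul_relations (p - 1) V B3"
    using koszul_relations_closed(3)[OF cycle] by fastforce
  \<comment> \<open>Up to a boundary, \<open>x\<close> is now minus the sum of two wedges below.\<close>
  have "\<exists>z\<in>koszul_chains (Suc p) V B1.
      wedge f1 da + wedge f2 db - koszul_map z \<in> koszul_relations p V B2"
  proof (cases p)
    case 0
    then have "da = 0" "db = 0"
      using koszul_map_degree_zero a b by (auto simp: da_def db_def)
    then show ?thesis
      by (intro bexI[of _ 0]) (simp_all add: wedge_def koszul_map_eq_lift koszul_relations_closed koszul_chains_closed)
  next
    case (Suc m)
    have "\<exists>c\<in>koszul_chains m V B1. da - coeff_map ((*) f2) c \<in> koszul_relations m V B2 \<and>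
        db + coeff_map ((*) f1) c \<in> koszul_relations m V B2"
      by (rule coprime_syzygy[OF B f(1,2,3,4) syz reg]) (use d rel Suc in simp_all)
    then obtain c where c: "c \<in> koszul_chains m V B1"
      "da - coeff_map ((*) f2) c \<in> koszul_relations m V B2"
      "db + coeff_map ((*) f1) c \<in> koszul_relations m V B2" by blast
    have call: "c \<in> all_chains" using c(1) koszul_chains_subset_all by blast
    define dc where "dc = koszul_map c"
    have dc: "dc \<in> koszul_chains (m - 1) V B2"
      unfolding dc_def by (rule koszul_map_chains[OF c(1) mult(1)])
    have dcall: "dc \<in> all_chains" using dc koszul_chains_subset_all by blast
    have "koszul_map (da - coeff_map ((*) f2) c) \<in> koszul_relations (m - 1) V B3"
      by (rule koszul_map_relations[OF c(2) V(1) mult(2)])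
    also have "koszul_map (da - coeff_map ((*) f2) c) = - coeff_map ((*) f2) dc"
      by (simp add: koszul_map_diff call chain_map_in_all koszul_map_in_all da_def dc_def koszul_map_koszul_map all
          koszul_map_coeff_times)
    finally have "coeff_map ((*) f2) dc \<in> koszul_relations (m - 1) V B3"
      using koszul_relations_closed(4) by fastforce
    moreover have "\<exists>D. Vector_Spaces.linear cscale cscale D \<and> range D \<subseteq> B2 \<and> (\<forall>w\<in>B2. D (f2 * w) = w)"
      by (rule division_exists[OF B(2)], rule reg[OF UnI2])
    then obtain D where D: "Vector_Spaces.linear cscale cscale D" "range D \<subseteq> B2" "\<forall>w\<in>B2. D (f2 * w) = w"
      by (elim exE conjE)
    ultimately have "coeff_map D (coeff_map ((*) f2) dc) \<in> koszul_relations (m - 1) V B2"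
      by (intro chain_map_relations[OF _ linear_into_ident linear_into_of_linear[OF D(1,2)]])
    then have dcrel: "dc \<in> koszul_relations (m - 1) V B2"
      using chain_map_cong[OF dc, of "\<lambda>w. D (f2 * w)" "\<lambda>w. w"] D(3) coeff_map_ident[OF dcall]
      by (simp add: coeff_map_coeff_map dcall)
    have wdc: "wedge f2 dc \<in> koszul_relations m V B2"
    proof (cases m)
      case 0
      then have "dc = 0" using koszul_map_degree_zero c(1) by (simp add: dc_def)
      then show ?thesis by (simp add: wedge_def koszul_relations_closed)
    next
      case (Suc m')
      then show ?thesis using wedge_relations[OF dcrel V(3)] by simp
    qed
    define z where "z = wedge f1 (wedge f2 c)"
    have z: "z \<in> koszul_chains (Suc p) V B1"
      unfolding z_def Suc by (intro wedge_chains c V)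
    have "koszul_map z = - coeff_map ((*) f1) (wedge f2 c)
        + wedge f1 (coeff_map ((*) f2) c) + wedge f1 (wedge f2 dc)"
      unfolding z_def dc_def
      by (simp add: koszul_map_wedge call wedge_in_all wedge_diff wedge_minus chain_map_in_all
          koszul_map_in_all all_chains_closed)
    also have "coeff_map ((*) f1) (wedge f2 c) = wedge f2 (coeff_map ((*) f1) c)"
      by (simp add: wedge_coeff_map call)
    finally have eq: "wedge f1 da + wedge f2 db - koszul_map z
        = wedge f1 (da - coeff_map ((*) f2) c) + wedge f2 (db + coeff_map ((*) f1) c) - wedge f1 (wedge f2 dc)"
      by (simp add: wedge_diff wedge_add dall call chain_map_in_all)
    have "wedge f1 da + wedge f2 db - koszul_map z \<in> koszul_relations p V B2"
      unfolding eq Suc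
      by (intro koszul_relations_closed wedge_relations c V wdc)
    with z show ?thesis by blast
  qed
  then obtain z where z: "z \<in> koszul_chains (Suc p) V B1"
    "wedge f1 da + wedge f2 db - koszul_map z \<in> koszul_relations p V B2" by blast
  have zall: "z \<in> all_chains" using z koszul_chains_subset_all by blast
  define y where "y = - (wedge f1 a + wedge f2 b + z)"
  have "y \<in> koszul_chains (Suc p) V B1"
    unfolding y_def by (intro koszul_chains_closed wedge_chains a b z V)
  moreover have eq: "x - koszul_map y = x - (coeff_map ((*) f1) a + coeff_map ((*) f2) b)
      - (wedge f1 da + wedge f2 db - koszul_map z)"
    unfolding y_def da_def db_def
    by (simp add: koszul_map_minus koszul_map_add koszul_map_diff koszul_map_wedge all zall wedge_in_all all_chains_closed)
  moreover have "x - koszul_map y \<in> koszul_relations p V B2"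
    unfolding eq by (rule koszul_relations_closed(3)[OF split z(2)])
  ultimately show ?thesis by blast
qed

section \<open>Contributions of the nodes\<close>

text \<open>Contraction of a wedge with the functional \<open>ev\<close>, with coefficient \<open>b\<close>.\<close>

primrec contraction ::
    "(('x \<Rightarrow> complex) \<Rightarrow> complex) \<Rightarrow> ('x \<Rightarrow> complex) \<Rightarrow> ('x \<Rightarrow> complex) list \<Rightarrow> 'x koszul_chain" where
  "contraction ev b [] = 0"
| "contraction ev b (a # v) = cscale (ev a) (symb v b) - wedge a (contraction ev b v)"

lemma contraction_chains:
  assumes "set v \<subseteq> V" "b \<in> B"
  shows "contraction ev b v \<in> koszul_chains (length v - 1) V B"
  using assms(1)
proof (induction v)
  case Nil
  then show ?case by (simp add: koszul_chains_closed)
next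
  case (Cons a v)
  have "wedge a (contraction ev b v) \<in> koszul_chains (length v) V B"
  proof (cases v)
    case Nil
    then show ?thesis by (simp add: wedge_def koszul_chains_closed)
  next
    case (Cons c u)
    then show ?thesis using wedge_chains[OF Cons.IH, of a] Cons.prems by simp
  qed
  then show ?case
    using Cons.prems assms(2) by (auto intro!: koszul_chains_closed symb_in_chains)
qed

lemma symb_scale:
  assumes "set v \<subseteq> V" "w \<in> W" "length v = m"
  shows "symb v (cscale c w) - cscale c (symb v w) \<in> koszul_relations m V W"
  using symb_coeff[of v m V w W w c 0] assms by simp

lemma wedge_cscale: "x \<in> all_chains \<Longrightarrow> wedge a (cscale c x) = cscale c (wedge a x)"
  by (simp add: wedge_def lift_cscale)

text \<open>Projecting all factors to the kernel of \<open>ev\<close> along a vector \<open>e\<close> with \<open>ev e = 1\<close> changes a wedge by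
\<open>e\<close> times its contraction. In particular a combination of wedges with zero contraction is a
combination of wedges of elements of the kernel.\<close>

lemma symb_project:
  assumes V: "cfun.subspace V" and e: "e \<in> V" and b: "b \<in> B" and "set v \<subseteq> V"
  shows "symb (map (\<lambda>x. x - cscale (ev x) e) v) b - symb v b + wedge e (contraction ev b v)
    \<in> koszul_relations (length v) V B"
  using assms(4)
proof (induction v)
  case Nil
  then show ?case by (simp add: wedge_def koszul_relations_closed)
next
  case (Cons a v)
  define v' where "v' = map (\<lambda>x. x - cscale (ev x) e) v"
  define C where "C = contraction ev b v"
  have a: "a \<in> V" and v: "set v \<subseteq> V" using Cons.prems by auto
  have v': "set v' \<subseteq> V" "length v' = length v"
    unfolding v'_def using v V e by (auto intro!: cfun.subspace_diff cfun.subspace_scale)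
  have C: "C \<in> koszul_chains (length v - 1) V B"
    unfolding C_def by (rule contraction_chains[OF v b])
  then have Call: "C \<in> all_chains" using koszul_chains_subset_all by blast
  have 1: "symb ((a - cscale (ev a) e) # v') b - symb (a # v') b + cscale (ev a) (symb (e # v') b)
      \<in> koszul_relations (Suc (length v)) V B"
    using symb_slot[of "a # v'" "Suc (length v)" V 0 a e b B 1 "- ev a"] v' a e b by simp
  have 2: "wedge a (symb v' b - symb v b + wedge e C) \<in> koszul_relations (Suc (length v)) V B"
    using wedge_relations[OF Cons.IH[OF v] a] by (simp add: v'_def C_def)
  have 3: "wedge e (symb v' b - symb v b + wedge e C) \<in> koszul_relations (Suc (length v)) V B"
    using wedge_relations[OF Cons.IH[OF v] e] by (simp add: v'_def C_def)
  have 4: "wedge e (wedge e C) \<in> koszul_relations (Suc (length v)) V B"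
    and 5: "wedge a (wedge e C) + wedge e (wedge a C) \<in> koszul_relations (Suc (length v)) V B"
  proof (atomize (full), cases v)
    case Nil
    then have "C = 0" by (simp add: C_def)
    then show "wedge e (wedge e C) \<in> koszul_relations (Suc (length v)) V B \<and>
      wedge a (wedge e C) + wedge e (wedge a C) \<in> koszul_relations (Suc (length v)) V B"
      by (simp add: wedge_def koszul_relations_closed)
  next
    case (Cons c u)
    then show "wedge e (wedge e C) \<in> koszul_relations (Suc (length v)) V B \<and>
      wedge a (wedge e C) + wedge e (wedge a C) \<in> koszul_relations (Suc (length v)) V B"
      using wedge_wedge_self[OF C e] wedge_wedge_swap[OF C V a e] by simp
  qed
  have eq: "symb ((a - cscale (ev a) e) # v') b - symb (a # v) b
        + wedge e (cscale (ev a) (symb v b) - wedge a C) =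
      (symb ((a - cscale (ev a) e) # v') b - symb (a # v') b + cscale (ev a) (symb (e # v') b))
      + wedge a (symb v' b - symb v b + wedge e C)
      - cscale (ev a) (wedge e (symb v' b - symb v b + wedge e C))
      + cscale (ev a) (wedge e (wedge e C))
      - (wedge a (wedge e C) + wedge e (wedge a C))"
    by (simp add: wedge_add wedge_diff wedge_cscale Call wedge_in_all symb_in_all all_chains_closed
        cfun.scale_right_distrib cfun.scale_right_diff_distrib)
  have "symb ((a - cscale (ev a) e) # v') b - symb (a # v) b
        + wedge e (cscale (ev a) (symb v b) - wedge a C) \<in> koszul_relations (Suc (length v)) V B"
    unfolding eq by (intro koszul_relations_closed 1 2 3 4 5)
  then show ?case by (simp add: v'_def C_def)
qed

text \<open>Taking the defect of the differential contracts with the value at the node.\<close>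

lemma coeff_map_koszul_symb:
  assumes "set v \<subseteq> V" "b \<in> B" and S: "\<And>a. a \<in> set v \<Longrightarrow> S (a * w) = cscale (ev a * r) b"
  shows "coeff_map S (koszul_symb v w) + cscale r (contraction ev b v) \<in> koszul_relations (length v - 1) V B"
  using assms(1,3)
proof (induction v)
  case Nil
  then show ?case by (simp add: chain_map_def koszul_relations_closed)
next
  case (Cons a v)
  have Call: "contraction ev b v \<in> all_chains"
    using contraction_chains[of v UNIV b UNIV] koszul_chains_subset_all by blast
  have 1: "symb v (S (a * w)) - cscale (r * ev a) (symb v b) \<in> koszul_relations (length v) V B"
    using symb_scale[of v V b B] Cons.prems assms(2) by (simp add: mult.commute)
  have 2: "wedge a (coeff_map S (koszul_symb v w) + cscale r (contraction ev b v))
      \<in> koszul_relations (length v) V B"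
  proof (cases v)
    case Nil
    then show ?thesis by (simp add: wedge_def chain_map_def koszul_relations_closed)
  next
    case (Cons c u)
    then show ?thesis using wedge_relations[OF Cons.IH, of a] Cons.prems by simp
  qed
  have eq: "coeff_map S (koszul_symb (a # v) w) + cscale r (contraction ev b (a # v))
      = - (symb v (S (a * w)) - cscale (r * ev a) (symb v b))
        - wedge a (coeff_map S (koszul_symb v w) + cscale r (contraction ev b v))"
    by (simp add: koszul_symb_Cons chain_map_diff chain_map_minus symb_in_all koszul_symb_in_all
        wedge_in_all all_chains_closed wedge_coeff_map wedge_add wedge_cscale chain_map_in_all Call
        cfun.scale_right_diff_distrib)
  show ?case unfolding eq length_Cons diff_Suc_1 by (intro koszul_relations_closed 1 2)
qed

lemma symb_minus_sum:
  assumes B: "cfun.subspace B" and "w \<in> B" "\<And>l. l \<in> L \<Longrightarrow> b l \<in> B" "set v \<subseteq> V" "length v = m" "finite L"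
  shows "symb v (w - (\<Sum>l\<in>L. cscale (c l) (b l))) + (\<Sum>l\<in>L. cscale (c l) (symb v (b l))) - symb v w
    \<in> koszul_relations m V B"
  using assms(6,3)
proof (induction L)
  case empty
  then show ?case by (simp add: koszul_relations_closed)
next
  case (insert l L)
  define y where "y = w - (\<Sum>l\<in>L. cscale (c l) (b l))"
  have y: "y \<in> B" unfolding y_def
    using insert.prems assms(2) B by (intro cfun.subspace_diff cfun.subspace_sum cfun.subspace_scale) auto
  have 1: "symb v (y - cscale (c l) (b l)) - symb v y + cscale (c l) (symb v (b l)) \<in> koszul_relations m V B"
    using symb_coeff[of v m V y B "b l" 1 "- c l"] y insert.prems assms(4,5) by simp
  have 2: "symb v y + (\<Sum>l\<in>L. cscale (c l) (symb v (b l))) - symb v w \<in> koszul_relations m V B"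
    using insert unfolding y_def by simp
  have "w - (\<Sum>l\<in>insert l L. cscale (c l) (b l)) = y - cscale (c l) (b l)"
    using insert by (simp add: y_def)
  then show ?case
    using koszul_relations_closed(2)[OF 1 2] insert(1,2) by (simp add: algebra_simps)
qed

lemma koszul_boundaries_iff:
  "x \<in> koszul_boundaries H p 2 \<longleftrightarrow> x \<in> koszul_chains p (H 1) (H 2) \<and>
    (\<exists>y\<in>koszul_chains (Suc p) (H 1) (H 1). x - koszul_map y \<in> koszul_relations p (H 1) (H 2))"
  by (simp add: koszul_boundaries_def)

lemma subspace_koszul_boundaries: "cfun.subspace (koszul_boundaries H p 2)"
  unfolding cfun.subspace_def
proof (intro conjI ballI allI)
  show "0 \<in> koszul_boundaries H p 2"
    unfolding koszul_boundaries_iff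
    by (intro conjI bexI[of _ 0]) (simp_all add: koszul_map_eq_lift koszul_chains_closed koszul_relations_closed)
next
  fix x x' assume "x \<in> koszul_boundaries H p 2" "x' \<in> koszul_boundaries H p 2"
  then obtain y y' where y: "x \<in> koszul_chains p (H 1) (H 2)" "y \<in> koszul_chains (Suc p) (H 1) (H 1)"
      "x - koszul_map y \<in> koszul_relations p (H 1) (H 2)"
    and y': "x' \<in> koszul_chains p (H 1) (H 2)" "y' \<in> koszul_chains (Suc p) (H 1) (H 1)"
      "x' - koszul_map y' \<in> koszul_relations p (H 1) (H 2)"
    unfolding koszul_boundaries_iff by blast
  have "y \<in> all_chains" "y' \<in> all_chains" using y y' koszul_chains_subset_all by blast+
  then have eq: "x + x' - koszul_map (y + y') = (x - koszul_map y) + (x' - koszul_map y')"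
    by (simp add: koszul_map_add)
  have "x + x' - koszul_map (y + y') \<in> koszul_relations p (H 1) (H 2)"
    unfolding eq by (rule koszul_relations_closed(2)[OF y(3) y'(3)])
  then show "x + x' \<in> koszul_boundaries H p 2"
    unfolding koszul_boundaries_iff using y y' koszul_chains_closed(2) by blast
next
  fix c x assume "x \<in> koszul_boundaries H p 2"
  then obtain y where y: "x \<in> koszul_chains p (H 1) (H 2)" "y \<in> koszul_chains (Suc p) (H 1) (H 1)"
      "x - koszul_map y \<in> koszul_relations p (H 1) (H 2)"
    unfolding koszul_boundaries_iff by blast
  have "y \<in> all_chains" using y koszul_chains_subset_all by blast
  then have eq: "cscale c x - koszul_map (cscale c y) = cscale c (x - koszul_map y)"
    by (simp add: koszul_map_cscale cfun.scale_right_diff_distrib)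
  have "cscale c x - koszul_map (cscale c y) \<in> koszul_relations p (H 1) (H 2)"
    unfolding eq by (rule koszul_relations_closed(5)[OF y(3)])
  then show "cscale c x \<in> koszul_boundaries H p 2"
    unfolding koszul_boundaries_iff using y koszul_chains_closed(5) by blast
qed

lemma relations_in_boundaries:
  assumes "x \<in> koszul_chains p (H 1) (H 2)" "x \<in> koszul_relations p (H 1) (H 2)"
  shows "x \<in> koszul_boundaries H p 2"
  unfolding koszul_boundaries_iff using assms
  by (intro conjI bexI[of _ 0]) (simp_all add: koszul_map_eq_lift koszul_chains_closed)

lemma koszul_map_in_boundaries:
  assumes "y \<in> koszul_chains (Suc p) (H 1) (H 1)" "\<And>v w. v \<in> H 1 \<Longrightarrow> w \<in> H 1 \<Longrightarrow> v * w \<in> H 2"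
  shows "koszul_map y \<in> koszul_boundaries H p 2"
  unfolding koszul_boundaries_iff
  using koszul_map_chains[OF assms] assms(1)
  by (intro conjI bexI[of _ y]) (simp_all add: koszul_relations_closed)

text \<open>The algebraic core. Here \<open>r1 l\<close> and \<open>r2 l\<close> are the gluing defects at the node \<open>l\<close> in degrees 1 and
2, \<open>ev l\<close> is the value at \<open>l\<close>, and \<open>b l\<close> has defect 1 at \<open>l\<close> only. A cycle \<open>x\<close> bounds some \<open>Y\<close>
over \<open>B1\<close>. Split off the defects of \<open>Y\<close>; as the boundary of \<open>Y\<close> is \<open>x\<close> up to relations and \<open>x\<close> has
none, the defect at \<open>l\<close> has zero contraction and can be rewritten with factors in \<open>K l\<close>, where the
assumption on the nodes applies.\<close>

lemma koszul_vanishes_of_node_contributions: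
  fixes H :: "nat \<Rightarrow> ('x \<Rightarrow> complex) set"
  assumes H: "cfun.subspace (H 1)" "cfun.subspace (H 2)" and B1: "cfun.subspace B1"
    and sub: "H 1 \<subseteq> B1" "H 2 \<subseteq> B2" "H 3 \<subseteq> B3"
    and mult: "\<And>v w. v \<in> H 1 \<Longrightarrow> w \<in> B1 \<Longrightarrow> v * w \<in> B2" "\<And>v w. v \<in> H 1 \<Longrightarrow> w \<in> H 1 \<Longrightarrow> v * w \<in> H 2"
    and exact: "\<And>x. x \<in> koszul_chains p (H 1) B2 \<Longrightarrow> koszul_map x \<in> koszul_relations (p - 1) (H 1) B3 \<Longrightarrow>
        \<exists>y\<in>koszul_chains (Suc p) (H 1) B1. x - koszul_map y \<in> koszul_relations p (H 1) B2"
    and L: "finite L"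
    and b: "\<And>l. l \<in> L \<Longrightarrow> b l \<in> B1" "\<And>w. w \<in> B1 \<Longrightarrow> w - (\<Sum>l\<in>L. cscale (r1 l w) (b l)) \<in> H 1"
    and r2: "\<And>l w w' a c. l \<in> L \<Longrightarrow> w \<in> B2 \<Longrightarrow> w' \<in> B2 \<Longrightarrow>
          r2 l (cscale a w + cscale c w') = a * r2 l w + c * r2 l w'"
      "\<And>l w. l \<in> L \<Longrightarrow> w \<in> H 2 \<Longrightarrow> r2 l w = 0"
      "\<And>l v w. l \<in> L \<Longrightarrow> v \<in> H 1 \<Longrightarrow> w \<in> B1 \<Longrightarrow> r2 l (v * w) = ev l v * r1 l w"
    and e: "\<And>l. l \<in> L \<Longrightarrow> e l \<in> H 1" "\<And>l v. l \<in> L \<Longrightarrow> v \<in> H 1 \<Longrightarrow> v - cscale (ev l v) (e l) \<in> K l"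
    and nodes: "\<And>l u. l \<in> L \<Longrightarrow> length u = Suc p \<Longrightarrow> set u \<subseteq> K l \<Longrightarrow>
        koszul_symb u (b l) \<in> koszul_boundaries H p 2"
    and K: "\<And>l. l \<in> L \<Longrightarrow> K l \<subseteq> H 1"
  shows "koszul_vanishes H p 2"
  unfolding koszul_vanishes_def
proof
  note One_nat_def [simp del]
  fix x assume "x \<in> koszul_cycles H p 2"
  then have x: "x \<in> koszul_chains p (H 1) (H 2)"
    and dx: "koszul_map x \<in> koszul_relations (p - 1) (H 1) (H 3)"
    by (auto simp: koszul_cycles_def numeral_3_eq_3)
  let ?V = "H 1"
  have x2: "x \<in> koszul_chains p ?V B2" using x koszul_chains_mono[OF subset_refl sub(2)] by blast
  have dx3: "koszul_map x \<in> koszul_relations (p - 1) ?V B3"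
    using dx koszul_relations_mono[OF subset_refl sub(3)] by blast
  obtain Y where Y: "Y \<in> koszul_chains (Suc p) ?V B1" "x - koszul_map Y \<in> koszul_relations p ?V B2"
    using exact[OF x2 dx3] by blast
  \<comment> \<open>\<open>Y\<close> is \<open>YR\<close> plus all \<open>N l\<close>; \<open>P l\<close> is \<open>N l\<close> with all factors projected to \<open>K l\<close>, and \<open>C l\<close> is its contraction.\<close>
  define YR where "YR = lift (\<lambda>v w. symb v (w - (\<Sum>l\<in>L. cscale (r1 l w) (b l)))) Y"
  define N where "N l = lift (\<lambda>v w. cscale (r1 l w) (symb v (b l))) Y" for l
  define P where "P l = lift (\<lambda>v w. cscale (r1 l w) (symb (map (\<lambda>x. x - cscale (ev l x) (e l)) v) (b l))) Y" for l
  define C where "C l = lift (\<lambda>v w. cscale (r1 l w) (contraction (ev l) (b l) v)) Y" for l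
  have YR: "YR \<in> koszul_chains (Suc p) ?V ?V"
    unfolding YR_def by (rule lift_mem[OF Y(1) subspace_koszul_chains]) (auto intro!: symb_in_chains b)
  have all: "Y \<in> all_chains" "YR \<in> all_chains" "x \<in> all_chains"
    using Y YR x koszul_chains_subset_all by blast+
  have Nall: "N l \<in> all_chains" and Pall: "P l \<in> all_chains" for l
    unfolding N_def P_def by (rule lift_in_all[OF all(1)], intro all_chains_closed symb_in_all)+
  have split: "YR + (\<Sum>l\<in>L. N l) - Y \<in> koszul_relations (Suc p) ?V B1"
  proof -
    have "lift (\<lambda>v w. symb v (w - (\<Sum>l\<in>L. cscale (r1 l w) (b l)))
          + (\<Sum>l\<in>L. cscale (r1 l w) (symb v (b l)))) Y - lift symb Y \<in> koszul_relations (Suc p) ?V B1"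
      by (rule lift_congruent[OF Y(1) subspace_koszul_relations])
         (auto intro!: symb_minus_sum[OF B1 _ _ _ _ L] b(1))
    moreover have "lift (\<lambda>v w. (\<Sum>l\<in>L. cscale (r1 l w) (symb v (b l)))) Y = (\<Sum>l\<in>L. N l)"
      unfolding N_def lift_def cfun.scale_sum_right by (rule sum.swap)
    ultimately show ?thesis by (simp add: lift_plus YR_def lift_ident all)
  qed
  \<comment> \<open>The difference is \<open>e l\<close> times the contraction, which the cycle condition makes a relation.\<close>
  have PN: "P l - N l \<in> koszul_relations (Suc p) ?V B1" if l: "l \<in> L" for l
  proof -
    define S where "S w = cscale (r2 l w) (b l)" for w
    have 1: "P l - N l + wedge (e l) (C l) \<in> koszul_relations (Suc p) ?V B1"
    proof -
      have "lift (\<lambda>v w. cscale (r1 l w) (symb (map (\<lambda>x. x - cscale (ev l x) (e l)) v) (b l))) Y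
        - lift (\<lambda>v w. cscale (r1 l w) (symb v (b l)) + - cscale (r1 l w) (wedge (e l) (contraction (ev l) (b l) v))) Y
        \<in> koszul_relations (Suc p) ?V B1"
      proof (rule lift_congruent[OF Y(1) subspace_koszul_relations])
        fix v w assume v: "length v = Suc p" "set v \<subseteq> ?V"
        have "cscale (r1 l w) (symb (map (\<lambda>x. x - cscale (ev l x) (e l)) v) (b l) - symb v (b l)
            + wedge (e l) (contraction (ev l) (b l) v)) \<in> koszul_relations (Suc p) ?V B1"
          using koszul_relations_closed(5)[OF symb_project[OF H(1) e(1)[OF l] b(1)[OF l] v(2), of "ev l"]] v(1)
          by simp
        then show "cscale (r1 l w) (symb (map (\<lambda>x. x - cscale (ev l x) (e l)) v) (b l))
            - (cscale (r1 l w) (symb v (b l)) + - cscale (r1 l w) (wedge (e l) (contraction (ev l) (b l) v)))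
            \<in> koszul_relations (Suc p) ?V B1"
          by (simp add: cfun.scale_right_diff_distrib cfun.scale_right_distrib algebra_simps)
      qed
      moreover have "lift (\<lambda>v w. cscale (r1 l w) (wedge (e l) (contraction (ev l) (b l) v))) Y = wedge (e l) (C l)"
      proof -
        have c: "contraction (ev l) (b l) v \<in> all_chains" for v
          using contraction_chains[of v UNIV "b l" UNIV] koszul_chains_subset_all by blast
        show ?thesis
          unfolding C_def wedge_def[of "e l"]
          by (simp add: lift_lift[OF all(1)] c all_chains_closed lift_cscale)
      qed
      ultimately show ?thesis
        by (simp only: lift_plus lift_minus_fun P_def N_def) (simp add: algebra_simps)
    qed
    have 2: "coeff_map S (koszul_map Y) + C l \<in> koszul_relations p ?V B1"
    proof -
      have "lift (\<lambda>v w. coeff_map S (koszul_symb v w) + cscale (r1 l w) (contraction (ev l) (b l) v)) Y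
          \<in> koszul_relations p ?V B1"
      proof (rule lift_mem[OF Y(1) subspace_koszul_relations])
        fix v w assume v: "length v = Suc p" "set v \<subseteq> ?V" "w \<in> B1"
        then show "coeff_map S (koszul_symb v w) + cscale (r1 l w) (contraction (ev l) (b l) v)
            \<in> koszul_relations p ?V B1"
          using coeff_map_koszul_symb[OF v(2) b(1)[OF l], of S w "ev l" "r1 l w"] r2(3)[OF l]
          by (auto simp: S_def)
      qed
      moreover have "lift (\<lambda>v w. coeff_map S (koszul_symb v w)) Y = coeff_map S (koszul_map Y)"
        unfolding chain_map_def koszul_map_eq_lift by (simp add: lift_lift all koszul_symb_in_all)
      ultimately show ?thesis by (simp add: lift_plus C_def)
    qed
    have linS: "linear_into B2 B1 S"
      unfolding linear_into_def S_def using r2(1)[OF l] b(1)[OF l] B1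
      by (auto simp: cfun.scale_left_distrib cfun.subspace_scale)
    have 3: "coeff_map S (x - koszul_map Y) \<in> koszul_relations p ?V B1"
      by (rule chain_map_relations[OF Y(2) _ linS]) (simp add: linear_into_def)
    have 4: "coeff_map S x \<in> koszul_relations p ?V B1"
      unfolding chain_map_def
    proof (rule lift_mem[OF x subspace_koszul_relations])
      fix v w assume "length v = p" "set v \<subseteq> ?V" "w \<in> H 2"
      then show "symb (map (\<lambda>v. v) v) (S w) \<in> koszul_relations p ?V B1"
        using symb_zero_coeff[of v ?V "b l" B1 p] b(1)[OF l] r2(2)[OF l] by (simp add: S_def)
    qed
    have "coeff_map S (koszul_map Y) = coeff_map S x - coeff_map S (x - koszul_map Y)"
      by (simp add: chain_map_diff all koszul_map_in_all)
    then have "coeff_map S (koszul_map Y) \<in> koszul_relations p ?V B1"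
      using koszul_relations_closed(3)[OF 4 3] by simp
    then have "C l \<in> koszul_relations p ?V B1"
      using koszul_relations_closed(3)[OF 2] by fastforce
    then have "wedge (e l) (C l) \<in> koszul_relations (Suc p) ?V B1"
      by (rule wedge_relations[OF _ e(1)[OF l]])
    then show ?thesis using koszul_relations_closed(3)[OF 1] by fastforce
  qed
  \<comment> \<open>This has the class of the boundary of \<open>Y\<close>, and its coefficients lie in \<open>H 2\<close>.\<close>
  define x' where "x' = koszul_map YR + (\<Sum>l\<in>L. koszul_map (P l))"
  have x': "x' \<in> koszul_boundaries H p 2"
    unfolding x'_def
  proof (rule cfun.subspace_add[OF subspace_koszul_boundaries koszul_map_in_boundaries[OF YR mult(2)]
      cfun.subspace_sum[OF subspace_koszul_boundaries]])
    fix l assume l: "l \<in> L"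
    have "koszul_map (P l) = lift (\<lambda>v w. cscale (r1 l w) (koszul_symb (map (\<lambda>x. x - cscale (ev l x) (e l)) v) (b l))) Y"
      unfolding P_def koszul_map_eq_lift
      by (simp add: lift_lift all symb_in_all all_chains_closed lift_cscale)
    also have "\<dots> \<in> koszul_boundaries H p 2"
      by (rule lift_mem[OF Y(1) subspace_koszul_boundaries])
         (auto simp: subset_iff intro!: cfun.subspace_scale subspace_koszul_boundaries nodes[OF l] e(2)[OF l])
    finally show "koszul_map (P l) \<in> koszul_boundaries H p 2" .
  qed
  have "koszul_map (YR + (\<Sum>l\<in>L. N l) - Y) \<in> koszul_relations p ?V B2"
    using koszul_map_relations[OF split H(1) mult(1)] by simp
  moreover have "koszul_map (P l - N l) \<in> koszul_relations p ?V B2" if "l \<in> L" for l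
    using koszul_map_relations[OF PN[OF that] H(1) mult(1)] by simp
  ultimately have "(x - koszul_map Y) - koszul_map (YR + (\<Sum>l\<in>L. N l) - Y) - (\<Sum>l\<in>L. koszul_map (P l - N l))
      \<in> koszul_relations p ?V B2"
    by (intro koszul_relations_closed Y(2) cfun.subspace_sum[OF subspace_koszul_relations]) auto
  also have "(x - koszul_map Y) - koszul_map (YR + (\<Sum>l\<in>L. N l) - Y) - (\<Sum>l\<in>L. koszul_map (P l - N l)) = x - x'"
    unfolding x'_def
    by (simp add: koszul_map_diff koszul_map_add koszul_map_sum all Nall Pall all_chains_closed
        cfun.subspace_sum[OF subspace_all_chains] sum_subtractf)
  finally have "x - x' \<in> koszul_relations p ?V B2" .
  moreover have "x - x' \<in> koszul_chains p ?V (H 2)"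
    using x x' by (auto simp: koszul_boundaries_iff intro: koszul_chains_closed)
  ultimately have "x - x' \<in> koszul_boundaries H p 2"
    using relations_restrict_coefficients[OF _ _ H(2)] relations_in_boundaries by blast
  from cfun.subspace_add[OF subspace_koszul_boundaries this x'] show "x \<in> koszul_boundaries H p 2"
    by simp
qed

section \<open>Boundaries from spanning sets and from other algebras\<close>

lemma relations_over_subspace_in_boundaries:
  assumes "x \<in> koszul_relations p V (H 2)" "V \<subseteq> H 1" "x \<in> koszul_chains p (H 1) (H 2)"
  shows "x \<in> koszul_boundaries H p 2"
  using relations_in_boundaries[OF assms(3)] koszul_relations_mono[OF assms(2) subset_refl] assms(1) by blast

text \<open>The differential of \<open>u \<otimes> w\<close> is multilinear in \<open>u\<close> modulo the relations, hence modulo boundaries;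
the factors are expanded one position after the other.\<close>

lemma koszul_symb_spanning_lists:
  fixes H :: "nat \<Rightarrow> ('x \<Rightarrow> complex) set"
  assumes S: "cfun.span S \<subseteq> H 1" and w: "\<And>v. v \<in> cfun.span S \<Longrightarrow> v * w \<in> H 2"
    and base: "\<And>u. length u = Suc p \<Longrightarrow> set u \<subseteq> S \<Longrightarrow> koszul_symb u w \<in> koszul_boundaries H p 2"
    and u: "length u = Suc p" "set u \<subseteq> cfun.span S"
  shows "koszul_symb u w \<in> koszul_boundaries H p 2"
proof -
  let ?T = "koszul_boundaries H p 2"
  note T = subspace_koszul_boundaries[of H p]
  have chain: "koszul_symb u w \<in> koszul_chains p (H 1) (H 2)"
    if "length u = Suc p" "set u \<subseteq> cfun.span S" for u
    using koszul_symb_chains[of u "H 1" w "H 2"] that S w by auto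
  have comb: "koszul_symb (u[i := cscale a s + cscale b t]) w \<in> ?T"
    if l: "length u = Suc p" "set u \<subseteq> cfun.span S" "i < Suc p" "s \<in> cfun.span S" "t \<in> cfun.span S"
      and st: "koszul_symb (u[i := s]) w \<in> ?T" "koszul_symb (u[i := t]) w \<in> ?T" for u i a b s t
  proof -
    let ?D = "koszul_symb (u[i := cscale a s + cscale b t]) w
        - cscale a (koszul_symb (u[i := s]) w) - cscale b (koszul_symb (u[i := t]) w)"
    have upd: "set (u[i := r]) \<subseteq> cfun.span S" if "r \<in> cfun.span S" for r
      using l(2) that set_update_subset_insert[of u i r] by auto
    have "?D \<in> koszul_relations p (cfun.span S) (H 2)"
      using koszul_symb_slot[OF w l(2) _ l(4,5), of i a b] l(1,3) by simp
    moreover have "?D \<in> koszul_chains p (H 1) (H 2)"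
      using l by (intro koszul_chains_closed chain) (auto intro!: upd cfun.span_add cfun.span_scale simp del: set_update_distinct)
    ultimately have "?D \<in> ?T" using relations_over_subspace_in_boundaries S by blast
    then have "?D + (cscale a (koszul_symb (u[i := s]) w) + cscale b (koszul_symb (u[i := t]) w)) \<in> ?T"
      by (intro cfun.subspace_add cfun.subspace_scale T st)
    then show ?thesis by simp
  qed
  \<comment> \<open>The first \<open>n\<close> factors are arbitrary elements of the span, the others are in \<open>S\<close>.\<close>
  have "\<forall>u. length u = Suc p \<longrightarrow> set u \<subseteq> cfun.span S \<longrightarrow> set (drop n u) \<subseteq> S \<longrightarrow> koszul_symb u w \<in> ?T"
    if "n \<le> Suc p" for n
    using that
  proof (induction n)
    case 0
    then show ?case using base by simp
  next
    case (Suc n)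
    show ?case
    proof (intro allI impI)
      fix u assume u: "length u = Suc p" "set u \<subseteq> cfun.span S" "set (drop (Suc n) u) \<subseteq> S"
      have n: "n < length u" using Suc.prems u by simp
      have in_S: "koszul_symb (u[n := s]) w \<in> ?T" if "s \<in> S" for s
      proof -
        have "drop n (u[n := s]) = s # drop (Suc n) u"
          using n by (metis drop_update_cancel Cons_nth_drop_Suc length_list_update lessI nth_list_update_eq)
        moreover have "set (u[n := s]) \<subseteq> cfun.span S"
          using u(2) that set_update_subset_insert[of u n s] cfun.span_base[OF that] by auto
        ultimately show ?thesis using Suc that u by auto
      qed
      have "x \<in> cfun.span S \<and> koszul_symb (u[n := x]) w \<in> ?T" if "x \<in> cfun.span S" for x
        using that
      proof (induction rule: cfun.span_induct_alt)
        case base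
        have 0: "set (u[n := 0]) \<subseteq> cfun.span S"
          using u(2) set_update_subset_insert[of u n 0] cfun.span_zero by blast
        have "koszul_symb (u[n := 0]) w \<in> koszul_relations p (cfun.span S) (H 2)"
          using koszul_symb_slot[OF w u(2) n cfun.span_zero cfun.span_zero, of 0 0] u(1) by simp
        then have "koszul_symb (u[n := 0]) w \<in> ?T"
          by (rule relations_over_subspace_in_boundaries[OF _ S chain]) (use u(1) 0 in simp_all)
        then show ?case by (simp add: cfun.span_zero)
      next
        case (step c x y)
        have "koszul_symb (u[n := cscale c x + cscale 1 y]) w \<in> ?T"
          by (rule comb) (use u n step in_S in \<open>auto intro: cfun.span_base\<close>)
        then show ?case using step by (auto intro: cfun.span_add cfun.span_scale cfun.span_base)
      qed
      from this[OF subsetD[OF u(2) nth_mem[OF n]]] show "koszul_symb u w \<in> ?T" by simp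
    qed
  qed
  from this[of "Suc p"] u show ?thesis by simp
qed

text \<open>The element is a cycle because the square of the differential is zero. It is not visibly a
boundary, since \<open>b\<close> itself need not be a section.\<close>

lemma koszul_vanishes_product:
  assumes N: "koszul_vanishes H p 2" and u: "length u = Suc p" "set u \<subseteq> H 1"
    and b: "\<And>v. v \<in> set u \<Longrightarrow> v * b \<in> H 2"
  shows "koszul_symb u b \<in> koszul_boundaries H p 2"
proof -
  have "koszul_symb u b \<in> koszul_chains p (H 1) (H 2)"
    using koszul_symb_chains[OF u(2) b] u(1) by simp
  then have "koszul_symb u b \<in> koszul_cycles H p 2"
    by (simp add: koszul_cycles_def koszul_map_koszul_symb koszul_relations_closed)
  then show ?thesis using N by (auto simp: koszul_vanishes_def)
qed

lemma koszul_boundaries_transport: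
  assumes x: "x \<in> koszul_boundaries H' p 2"
    and l: "\<And>v. v \<in> H' 1 \<Longrightarrow> l * v \<in> H 1" "\<And>w. w \<in> H' 2 \<Longrightarrow> l * l * w \<in> H 2"
  shows "chain_map ((*) l) ((*) (l * l)) x \<in> koszul_boundaries H p 2"
proof -
  obtain y where y: "x \<in> koszul_chains p (H' 1) (H' 2)" "y \<in> koszul_chains (Suc p) (H' 1) (H' 1)"
      "x - koszul_map y \<in> koszul_relations p (H' 1) (H' 2)"
    using x unfolding koszul_boundaries_iff by blast
  have all: "x \<in> all_chains" "y \<in> all_chains" using y koszul_chains_subset_all by blast+
  have 1: "chain_map ((*) l) ((*) (l * l)) x \<in> koszul_chains p (H 1) (H 2)"
    by (rule chain_map_chains[OF y(1) l])
  have 2: "chain_map ((*) l) ((*) l) y \<in> koszul_chains (Suc p) (H 1) (H 1)"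
    by (rule chain_map_chains[OF y(2) l(1) l(1)])
  have "koszul_map (chain_map ((*) l) ((*) l) y) = chain_map ((*) l) ((*) (l * l)) (koszul_map y)"
    by (rule koszul_map_chain_map[OF all(2)]) (simp add: mult_ac)
  then have "chain_map ((*) l) ((*) (l * l)) x - koszul_map (chain_map ((*) l) ((*) l) y)
      = chain_map ((*) l) ((*) (l * l)) (x - koszul_map y)"
    by (simp add: chain_map_diff all koszul_map_in_all)
  also have "\<dots> \<in> koszul_relations p (H 1) (H 2)"
    by (rule chain_map_relations[OF y(3) linear_into_times[OF l(1)] linear_into_times[OF l(2)]])
  finally show ?thesis unfolding koszul_boundaries_iff using 1 2 by blast
qed

text \<open>Changing \<open>b\<close> by an element of \<open>H 1\<close> changes the differential of \<open>u \<otimes> b\<close> by a boundary.\<close>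

lemma koszul_symb_change_coefficient:
  assumes H: "cfun.subspace (H 2)" and mult: "\<And>v w. v \<in> H 1 \<Longrightarrow> w \<in> H 1 \<Longrightarrow> v * w \<in> H 2"
    and u: "length u = Suc p" "set u \<subseteq> H 1"
    and b: "\<And>v. v \<in> set u \<Longrightarrow> v * b \<in> H 2" "c - b \<in> H 1"
    and bd: "koszul_symb u b \<in> koszul_boundaries H p 2"
  shows "koszul_symb u c \<in> koszul_boundaries H p 2"
proof -
  define r where "r = c - b"
  define W where "W = {w. \<forall>v\<in>set u. v * w \<in> H 2}"
  have W: "r \<in> W" "b \<in> W" using b mult u(2) by (auto simp: W_def r_def)
  have r: "koszul_symb u r \<in> koszul_boundaries H p 2"
    using koszul_map_in_boundaries[OF symb_in_chains[of u "Suc p" "H 1" r "H 1"] mult] u b(2)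
    by (simp add: r_def)
  have cb: "c = cscale 1 b + cscale 1 r" by (simp add: r_def)
  have "v * c \<in> H 2" if v: "v \<in> set u" for v
  proof -
    have "v * b + v * r \<in> H 2"
      using v u(2) b mult by (intro cfun.subspace_add[OF H]) (auto simp: r_def)
    then show ?thesis by (simp add: r_def right_diff_distrib)
  qed
  then have c: "koszul_symb u c \<in> koszul_chains p (H 1) (H 2)"
    using koszul_symb_chains[OF u(2)] u(1) by fastforce
  let ?D = "koszul_symb u (cscale 1 b + cscale 1 r) - cscale 1 (koszul_symb u b) - cscale 1 (koszul_symb u r)"
  have "?D \<in> koszul_relations p (set u) (H 2)"
    using koszul_symb_coeff[of "set u" W "H 2" u b r 1 1] W u(1) by (auto simp: W_def)
  then have D: "?D \<in> koszul_relations p (H 1) (H 2)"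
    using koszul_relations_mono[OF u(2) subset_refl] by blast
  obtain y where y: "y \<in> koszul_chains (Suc p) (H 1) (H 1)"
      "koszul_symb u b + koszul_symb u r - koszul_map y \<in> koszul_relations p (H 1) (H 2)"
    using cfun.subspace_add[OF subspace_koszul_boundaries bd r] unfolding koszul_boundaries_iff by blast
  have "koszul_symb u c - koszul_map y \<in> koszul_relations p (H 1) (H 2)"
    using koszul_relations_closed(2)[OF D y(2)] cb by (simp add: algebra_simps)
  then show ?thesis unfolding koszul_boundaries_iff using c y(1) by blast
qed

section \<open>Binary forms\<close>

text \<open>Forms are handled through their dehomogenization, so that division and absence of zero divisors
come from univariate polynomials.\<close>

definition homogenization :: "nat \<Rightarrow> complex poly \<Rightarrow> complex \<times> complex \<Rightarrow> complex" where
  "homogenization n p = (\<lambda>(t, u). \<Sum>i\<le>n. coeff p i * t ^ i * u ^ (n - i))"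

lemma homogenization_affine:
  assumes "degree p \<le> n" "u \<noteq> 0"
  shows "homogenization n p (t, u) = u ^ n * poly p (t / u)"
proof -
  have "poly p (t / u) = (\<Sum>i\<le>n. coeff p i * (t / u) ^ i)"
    unfolding poly_altdef using assms(1) by (intro sum.mono_neutral_left) (auto simp: coeff_eq_0)
  also have "u ^ n * \<dots> = (\<Sum>i\<le>n. coeff p i * t ^ i * u ^ (n - i))"
    unfolding sum_distrib_left
    by (intro sum.cong) (use assms(2) in \<open>auto simp: power_divide power_diff\<close>)
  finally show ?thesis by (simp add: homogenization_def)
qed

lemma homogenization_infinity: "homogenization n p (t, 0) = coeff p n * t ^ n"
proof -
  have "(\<Sum>i\<le>n. coeff p i * t ^ i * 0 ^ (n - i)) = (\<Sum>i\<in>{n}. coeff p i * t ^ i * 0 ^ (n - i))"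
    by (intro sum.mono_neutral_right) auto
  then show ?thesis by (simp add: homogenization_def)
qed

lemma binary_form_iff: "binary_form n f \<longleftrightarrow> (\<exists>p. degree p \<le> n \<and> f = homogenization n p)"
proof
  assume "binary_form n f"
  then obtain c where c: "\<And>t u. f (t, u) = (\<Sum>i\<le>n. c i * t ^ i * u ^ (n - i))"
    unfolding binary_form_def by blast
  define p where "p = (\<Sum>i\<le>n. monom (c i) i)"
  have "coeff p i = c i" if "i \<le> n" for i
    using that by (simp add: p_def coeff_sum)
  then have "f = homogenization n p"
    by (auto simp: homogenization_def c fun_eq_iff)
  moreover have "degree p \<le> n" unfolding p_def by (rule degree_sum_le) (auto intro: order.trans[OF degree_monom_le])
  ultimately show "\<exists>p. degree p \<le> n \<and> f = homogenization n p" by blast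
next
  assume "\<exists>p. degree p \<le> n \<and> f = homogenization n p"
  then show "binary_form n f" unfolding binary_form_def homogenization_def by auto
qed

lemma homogenization_mult:
  assumes "degree p \<le> n" "degree q \<le> m"
  shows "homogenization (n + m) (p * q) z = homogenization n p z * homogenization m q z"
proof (cases z)
  case (Pair t u)
  have deg: "degree (p * q) \<le> n + m" using degree_mult_le[of p q] assms by linarith
  show ?thesis
  proof (cases "u = 0")
    case True
    have "coeff (p * q) (n + m) = coeff p n * coeff q m"
    proof (cases "degree p = n \<and> degree q = m")
      case True
      then show ?thesis using coeff_mult_degree_sum[of p q] by simp
    next
      case False
      then have "degree (p * q) < n + m" "coeff p n = 0 \<or> coeff q m = 0"
        using degree_mult_le[of p q] assms by (auto intro: coeff_eq_0)
      then show ?thesis by (auto simp: coeff_eq_0)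
    qed
    then show ?thesis using True Pair by (simp add: homogenization_infinity power_add)
  next
    case False
    then show ?thesis using Pair deg assms by (simp add: homogenization_affine power_add)
  qed
qed

lemma binary_form_mult:
  assumes "binary_form n f" "binary_form m g"
  shows "binary_form (n + m) (\<lambda>z. f z * g z)"
proof -
  obtain p q where "degree p \<le> n" "f = homogenization n p" "degree q \<le> m" "g = homogenization m q"
    using assms by (auto simp: binary_form_iff)
  then show ?thesis unfolding binary_form_iff
    using homogenization_mult[of p n q m] degree_mult_le[of p q]
    by (intro exI[of _ "p * q"]) (auto simp: fun_eq_iff)
qed

lemma binary_form_linear:
  assumes "binary_form n f" "binary_form n g"
  shows "binary_form n (\<lambda>z. a * f z + b * g z)"
proof -
  obtain c c' where "\<forall>t u. f (t, u) = (\<Sum>i\<le>n. c i * t ^ i * u ^ (n - i))"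
    "\<forall>t u. g (t, u) = (\<Sum>i\<le>n. c' i * t ^ i * u ^ (n - i))"
    using assms unfolding binary_form_def by blast
  then show ?thesis unfolding binary_form_def
    by (intro exI[of _ "\<lambda>i. a * c i + b * c' i"]) (simp add: sum_distrib_left sum.distrib[symmetric] algebra_simps)
qed

lemma binary_form_0: "binary_form n (\<lambda>z. 0)"
  unfolding binary_form_def by (intro exI[of _ "\<lambda>_. 0"]) simp

lemma binary_form_const: "binary_form 0 (\<lambda>z. c)"
  unfolding binary_form_def by (intro exI[of _ "\<lambda>_. c"]) simp

lemma binary_form_scale: "binary_form n f \<Longrightarrow> binary_form n (\<lambda>z. a * f z)"
  using binary_form_linear[of n f f a 0] by simp

lemma binary_form_sum:
  assumes "\<And>i. i \<in> I \<Longrightarrow> binary_form n (f i)"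
  shows "binary_form n (\<lambda>z. \<Sum>i\<in>I. f i z)"
  using assms
proof (induction I rule: infinite_finite_induct)
  case (insert i I)
  then show ?case using binary_form_linear[of n "f i" "\<lambda>z. \<Sum>i\<in>I. f i z" 1 1] by simp
qed (simp_all add: binary_form_0)

lemma vanishing_form_apply: "vanishing_form x z = snd x * fst z - fst x * snd z"
  by (simp add: vanishing_form_def split: prod.splits)

lemma vanishing_form_swap: "vanishing_form x z = - vanishing_form z x"
  by (simp add: vanishing_form_apply)

lemma vanishing_form_self [simp]: "vanishing_form x x = 0"
  by (simp add: vanishing_form_apply)

lemma binary_form_vanishing_form: "binary_form 1 (vanishing_form x)"
  unfolding binary_form_def
  by (intro exI[of _ "\<lambda>i. if i = 0 then - fst x else snd x"]) (simp add: vanishing_form_apply)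

lemma binary_form_prod:
  assumes "finite A"
  shows "binary_form (card A) (\<lambda>z. \<Prod>r\<in>A. vanishing_form (x r) z)"
  using assms
proof (induction A rule: finite_induct)
  case empty
  then show ?case by (simp add: binary_form_const)
next
  case (insert r A)
  then show ?case using binary_form_mult[OF binary_form_vanishing_form[of "x r"]] by simp
qed

lemma binary_form_homogeneous:
  assumes "binary_form n f"
  shows "f (c * t, c * u) = c ^ n * f (t, u)"
proof -
  obtain k where k: "\<And>t u. f (t, u) = (\<Sum>i\<le>n. k i * t ^ i * u ^ (n - i))"
    using assms unfolding binary_form_def by blast
  have key: "k i * (c * t) ^ i * (c * u) ^ (n - i) = c ^ n * (k i * t ^ i * u ^ (n - i))" if "i \<le> n" for i
  proof -
    have "c ^ n = c ^ i * c ^ (n - i)" using that by (simp add: power_add[symmetric])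
    then show ?thesis by (simp add: power_mult_distrib)
  qed
  show ?thesis unfolding k sum_distrib_left by (intro sum.cong refl key) simp
qed

lemma binary_form_divide:
  assumes f: "binary_form (Suc n) f" and x: "x \<noteq> (0, 0)" and fx: "f x = 0"
  obtains g where "binary_form n g" "\<And>z. f z = vanishing_form x z * g z"
proof -
  obtain p where p: "degree p \<le> Suc n" "f = homogenization (Suc n) p"
    using f by (auto simp: binary_form_iff)
  obtain a b where ab: "x = (a, b)" by (cases x)
  show ?thesis
  proof (cases "b = 0")
    case True
    then have a: "a \<noteq> 0" using x ab by simp
    then have "coeff p (Suc n) = 0" using fx True by (simp add: ab p homogenization_infinity)
    then have deg: "degree p \<le> n" using p(1) by (metis le_SucE leading_coeff_0_iff degree_0 le0)
    have "f z = snd z * homogenization n p z" for z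
    proof (cases z)
      case (Pair t u)
      have "(\<Sum>i\<le>Suc n. coeff p i * t ^ i * u ^ (Suc n - i)) = (\<Sum>i\<le>n. coeff p i * t ^ i * u ^ (Suc n - i))"
        by (simp add: \<open>coeff p (Suc n) = 0\<close>)
      also have "\<dots> = u * (\<Sum>i\<le>n. coeff p i * t ^ i * u ^ (n - i))"
        unfolding sum_distrib_left by (intro sum.cong) (auto simp: Suc_diff_le)
      finally show ?thesis using Pair by (simp add: p(2) homogenization_def)
    qed
    moreover have "binary_form n (\<lambda>z. - (1 / a) * homogenization n p z)"
      by (rule binary_form_scale) (use deg binary_form_iff in blast)
    ultimately show ?thesis
      using that[of "\<lambda>z. - (1 / a) * homogenization n p z"] True a by (simp add: ab vanishing_form_apply)
  next
    case False
    then have "poly p (a / b) = 0" using fx p by (simp add: ab homogenization_affine)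
    then obtain q where q: "p = [:- (a / b), 1:] * q" by (metis poly_eq_0_iff_dvd dvdE)
    have dq: "degree q \<le> n"
    proof (cases "q = 0")
      case False
      then have "degree p = Suc (degree q)" unfolding q by (subst degree_mult_eq) auto
      then show ?thesis using p(1) by simp
    qed simp
    have "f z = homogenization 1 [:- (a / b), 1:] z * homogenization n q z" for z
      using homogenization_mult[of "[:- (a / b), 1:]" 1 q n z] dq by (simp add: p(2) q)
    moreover have "homogenization 1 [:- (a / b), 1:] z = (1 / b) * vanishing_form x z" for z
      using False by (cases z) (simp add: homogenization_def ab vanishing_form_apply field_simps)
    moreover have "binary_form n (\<lambda>z. (1 / b) * homogenization n q z)"
      by (rule binary_form_scale) (use dq binary_form_iff in blast)
    ultimately show ?thesis using that[of "\<lambda>z. (1 / b) * homogenization n q z"] by simp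
  qed
qed

lemma binary_form_mult_eq_0:
  assumes f: "binary_form n f" and g: "binary_form m g" and fg: "\<And>z. f z * g z = 0" and f0: "f z0 \<noteq> 0"
  shows "g z = 0"
proof -
  obtain p q where p: "degree p \<le> n" "f = homogenization n p" and q: "degree q \<le> m" "g = homogenization m q"
    using f g by (auto simp: binary_form_iff)
  have "poly (p * q) t = 0" for t
    using fg[of "(t, 1)"] p q by (simp add: homogenization_affine)
  then have "p * q = 0" using poly_all_0_iff_0[of "p * q"] by blast
  moreover have "p \<noteq> 0" using f0 by (auto simp: p(2) homogenization_def split: prod.splits)
  ultimately have "q = 0" by simp
  then show ?thesis by (simp add: q(2) homogenization_def split: prod.splits)
qed

lemma vanishing_form_nonzero:
  assumes "x \<noteq> (0, 0)"
  shows "\<exists>z. vanishing_form x z \<noteq> 0"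
proof (cases "snd x = 0")
  case True
  then have "vanishing_form x (0, 1) \<noteq> 0" using assms by (cases x) (simp add: vanishing_form_apply)
  then show ?thesis ..
next
  case False
  then have "vanishing_form x (1, 0) \<noteq> 0" by (simp add: vanishing_form_apply)
  then show ?thesis ..
qed

text \<open>Pairwise different points of the projective line.\<close>

definition independent_points :: "'i set \<Rightarrow> ('i \<Rightarrow> complex \<times> complex) \<Rightarrow> bool" where
  "independent_points A x \<longleftrightarrow>
     (\<forall>r\<in>A. x r \<noteq> (0, 0)) \<and> (\<forall>r\<in>A. \<forall>s\<in>A. r \<noteq> s \<longrightarrow> vanishing_form (x r) (x s) \<noteq> 0)"

lemma independent_points_subset: "independent_points A x \<Longrightarrow> B \<subseteq> A \<Longrightarrow> independent_points B x"
  by (auto simp: independent_points_def)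

lemma binary_form_divide_prod:
  assumes "finite A" "independent_points A x" "binary_form (card A + n) f" "\<And>r. r \<in> A \<Longrightarrow> f (x r) = 0"
  shows "\<exists>g. binary_form n g \<and> (\<forall>z. f z = (\<Prod>r\<in>A. vanishing_form (x r) z) * g z)"
  using assms
proof (induction A arbitrary: f rule: finite_induct)
  case empty
  then show ?case by auto
next
  case (insert r A)
  have xr: "x r \<noteq> (0, 0)" using insert.prems(1) by (simp add: independent_points_def)
  have "binary_form (Suc (card A + n)) f" using insert by simp
  then obtain f' where f': "binary_form (card A + n) f'" "\<And>z. f z = vanishing_form (x r) z * f' z"
    using binary_form_divide[OF _ xr] insert.prems(3) by blast
  have "f' (x s) = 0" if "s \<in> A" for s
  proof -
    have "vanishing_form (x r) (x s) \<noteq> 0"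
      using insert.prems(1) insert.hyps(2) that unfolding independent_points_def by auto
    then show ?thesis using f'(2)[of "x s"] insert.prems(3)[of s] that by simp
  qed
  then obtain g where "binary_form n g" "\<And>z. f' z = (\<Prod>r\<in>A. vanishing_form (x r) z) * g z"
    using insert.IH[OF independent_points_subset[OF insert.prems(1)] f'(1)] by blast
  then show ?case using f' insert.hyps by (intro exI[of _ g]) (simp add: mult.assoc)
qed

lemma interpolating_form:
  assumes A: "finite A" "independent_points A x"
  shows "\<exists>f. binary_form (card A) f \<and> (\<forall>r\<in>A. f (x r) = y r)"
proof -
  have "\<exists>f. binary_form (card A) f \<and> f (x r) \<noteq> 0 \<and> (\<forall>s\<in>A - {r}. f (x s) = 0)" if r: "r \<in> A" for r
  proof -
    have "x r \<noteq> (0, 0)" using A r by (simp add: independent_points_def)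
    then obtain z where z: "vanishing_form (x r) z \<noteq> 0" using vanishing_form_nonzero by blast
    define f where "f w = vanishing_form z w * (\<Prod>s\<in>A - {r}. vanishing_form (x s) w)" for w
    have "binary_form (1 + card (A - {r})) f"
      unfolding f_def by (intro binary_form_mult binary_form_vanishing_form binary_form_prod) (use A in simp)
    moreover have "1 + card (A - {r}) = card A" using A r by (metis card.remove plus_1_eq_Suc)
    moreover have "f (x r) \<noteq> 0"
      using z vanishing_form_swap[of z "x r"] A r unfolding f_def independent_points_def by auto
    moreover have "f (x s) = 0" if "s \<in> A - {r}" for s
      unfolding f_def using prod_zero[of "A - {r}" "\<lambda>s'. vanishing_form (x s') (x s)"] A that
      by (auto intro: bexI[of _ s])
    ultimately show ?thesis by auto
  qed
  then obtain f where f: "\<And>r. r \<in> A \<Longrightarrow> binary_form (card A) (f r) \<and> f r (x r) \<noteq> 0 \<and> (\<forall>s\<in>A - {r}. f r (x s) = 0)"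
    by metis
  define F where "F z = (\<Sum>r\<in>A. y r / f r (x r) * f r z)" for z
  have "binary_form (card A) F"
    unfolding F_def by (intro binary_form_sum binary_form_scale) (use f in blast)
  moreover have "F (x s) = y s" if s: "s \<in> A" for s
  proof -
    have "F (x s) = (\<Sum>r\<in>{s}. y r / f r (x r) * f r (x s))"
      unfolding F_def using A s f by (intro sum.mono_neutral_right) auto
    then show ?thesis using f[OF s] by simp
  qed
  ultimately show ?thesis by blast
qed

text \<open>With \<open>n = card A\<close>, two coprime forms of degree \<open>n\<close> generate all forms of degree \<open>2 n\<close>: choose \<open>b\<close>
so that \<open>w\<close> and \<open>f2 b\<close> agree at the zeros of the first form, which is a product of distinct linear
factors, and divide.\<close>

lemma pencil_generates:
  assumes A: "finite A" "independent_points A x" and c: "c \<noteq> 0"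
    and f2: "binary_form (card A) f2" "\<And>r. r \<in> A \<Longrightarrow> f2 (x r) \<noteq> 0"
    and w: "binary_form (card A + card A) w"
  shows "\<exists>a b. binary_form (card A) a \<and> binary_form (card A) b \<and>
    (\<forall>z. w z = c * (\<Prod>r\<in>A. vanishing_form (x r) z) * a z + f2 z * b z)"
proof -
  obtain b where b: "binary_form (card A) b" "\<And>r. r \<in> A \<Longrightarrow> b (x r) = w (x r) / f2 (x r)"
    using interpolating_form[OF A, of "\<lambda>r. w (x r) / f2 (x r)"] by blast
  have "binary_form (card A + card A) (\<lambda>z. w z - f2 z * b z)"
    using binary_form_linear[OF w binary_form_mult[OF f2(1) b(1)], of 1 "-1"] by simp
  moreover have "w (x r) - f2 (x r) * b (x r) = 0" if "r \<in> A" for r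
    using b(2)[OF that] f2(2)[OF that] by simp
  ultimately obtain a where a: "binary_form (card A) a"
      "\<And>z. w z - f2 z * b z = (\<Prod>r\<in>A. vanishing_form (x r) z) * a z"
    using binary_form_divide_prod[OF A, of "card A" "\<lambda>z. w z - f2 z * b z"] by blast
  have "w z = c * (\<Prod>r\<in>A. vanishing_form (x r) z) * ((1 / c) * a z) + f2 z * b z" for z
    using a(2)[of z] c by (simp add: field_simps)
  then show ?thesis using binary_form_scale[OF a(1), of "1 / c"] b(1) by blast
qed

text \<open>At the zeros of the first form \<open>v\<close> has to vanish, because \<open>f2\<close> does not; so \<open>v\<close> is divisible by
it.\<close>

lemma pencil_syzygy:
  assumes A: "finite A" "independent_points A x" and c: "c \<noteq> 0"
    and f2: "binary_form (card A) f2" "\<And>r. r \<in> A \<Longrightarrow> f2 (x r) \<noteq> 0"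
    and v: "binary_form (card A + n) v" and u: "binary_form (card A + n) u"
    and syz: "\<And>z. c * (\<Prod>r\<in>A. vanishing_form (x r) z) * u z + f2 z * v z = 0"
  shows "\<exists>e. binary_form n e \<and> (\<forall>z. u z = f2 z * e z)"
proof -
  have "v (x r) = 0" if "r \<in> A" for r
  proof -
    have "(\<Prod>s\<in>A. vanishing_form (x s) (x r)) = 0"
      by (rule prod_zero) (use A that in \<open>auto intro: bexI[of _ r]\<close>)
    then show ?thesis using syz[of "x r"] f2(2)[OF that] by simp
  qed
  then obtain e where e: "binary_form n e" "\<And>z. v z = (\<Prod>r\<in>A. vanishing_form (x r) z) * e z"
    using binary_form_divide_prod[OF A v] by blast
  define P where "P z = (\<Prod>r\<in>A. vanishing_form (x r) z)" for z
  have "\<exists>z. P z \<noteq> 0"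
  proof (rule ccontr)
    assume "\<not> ?thesis"
    then have P: "P z = 0" for z by blast
    have "infinite (UNIV :: complex set)" by (simp add: infinite_UNIV_char_0)
    moreover have "finite ((\<lambda>r. fst (x r) / snd (x r)) ` A)" using A by simp
    ultimately obtain t where t: "t \<notin> (\<lambda>r. fst (x r) / snd (x r)) ` A"
      by (metis ex_new_if_finite)
    have "vanishing_form (x r) (t, 1) \<noteq> 0" if "r \<in> A" for r
    proof
      assume "vanishing_form (x r) (t, 1) = 0"
      then have *: "snd (x r) * t = fst (x r)" by (simp add: vanishing_form_apply)
      then have "snd (x r) \<noteq> 0" using A(2) that by (cases "x r") (auto simp: independent_points_def)
      then have "t = fst (x r) / snd (x r)" using * by (simp add: field_simps)
      then show False using t that by blast
    qed
    then show False using P[of "(t, 1)"] A(1) by (simp add: P_def)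
  qed
  then obtain z0 where z0: "P z0 \<noteq> 0" by blast
  have "binary_form (card A + n) (\<lambda>z. c * u z + f2 z * e z)"
    using binary_form_linear[OF u binary_form_mult[OF f2(1) e(1)], of c 1] by simp
  moreover have "P z * (c * u z + f2 z * e z) = 0" for z
    using syz[of z] e(2)[of z] by (simp add: P_def algebra_simps)
  ultimately have "c * u z + f2 z * e z = 0" for z
    using binary_form_mult_eq_0[of "card A" P] binary_form_prod[OF A(1), of x] z0
    unfolding P_def by blast
  then have "u z = f2 z * (- (1 / c) * e z)" for z
    using c by (simp add: field_simps eq_neg_iff_add_eq_0)
  then show ?thesis using binary_form_scale[OF e(1), of "- (1 / c)"] by blast
qed

section \<open>Sections on two glued lines\<close>

definition form_pairs :: "nat \<Rightarrow> curve_section set" where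
  "form_pairs m = {s. \<forall>j. binary_form m (\<lambda>z. s (j, z))}"

lemma subspace_form_pairs: "cfun.subspace (form_pairs m)"
  unfolding cfun.subspace_def
proof (intro conjI ballI allI)
  show "0 \<in> form_pairs m" by (simp add: form_pairs_def fun_apply binary_form_0)
next
  fix s t assume "s \<in> form_pairs m" "t \<in> form_pairs m"
  then show "s + t \<in> form_pairs m"
    using binary_form_linear[of m "\<lambda>z. s (j, z)" "\<lambda>z. t (j, z)" 1 1 for j]
    by (simp add: form_pairs_def fun_apply)
next
  fix c s assume "s \<in> form_pairs m"
  then show "cscale c s \<in> form_pairs m"
    by (simp add: form_pairs_def cscale_def binary_form_scale)
qed

lemma form_pairs_mult: "s \<in> form_pairs m \<Longrightarrow> t \<in> form_pairs n \<Longrightarrow> s * t \<in> form_pairs (m + n)"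
  by (simp add: form_pairs_def fun_apply binary_form_mult)

definition node_value ::
    "nat \<Rightarrow> (nat \<Rightarrow> branch \<Rightarrow> complex \<times> complex) \<Rightarrow> nat \<Rightarrow> branch \<Rightarrow> nat \<Rightarrow> curve_section \<Rightarrow> complex" where
  "node_value g x q j l s = node_residue g (\<lambda>r. x r j) q (\<lambda>z. s (j, z)) l"

text \<open>The failure of a pair of forms to be a section at the node \<open>l\<close>; for \<open>q = 1\<close> it compares two
residues.\<close>

definition gluing_defect ::
    "nat \<Rightarrow> (nat \<Rightarrow> branch \<Rightarrow> complex \<times> complex) \<Rightarrow> (nat \<Rightarrow> complex) \<Rightarrow> nat \<Rightarrow> nat \<Rightarrow> curve_section \<Rightarrow> complex" where
  "gluing_defect g x h q l s = node_value g x q Br1 l s - (- h l) ^ q * node_value g x q Br2 l s"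

lemma twisted_canonical_sections_iff:
  "s \<in> twisted_canonical_sections g x h q \<longleftrightarrow>
     s \<in> form_pairs (q * (g - 1)) \<and> (\<forall>l\<in>{1..g + 1}. gluing_defect g x h q l s = 0)"
  by (simp add: twisted_canonical_sections_def form_pairs_def gluing_defect_def node_value_def)

lemma node_value_linear:
  "node_value g x q j l (cscale a s + cscale b t) = a * node_value g x q j l s + b * node_value g x q j l t"
  by (simp add: node_value_def node_residue_def fun_apply cscale_def add_divide_distrib)

lemma gluing_defect_linear:
  "gluing_defect g x h q l (cscale a s + cscale b t) = a * gluing_defect g x h q l s + b * gluing_defect g x h q l t"
  by (simp add: gluing_defect_def node_value_linear algebra_simps)

lemma gluing_defect_diff: "gluing_defect g x h q l (s - t) = gluing_defect g x h q l s - gluing_defect g x h q l t"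
  using gluing_defect_linear[of g x h q l 1 s "-1" t] by (simp add: cscale_minus_one)

lemma node_value_diff: "node_value g x q j l (s - t) = node_value g x q j l s - node_value g x q j l t"
  using node_value_linear[of g x q j l 1 s "-1" t] by (simp add: cscale_minus_one)

lemma node_value_cscale: "node_value g x q j l (cscale a s) = a * node_value g x q j l s"
  using node_value_linear[of g x q j l a s 0 s] by simp

lemma gluing_defect_cscale: "gluing_defect g x h q l (cscale a s) = a * gluing_defect g x h q l s"
  using gluing_defect_linear[of g x h q l a s 0 s] by simp

lemma gluing_defect_sum:
  "finite L \<Longrightarrow> gluing_defect g x h q l (\<Sum>i\<in>L. s i) = (\<Sum>i\<in>L. gluing_defect g x h q l (s i))"
proof (induction L rule: finite_induct)
  case empty
  then show ?case by (simp add: gluing_defect_def node_value_def node_residue_def fun_apply)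
next
  case (insert i L)
  then show ?case using gluing_defect_linear[of g x h q l 1 "s i" 1 "\<Sum>i\<in>L. s i"] by simp
qed

lemma node_value_mult:
  "node_value g x (q + q') j l (s * t) = node_value g x q j l s * node_value g x q' j l t"
  by (simp add: node_value_def node_residue_def fun_apply power_add)

lemma subspace_twisted_canonical_sections: "cfun.subspace (twisted_canonical_sections g x h q)"
  unfolding cfun.subspace_def
proof (intro conjI ballI allI)
  show "0 \<in> twisted_canonical_sections g x h q"
    using gluing_defect_cscale[of g x h q _ 0 0] cfun.subspace_0[OF subspace_form_pairs]
    by (simp add: twisted_canonical_sections_iff)
next
  fix s t assume "s \<in> twisted_canonical_sections g x h q" "t \<in> twisted_canonical_sections g x h q"
  then show "s + t \<in> twisted_canonical_sections g x h q"
    using gluing_defect_linear[of g x h q _ 1 s 1 t] cfun.subspace_add[OF subspace_form_pairs]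
    by (simp add: twisted_canonical_sections_iff)
next
  fix c s assume "s \<in> twisted_canonical_sections g x h q"
  then show "cscale c s \<in> twisted_canonical_sections g x h q"
    by (simp add: twisted_canonical_sections_iff gluing_defect_cscale cfun.subspace_scale[OF subspace_form_pairs])
qed

text \<open>Residues are multiplicative, and the two residues of a glued \<open>v\<close> differ by the factor \<open>- h l\<close>, so
the value of \<open>v\<close> on the first line can be factored out.\<close>

lemma gluing_defect_mult:
  assumes "gluing_defect g x h 1 l v = 0"
  shows "gluing_defect g x h 2 l (v * w) = node_value g x 1 Br1 l v * gluing_defect g x h 1 l w"
proof -
  have v: "node_value g x 1 Br1 l v = - h l * node_value g x 1 Br2 l v"
    using assms by (simp add: gluing_defect_def eq_neg_iff_add_eq_0)
  have "node_value g x 2 j l (v * w) = node_value g x 1 j l v * node_value g x 1 j l w" for j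
    using node_value_mult[of g x 1 1 j l v w] by (simp add: numeral_2_eq_2)
  then show ?thesis unfolding gluing_defect_def using v
    by (simp add: power2_eq_square algebra_simps)
qed

lemma twisted_canonical_sections_mult:
  assumes "v \<in> twisted_canonical_sections g x h 1" "w \<in> twisted_canonical_sections g x h 1"
  shows "v * w \<in> twisted_canonical_sections g x h 2"
  using assms form_pairs_mult[of v "g - 1" w "g - 1"] gluing_defect_mult[of g x h _ v w]
  by (simp add: twisted_canonical_sections_iff mult_2)

definition independent_nodes :: "nat \<Rightarrow> (nat \<Rightarrow> branch \<Rightarrow> complex \<times> complex) \<Rightarrow> bool" where
  "independent_nodes g x \<longleftrightarrow> (\<forall>j. independent_points {1..g + 1} (\<lambda>r. x r j))"

lemma node_denominator_nonzero:
  assumes "independent_nodes g x" "l \<in> {1..g + 1}"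
  shows "(\<Prod>r\<in>{1..g + 1} - {l}. vanishing_form (x r j) (x l j)) \<noteq> 0"
  using assms by (auto simp: independent_nodes_def independent_points_def)

lemma node_value_eq_0_iff:
  assumes "independent_nodes g x" "l \<in> {1..g + 1}"
  shows "node_value g x q j l s = 0 \<longleftrightarrow> s (j, x l j) = 0"
  using node_denominator_nonzero[OF assms, of j] by (simp add: node_value_def node_residue_def)

text \<open>The form with residue 1 at the node \<open>m\<close>, residue \<open>-1\<close> at \<open>m'\<close>, and no other residue.\<close>

definition residue_pair :: "nat \<Rightarrow> (nat \<Rightarrow> branch \<Rightarrow> complex \<times> complex) \<Rightarrow> branch \<Rightarrow> nat \<Rightarrow> nat \<Rightarrow> complex \<times> complex \<Rightarrow> complex" where
  "residue_pair g x j m m' = (\<lambda>z. if m = m' then 0 else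
     vanishing_form (x m' j) (x m j) * (\<Prod>r\<in>{1..g + 1} - {m, m'}. vanishing_form (x r j) z))"

lemma binary_form_residue_pair:
  assumes "m \<in> {1..g + 1}" "m' \<in> {1..g + 1}"
  shows "binary_form (g - 1) (residue_pair g x j m m')"
proof (cases "m = m'")
  case True
  then show ?thesis by (simp add: residue_pair_def binary_form_0)
next
  case False
  then have "card ({1..g + 1} - {m, m'}) = g - 1"
    using assms by (subst card_Diff_subset) auto
  then show ?thesis
    using False binary_form_scale[OF binary_form_prod[of "{1..g + 1} - {m, m'}" "\<lambda>r. x r j"]]
    by (simp add: residue_pair_def)
qed

lemma node_residue_residue_pair:
  assumes x: "independent_nodes g x" and m: "m \<in> {1..g + 1}" "m' \<in> {1..g + 1}" and l: "l \<in> {1..g + 1}"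
  shows "node_residue g (\<lambda>r. x r j) 1 (residue_pair g x j m m') l
    = (if l = m then 1 else 0) - (if l = m' then 1 else 0)"
proof (cases "m = m'")
  case True
  then show ?thesis by (simp add: node_residue_def residue_pair_def)
next
  case False
  let ?v = "\<lambda>r s. vanishing_form (x r j) (x s j)"
  have split: "(\<Prod>r\<in>{1..g + 1} - {m}. ?v r m) = ?v m' m * (\<Prod>r\<in>{1..g + 1} - {m, m'}. ?v r m)"
    if "m \<noteq> m'" "m' \<in> {1..g + 1}" for m m'
  proof -
    have "{1..g + 1} - {m} - {m'} = {1..g + 1} - {m, m'}" by auto
    then show ?thesis using that prod.remove[of "{1..g + 1} - {m}" m' "\<lambda>r. ?v r m"] by simp
  qed
  have ne: "?v m m' \<noteq> 0" "?v m' m \<noteq> 0"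
    using x m False by (auto simp: independent_nodes_def independent_points_def)
  have nz: "(\<Prod>r\<in>{1..g + 1} - {l}. ?v r l) \<noteq> 0" by (rule node_denominator_nonzero[OF x l])
  consider "l = m" | "l = m'" | "l \<noteq> m" "l \<noteq> m'" by blast
  then show ?thesis
  proof cases
    case 1
    then have "(\<Prod>r\<in>{1..g + 1} - {m, m'}. ?v r m) \<noteq> 0" using nz split[OF False m(2)] by auto
    then show ?thesis unfolding node_residue_def residue_pair_def 1 split[OF False m(2)]
      using False ne by simp
  next
    case 2
    have sw: "{1..g + 1} - {m', m} = {1..g + 1} - {m, m'}" by auto
    note split' = split[of m' m, unfolded sw, OF False[symmetric] m(1)]
    from 2 have "(\<Prod>r\<in>{1..g + 1} - {m, m'}. ?v r m') \<noteq> 0" using nz split' by auto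
    moreover have "?v m' m = - ?v m m'" by (rule vanishing_form_swap)
    ultimately show ?thesis unfolding node_residue_def residue_pair_def 2 split'
      using False ne by simp
  next
    case 3
    have "(\<Prod>r\<in>{1..g + 1} - {m, m'}. ?v r l) = 0"
      by (rule prod_zero) (use 3 l in \<open>auto intro: bexI[of _ l]\<close>)
    then show ?thesis using 3 False by (simp add: node_residue_def residue_pair_def)
  qed
qed

text \<open>On one line the residues of a form sum to zero. A defect at a single node is reached by moving the
total residue to two nodes \<open>m\<close>, \<open>m'\<close> where the lines are glued with opposite signs: one half at
each of them can be cancelled by a form on the second line.\<close>

lemma defect_dual:
  assumes x: "independent_nodes g x" and m: "m \<in> {1..g + 1}" "m' \<in> {1..g + 1}" "h m = 1" "h m' = -1"
    and l: "l \<in> {1..g + 1}"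
  shows "\<exists>b\<in>form_pairs (g - 1). \<forall>i\<in>{1..g + 1}. gluing_defect g x h 1 i b = (if i = l then 1 else 0)"
proof -
  define b :: curve_section where "b = (\<lambda>(j, z). case j of
      Br1 \<Rightarrow> 1 / 2 * residue_pair g x Br1 l m z + 1 / 2 * residue_pair g x Br1 l m' z
    | Br2 \<Rightarrow> 1 / 2 * residue_pair g x Br2 m m' z)"
  have b1: "(\<lambda>z. b (Br1, z)) = (\<lambda>z. 1 / 2 * residue_pair g x Br1 l m z + 1 / 2 * residue_pair g x Br1 l m' z)"
    and b2: "(\<lambda>z. b (Br2, z)) = (\<lambda>z. 1 / 2 * residue_pair g x Br2 m m' z)"
    by (simp_all add: b_def)
  have "binary_form (g - 1) (\<lambda>z. b (j, z))" for j
    by (cases j) (simp_all only: b1 b2 binary_form_linear binary_form_scale binary_form_residue_pair m l)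
  moreover have "gluing_defect g x h 1 i b = (if i = l then 1 else 0)" if i: "i \<in> {1..g + 1}" for i
  proof -
    have v1: "node_value g x 1 Br1 i b = 1 / 2 * node_residue g (\<lambda>r. x r Br1) 1 (residue_pair g x Br1 l m) i
        + 1 / 2 * node_residue g (\<lambda>r. x r Br1) 1 (residue_pair g x Br1 l m') i"
      unfolding node_value_def b1 by (simp add: node_residue_def add_divide_distrib)
    have v2: "node_value g x 1 Br2 i b = 1 / 2 * node_residue g (\<lambda>r. x r Br2) 1 (residue_pair g x Br2 m m') i"
      unfolding node_value_def b2 by (simp add: node_residue_def)
    have "m \<noteq> m'" using m(3,4) by auto
    then show ?thesis
      unfolding gluing_defect_def v1 v2 node_residue_residue_pair[OF x l m(1) i]
        node_residue_residue_pair[OF x l m(2) i] node_residue_residue_pair[OF x m(1,2) i]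
      using m(3,4) by auto
  qed
  ultimately show ?thesis by (intro bexI[of _ b]) (simp_all add: form_pairs_def)
qed

text \<open>The only defect of the product is the value of \<open>v\<close> at \<open>l\<close>, which is zero.\<close>

lemma section_times_dual:
  assumes "v \<in> twisted_canonical_sections g x h 1" "node_value g x 1 Br1 l v = 0"
    and b: "b \<in> form_pairs (g - 1)" "\<And>i. i \<in> {1..g + 1} \<Longrightarrow> gluing_defect g x h 1 i b = (if i = l then 1 else 0)"
  shows "v * b \<in> twisted_canonical_sections g x h 2"
proof -
  have "v * b \<in> form_pairs (2 * (g - 1))"
    using form_pairs_mult[of v "g - 1" b "g - 1"] assms(1) b(1) by (simp add: twisted_canonical_sections_iff mult_2)
  moreover have "gluing_defect g x h 2 i (v * b) = 0" if i: "i \<in> {1..g + 1}" for i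
  proof -
    have "gluing_defect g x h 1 i v = 0" using assms(1) i by (simp add: twisted_canonical_sections_iff)
    then show ?thesis using gluing_defect_mult[of g x h i v b] b(2)[OF i] assms(2) by (auto split: if_splits)
  qed
  ultimately show ?thesis by (simp add: twisted_canonical_sections_iff)
qed

text \<open>Two coefficients with the same gluing defects differ by a section.\<close>

lemma dual_coefficient_irrelevant:
  fixes g x h
  defines "H \<equiv> twisted_canonical_sections g x h"
  assumes l: "l \<in> {1..g + 1}" and u: "length u = Suc p" "set u \<subseteq> {v \<in> H 1. node_value g x 1 Br1 l v = 0}"
    and b: "b \<in> form_pairs (g - 1)" "\<And>i. i \<in> {1..g + 1} \<Longrightarrow> gluing_defect g x h 1 i b = (if i = l then 1 else 0)"
    and b': "b' \<in> form_pairs (g - 1)" "\<And>i. i \<in> {1..g + 1} \<Longrightarrow> gluing_defect g x h 1 i b' = (if i = l then 1 else 0)"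
    and bd: "koszul_symb u b' \<in> koszul_boundaries H p 2"
  shows "koszul_symb u b \<in> koszul_boundaries H p 2"
proof (rule koszul_symb_change_coefficient[OF _ _ u(1) _ _ _ bd])
  have H_iff: "s \<in> H q \<longleftrightarrow> s \<in> form_pairs (q * (g - 1)) \<and> (\<forall>l\<in>{1..g + 1}. gluing_defect g x h q l s = 0)" for s q
    unfolding H_def by (rule twisted_canonical_sections_iff)
  show "cfun.subspace (H 2)" unfolding H_def by (rule subspace_twisted_canonical_sections)
  show "v * w \<in> H 2" if "v \<in> H 1" "w \<in> H 1" for v w
    using that twisted_canonical_sections_mult unfolding H_def by blast
  show "set u \<subseteq> H 1" using u(2) by blast
  show "v * b' \<in> H 2" if v: "v \<in> set u" for v
    unfolding H_def by (rule section_times_dual[OF _ _ b']) (use u(2) v in \<open>auto simp: H_def\<close>)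
  show "b - b' \<in> H 1"
    unfolding H_iff using b b' cfun.subspace_diff[OF subspace_form_pairs]
    by (simp add: gluing_defect_diff)
qed

text \<open>The algebraic criterion applied to two glued lines. The form \<open>f1\<close> splits into distinct linear
factors, one for each node of \<open>A\<close>, and \<open>f2\<close> does not vanish at these nodes.\<close>

lemma koszul_vanishes_twisted:
  fixes g x h
  defines "H \<equiv> twisted_canonical_sections g x h"
  assumes x: "independent_nodes g x" and m: "m \<in> {1..g + 1}" "m' \<in> {1..g + 1}" "h m = 1" "h m' = -1"
    and A: "A \<subseteq> {1..g + 1}" "card A = g - 1"
    and f1: "f1 \<in> H 1" "\<And>j. c j \<noteq> 0" "\<And>j z. f1 (j, z) = c j * (\<Prod>r\<in>A. vanishing_form (x r j) z)"
    and f2: "f2 \<in> H 1" "\<And>j r. r \<in> A \<Longrightarrow> f2 (j, x r j) \<noteq> 0" "A \<noteq> {}"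
    and e: "\<And>l. l \<in> {1..g + 1} \<Longrightarrow> \<exists>e\<in>H 1. node_value g x 1 Br1 l e \<noteq> 0"
    and nodes: "\<And>l u b. l \<in> {1..g + 1} \<Longrightarrow> length u = Suc p \<Longrightarrow>
        set u \<subseteq> {v \<in> H 1. node_value g x 1 Br1 l v = 0} \<Longrightarrow> b \<in> form_pairs (g - 1) \<Longrightarrow>
        (\<And>i. i \<in> {1..g + 1} \<Longrightarrow> gluing_defect g x h 1 i b = (if i = l then 1 else 0)) \<Longrightarrow>
        koszul_symb u b \<in> koszul_boundaries H p 2"
  shows "koszul_vanishes H p 2"
proof -
  let ?L = "{1..g + 1}" and ?B = "\<lambda>q. form_pairs (q * (g - 1))"
  have H_iff: "s \<in> H q \<longleftrightarrow> s \<in> ?B q \<and> (\<forall>l\<in>?L. gluing_defect g x h q l s = 0)" for s q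
    unfolding H_def by (rule twisted_canonical_sections_iff)
  have B_mult: "v * w \<in> ?B (Suc q)" if "v \<in> H 1" "w \<in> ?B q" for v w q
    using form_pairs_mult[of v "g - 1" w "q * (g - 1)"] that H_iff[of v 1] by simp
  have H_mult: "v * w \<in> H 2" if "v \<in> H 1" "w \<in> H 1" for v w
    using that twisted_canonical_sections_mult unfolding H_def by blast
  have H_sub: "cfun.subspace (H q)" for q unfolding H_def by (rule subspace_twisted_canonical_sections)
  obtain b where b: "\<And>l. l \<in> ?L \<Longrightarrow> b l \<in> ?B 1"
      "\<And>l i. l \<in> ?L \<Longrightarrow> i \<in> ?L \<Longrightarrow> gluing_defect g x h 1 i (b l) = (if i = l then 1 else 0)"
    using defect_dual[OF x m] by (simp only: mult_1) metis
  obtain e' where e': "\<And>l. l \<in> ?L \<Longrightarrow> e' l \<in> H 1" "\<And>l. l \<in> ?L \<Longrightarrow> node_value g x 1 Br1 l (e' l) \<noteq> 0"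
    using e by metis
  define e'' where "e'' l = cscale (1 / node_value g x 1 Br1 l (e' l)) (e' l)" for l
  have e'': "e'' l \<in> H 1" "node_value g x 1 Br1 l (e'' l) = 1" if "l \<in> ?L" for l
    using e'[OF that] by (simp_all add: e''_def cfun.subspace_scale[OF H_sub] node_value_cscale)
  have fin: "finite A" using A(1) finite_subset by blast
  have indA: "independent_points A (\<lambda>r. x r j)" for j
    using x A(1) independent_points_subset unfolding independent_nodes_def by blast
  have f2_form: "binary_form (card A) (\<lambda>z. f2 (j, z))" for j
    using f2(1) A(2) by (simp add: H_iff form_pairs_def)
  have exact: "\<exists>y\<in>koszul_chains (Suc p) (H 1) (?B 1). s - koszul_map y \<in> koszul_relations p (H 1) (?B 2)"
    if "s \<in> koszul_chains p (H 1) (?B 2)" "koszul_map s \<in> koszul_relations (p - 1) (H 1) (?B 3)" for s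
  proof (rule koszul_exact_of_pencil[OF H_sub f1(1) f2(1) subspace_form_pairs subspace_form_pairs subspace_form_pairs
        _ _ _ _ _ that])
    show "v * w \<in> ?B 2" if "v \<in> H 1" "w \<in> ?B 1" for v w using B_mult[OF that] by (simp add: numeral_2_eq_2)
    show "v * w \<in> ?B 3" if "v \<in> H 1" "w \<in> ?B 2" for v w using B_mult[OF that] by (simp add: numeral_3_eq_3)
    show "\<exists>a\<in>?B 1. \<exists>b\<in>?B 1. w = f1 * a + f2 * b" if w: "w \<in> ?B 2" for w
    proof -
      have "\<exists>a b. binary_form (card A) a \<and> binary_form (card A) b \<and>
          (\<forall>z. w (j, z) = c j * (\<Prod>r\<in>A. vanishing_form (x r j) z) * a z + f2 (j, z) * b z)" for j
        by (rule pencil_generates[OF fin indA f1(2) f2_form])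
           (use f2(2) w A(2) in \<open>auto simp: form_pairs_def mult_2\<close>)
      then obtain a b where ab: "\<And>j. binary_form (card A) (a j)" "\<And>j. binary_form (card A) (b j)"
          "\<And>j z. w (j, z) = c j * (\<Prod>r\<in>A. vanishing_form (x r j) z) * a j z + f2 (j, z) * b j z" by metis
      show ?thesis
        by (intro bexI[of _ "\<lambda>(j, z). a j z"] bexI[of _ "\<lambda>(j, z). b j z"])
           (use ab A(2) in \<open>auto simp: form_pairs_def fun_eq_iff fun_apply f1(3)\<close>)
    qed
    show "\<exists>e\<in>?B 1. u = f2 * e" if uv: "u \<in> ?B 2" "v \<in> ?B 2" and eq: "f1 * u + f2 * v = 0" for u v
    proof -
      have "\<exists>e. binary_form (card A) e \<and> (\<forall>z. u (j, z) = f2 (j, z) * e z)" for j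
      proof (rule pencil_syzygy[OF fin indA f1(2) f2_form, where v = "\<lambda>z. v (j, z)"])
        show "c j * (\<Prod>r\<in>A. vanishing_form (x r j) z) * u (j, z) + f2 (j, z) * v (j, z) = 0" for z
          using fun_cong[OF eq, of "(j, z)"] by (simp add: fun_apply f1(3))
      qed (use f2(2) uv A(2) in \<open>auto simp: form_pairs_def mult_2\<close>)
      then obtain e where ee: "\<And>j. binary_form (card A) (e j)" "\<And>j z. u (j, z) = f2 (j, z) * e j z" by metis
      show ?thesis
        by (intro bexI[of _ "\<lambda>(j, z). e j z"])
           (use ee A(2) in \<open>auto simp: form_pairs_def fun_eq_iff fun_apply\<close>)
    qed
    show "w = 0" if w: "w \<in> ?B 1 \<union> ?B 2" and eq: "f2 * w = 0" for w
    proof -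
      obtain q where q: "\<And>j. binary_form q (\<lambda>z. w (j, z))" using w by (auto simp: form_pairs_def)
      obtain r where r: "r \<in> A" using f2(3) by blast
      have "w (j, z) = 0" for j z
        by (rule binary_form_mult_eq_0[OF f2_form q _ f2(2)[OF r]])
           (use fun_cong[OF eq, of "(j, z)" for z] in \<open>simp add: fun_apply\<close>)
      then show ?thesis by (auto simp: fun_eq_iff fun_apply)
    qed
  qed
  show ?thesis
  proof (rule koszul_vanishes_of_node_contributions[where L = ?L and ?B1.0 = "?B 1" and ?B2.0 = "?B 2" and ?B3.0 = "?B 3"
        and b = b and e = e'' and ev = "node_value g x 1 Br1" and K = "\<lambda>l. {v \<in> H 1. node_value g x 1 Br1 l v = 0}"
        and ?r1.0 = "gluing_defect g x h 1" and ?r2.0 = "gluing_defect g x h 2"])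
    show "w - (\<Sum>l\<in>?L. cscale (gluing_defect g x h 1 l w) (b l)) \<in> H 1" if w: "w \<in> ?B 1" for w
      unfolding H_iff
    proof
      show "w - (\<Sum>l\<in>?L. cscale (gluing_defect g x h 1 l w) (b l)) \<in> ?B 1"
        using w b(1) by (intro cfun.subspace_diff cfun.subspace_sum cfun.subspace_scale subspace_form_pairs)
      show "\<forall>i\<in>?L. gluing_defect g x h 1 i (w - (\<Sum>l\<in>?L. cscale (gluing_defect g x h 1 l w) (b l))) = 0"
        by (simp add: gluing_defect_diff gluing_defect_sum gluing_defect_cscale b(2) if_distrib sum.delta
            cong: if_cong del: One_nat_def)
    qed
    show "koszul_symb u (b l) \<in> koszul_boundaries H p 2"
      if l: "l \<in> ?L" and u: "length u = Suc p" "set u \<subseteq> {v \<in> H 1. node_value g x 1 Br1 l v = 0}" for l u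
      by (rule nodes[OF l u]) (use b[OF l] in simp_all)
    show "v - cscale (node_value g x 1 Br1 l v) (e'' l) \<in> {v \<in> H 1. node_value g x 1 Br1 l v = 0}"
      if "l \<in> ?L" "v \<in> H 1" for l v
      using that e'' by (simp add: node_value_diff node_value_cscale cfun.subspace_diff[OF H_sub] cfun.subspace_scale[OF H_sub])
    show "gluing_defect g x h 2 l (v * w) = node_value g x 1 Br1 l v * gluing_defect g x h 1 l w"
      if "l \<in> ?L" "v \<in> H 1" "w \<in> ?B 1" for l v w
      by (rule gluing_defect_mult) (use that H_iff in blast)
    show "v * w \<in> ?B 2" if "v \<in> H 1" "w \<in> ?B 1" for v w
      using B_mult[OF that] by (simp add: numeral_2_eq_2)
    show "finite ?L" by simp
    show "cfun.subspace (H 1)" "cfun.subspace (H 2)" by (rule H_sub)+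
    show "cfun.subspace (?B 1)" by (rule subspace_form_pairs)
    show "H 1 \<subseteq> ?B 1" "H 2 \<subseteq> ?B 2" "H 3 \<subseteq> ?B 3" using H_iff by blast+
    show "v * w \<in> H 2" if "v \<in> H 1" "w \<in> H 1" for v w using that by (rule H_mult)
    show "\<exists>y\<in>koszul_chains (Suc p) (H 1) (?B 1). s - koszul_map y \<in> koszul_relations p (H 1) (?B 2)"
      if "s \<in> koszul_chains p (H 1) (?B 2)" "koszul_map s \<in> koszul_relations (p - 1) (H 1) (?B 3)" for s
      using that by (rule exact)
    show "b l \<in> ?B 1" if "l \<in> ?L" for l using that by (rule b(1))
    show "gluing_defect g x h 2 l (cscale a w + cscale c w') = a * gluing_defect g x h 2 l w + c * gluing_defect g x h 2 l w'"
      for l w w' a c by (rule gluing_defect_linear)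
    show "gluing_defect g x h 2 l w = 0" if "l \<in> ?L" "w \<in> H 2" for l w using that H_iff by blast
    show "e'' l \<in> H 1" if "l \<in> ?L" for l using that by (rule e''(1))
    show "{v \<in> H 1. node_value g x 1 Br1 l v = 0} \<subseteq> H 1" for l by blast
  qed
qed

section \<open>Partial normalization at a node\<close>

text \<open>The numbering of the remaining nodes after \<open>P\<close> is removed.\<close>

definition skip :: "nat \<Rightarrow> nat \<Rightarrow> nat" where
  "skip P i = (if i < P then i else Suc i)"

lemma inj_skip: "inj (skip P)"
  by (auto simp: inj_def skip_def split: if_splits)

lemma skip_image:
  assumes "P \<in> {1..Suc n}"
  shows "skip P ` {1..n} = {1..Suc n} - {P}"
proof
  show "skip P ` {1..n} \<subseteq> {1..Suc n} - {P}" using assms by (auto simp: skip_def)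
  show "{1..Suc n} - {P} \<subseteq> skip P ` {1..n}"
  proof
    fix m assume m: "m \<in> {1..Suc n} - {P}"
    then have "m = skip P (if m < P then m else m - 1)" by (auto simp: skip_def)
    moreover have "(if m < P then m else m - 1) \<in> {1..n}" using m assms by auto
    ultimately show "m \<in> skip P ` {1..n}" by blast
  qed
qed

text \<open>The factor for \<open>P\<close> in the denominator cancels against the multiplication with the equation of \<open>P\<close>.\<close>

lemma node_residue_normalization:
  assumes x: "independent_points {1..g + 1} x" and g: "g \<ge> 1" and P: "P \<in> {1..g + 1}" and i: "i \<in> {1..g}"
    and F: "\<And>z. F z = vanishing_form (x P) z ^ q * F' z"
  shows "node_residue g x q F (skip P i) = node_residue (g - 1) (x \<circ> skip P) q F' i"
proof -
  let ?l = "skip P i"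
  have img: "skip P ` {1..g} = {1..g + 1} - {P}" using skip_image[of P g] P by simp
  then have l: "?l \<in> {1..g + 1} - {P}" using i by blast
  have nz: "vanishing_form (x P) (x ?l) \<noteq> 0" using x P l by (auto simp: independent_points_def)
  have "skip P ` ({1..g} - {i}) = {1..g + 1} - {?l} - {P}"
    using img by (simp add: image_set_diff[OF inj_skip]) auto
  then have "(\<Prod>r\<in>{1..g + 1} - {?l} - {P}. vanishing_form (x r) (x ?l))
      = (\<Prod>r\<in>{1..g} - {i}. vanishing_form (x (skip P r)) (x ?l))"
    by (metis (no_types, lifting) inj_skip inj_on_subset subset_UNIV prod.reindex_cong)
  moreover have "(\<Prod>r\<in>{1..g + 1} - {?l}. vanishing_form (x r) (x ?l))
      = vanishing_form (x P) (x ?l) * (\<Prod>r\<in>{1..g + 1} - {?l} - {P}. vanishing_form (x r) (x ?l))"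
    using P l by (intro prod.remove) auto
  moreover have "{1..g - 1 + 1} = {1..g}" using g by simp
  ultimately show ?thesis
    using nz by (simp add: node_residue_def F power_mult_distrib)
qed

text \<open>Multiplying with the \<open>q\<close>-th power of this section embeds the sections of the partial normalization
at \<open>P\<close> into the sections of the curve, with image in those that vanish to order \<open>q\<close> on both lines
over \<open>P\<close>.\<close>

definition node_equation :: "(nat \<Rightarrow> branch \<Rightarrow> complex \<times> complex) \<Rightarrow> nat \<Rightarrow> curve_section" where
  "node_equation x P = (\<lambda>(j, z). vanishing_form (x P j) z)"

lemma node_equation_form: "node_equation x P \<in> form_pairs 1"
  by (simp add: form_pairs_def node_equation_def binary_form_vanishing_form[unfolded One_nat_def])

lemma node_value_normalization:
  assumes x: "independent_nodes g x" and g: "g \<ge> 1" and P: "P \<in> {1..g + 1}" and i: "i \<in> {1..g}"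
    and s: "\<And>j z. s (j, z) = node_equation x P (j, z) ^ q * s' (j, z)"
  shows "node_value g x q j (skip P i) s = node_value (g - 1) (x \<circ> skip P) q j i s'"
  unfolding node_value_def
  using node_residue_normalization[where x = "\<lambda>r. x r j", OF _ g P i] x s
  by (simp add: independent_nodes_def node_equation_def comp_def)

lemma gluing_defect_normalization:
  assumes x: "independent_nodes g x" and g: "g \<ge> 1" and P: "P \<in> {1..g + 1}" and i: "i \<in> {1..g}"
    and s: "\<And>j z. s (j, z) = node_equation x P (j, z) ^ q * s' (j, z)"
  shows "gluing_defect g x h q (skip P i) s = gluing_defect (g - 1) (x \<circ> skip P) (h \<circ> skip P) q i s'"
  by (simp add: gluing_defect_def node_value_normalization[OF assms])

lemma gluing_defect_removed_node:
  assumes "q \<ge> 1" and s: "\<And>j z. s (j, z) = node_equation x P (j, z) ^ q * s' (j, z)"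
  shows "gluing_defect g x h q P s = 0"
  using assms by (simp add: gluing_defect_def node_value_def node_residue_def node_equation_def zero_power)

lemma nodes_split:
  assumes "P \<in> {1..g + 1}" "l \<in> {1..g + 1}"
  shows "l = P \<or> (\<exists>i\<in>{1..g}. l = skip P i)"
  using skip_image[of P g] assms by auto

lemma normalization_sections:
  assumes x: "independent_nodes g x" and g: "g \<ge> 1" and P: "P \<in> {1..g + 1}" and q: "q \<ge> 1"
    and s: "\<And>j z. s (j, z) = node_equation x P (j, z) ^ q * s' (j, z)"
    and s': "s' \<in> twisted_canonical_sections (g - 1) (x \<circ> skip P) (h \<circ> skip P) q" and form: "s \<in> form_pairs (q * (g - 1))"
  shows "s \<in> twisted_canonical_sections g x h q"
proof -
  have "gluing_defect g x h q l s = 0" if l: "l \<in> {1..g + 1}" for l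
    using nodes_split[OF P l]
  proof
    assume "l = P"
    then show ?thesis using gluing_defect_removed_node[OF q s] by simp
  next
    assume "\<exists>i\<in>{1..g}. l = skip P i"
    then obtain i where i: "i \<in> {1..g}" "l = skip P i" by blast
    moreover have "{1..g - 1 + 1} = {1..g}" using g by simp
    ultimately show ?thesis
      using s' gluing_defect_normalization[OF x g P i(1) s] by (simp add: twisted_canonical_sections_iff)
  qed
  with form show ?thesis by (simp add: twisted_canonical_sections_iff)
qed

text \<open>The gluing condition at \<open>P\<close> carries the zero from the first line to the second, as \<open>h P\<close> is not
zero; so the equation of \<open>P\<close> divides the section on both lines.\<close>

lemma section_vanishing_at_node:
  assumes x: "independent_nodes g x" and g: "g \<ge> 2" and P: "P \<in> {1..g + 1}" and h: "h P \<noteq> 0"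
    and s: "s \<in> twisted_canonical_sections g x h 1" "node_value g x 1 Br1 P s = 0"
  shows "\<exists>s'\<in>twisted_canonical_sections (g - 1) (x \<circ> skip P) (h \<circ> skip P) 1. s = node_equation x P * s'"
proof -
  have "gluing_defect g x h 1 P s = 0" using s(1) P unfolding twisted_canonical_sections_iff by blast
  then have "node_value g x 1 j P s = 0" for j
    using s(2) h by (cases j) (simp_all add: gluing_defect_def)
  then have z: "s (j, x P j) = 0" for j using node_value_eq_0_iff[OF x P] by blast
  have nz: "x P j \<noteq> (0, 0)" for j using x P by (auto simp: independent_nodes_def independent_points_def)
  have "binary_form (Suc (g - 2)) (\<lambda>z. s (j, z))" for j
    using s(1) g by (simp add: twisted_canonical_sections_iff form_pairs_def Suc_diff_Suc numeral_2_eq_2)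
  then have "\<exists>f. binary_form (g - 2) f \<and> (\<forall>z. s (j, z) = vanishing_form (x P j) z * f z)" for j
    using binary_form_divide[where f = "\<lambda>z. s (j, z)" and x = "x P j" and n = "g - 2"] nz z by metis
  then obtain f where f: "\<And>j. binary_form (g - 2) (f j)" "\<And>j z. s (j, z) = vanishing_form (x P j) z * f j z"
    by metis
  define s' :: curve_section where "s' = (\<lambda>(j, z). f j z)"
  have s': "s (j, z) = node_equation x P (j, z) ^ 1 * s' (j, z)" for j z
    by (simp add: s'_def node_equation_def f(2))
  have "gluing_defect (g - 1) (x \<circ> skip P) (h \<circ> skip P) 1 i s' = 0" if i: "i \<in> {1..g}" for i
  proof -
    have "skip P i \<in> {1..g + 1}" using i by (simp add: skip_def)
    then show ?thesis
      using gluing_defect_normalization[OF x _ P i s', of h] s(1) g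
      unfolding twisted_canonical_sections_iff by simp
  qed
  moreover have "{1..g - 1 + 1} = {1..g}" using g by simp
  moreover have "s' \<in> form_pairs (g - 1 - 1)" using f(1) by (simp add: form_pairs_def s'_def numeral_2_eq_2)
  ultimately have "s' \<in> twisted_canonical_sections (g - 1) (x \<circ> skip P) (h \<circ> skip P) 1"
    by (simp add: twisted_canonical_sections_iff)
  moreover have "s = node_equation x P * s'" using s' by (auto simp: fun_eq_iff fun_apply)
  ultimately show ?thesis by blast
qed

lemma independent_nodes_normalization:
  assumes "independent_nodes g x" "P \<in> {1..g + 1}" "g \<ge> 1"
  shows "independent_nodes (g - 1) (x \<circ> skip P)"
proof -
  have "skip P r \<in> {1..g + 1}" if "r \<in> {1..g}" for r using that by (simp add: skip_def)
  moreover have "skip P r \<noteq> skip P s" if "r \<noteq> s" for r s using inj_skip that by (auto dest: injD)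
  moreover have "{1..g - 1 + 1} = {1..g}" using assms(3) by simp
  ultimately show ?thesis
    using assms(1) unfolding independent_nodes_def independent_points_def by (simp del: One_nat_def)
qed

text \<open>Divide the factors of \<open>u\<close> by the equation of \<open>P\<close> and choose a coefficient \<open>b'\<close> on the partial
normalization with its only defect at \<open>l\<close>. The differential of the quotients with \<open>b'\<close> has
coefficients without defects, so it is a cycle there and hence a boundary; multiplying back gives
the claim for the coefficient \<open>c\<close>, which is \<open>b'\<close> times the equation of \<open>P\<close>, and \<open>c\<close> has the same
defects as \<open>b\<close>.\<close>

lemma node_contribution_from_normalization:
  fixes g x h P
  defines "H \<equiv> twisted_canonical_sections g x h"
    and "H' \<equiv> twisted_canonical_sections (g - 1) (x \<circ> skip P) (h \<circ> skip P)"
  assumes x: "independent_nodes g x" and g: "g \<ge> 2" and P: "P \<in> {1..g + 1}" and h: "h P \<noteq> 0"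
    and m: "m \<in> {1..g + 1} - {P}" "m' \<in> {1..g + 1} - {P}" "h m = 1" "h m' = -1"
    and van: "koszul_vanishes H' p 2"
    and l: "l \<in> {1..g + 1} - {P}" and u: "length u = Suc p"
      "set u \<subseteq> {v \<in> H 1. node_value g x 1 Br1 P v = 0 \<and> node_value g x 1 Br1 l v = 0}"
    and b: "b \<in> form_pairs (g - 1)" "\<And>i. i \<in> {1..g + 1} \<Longrightarrow> gluing_defect g x h 1 i b = (if i = l then 1 else 0)"
  shows "koszul_symb u b \<in> koszul_boundaries H p 2"
proof -
  let ?x = "x \<circ> skip P" and ?h = "h \<circ> skip P" and ?e = "node_equation x P"
  have g1: "g \<ge> 1" using g by simp
  have nodes': "{1..g - 1 + 1} = {1..g}" using g by simp
  have img: "skip P ` {1..g} = {1..g + 1} - {P}" using skip_image[of P g] P by simp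
  obtain n n' l' where n: "n \<in> {1..g}" "m = skip P n" and n': "n' \<in> {1..g}" "m' = skip P n'"
    and l': "l' \<in> {1..g}" "l = skip P l'"
    using m(1,2) l unfolding img[symmetric] by blast
  have "\<exists>b\<in>form_pairs (g - 1 - 1). \<forall>i\<in>{1..g - 1 + 1}.
      gluing_defect (g - 1) ?x ?h 1 i b = (if i = l' then 1 else 0)"
    by (rule defect_dual[OF independent_nodes_normalization[OF x P g1], where m = n and m' = n'])
       (use n n' l' m nodes' in auto)
  then obtain b' where b': "b' \<in> form_pairs (g - 1 - 1)"
    "\<And>i. i \<in> {1..g} \<Longrightarrow> gluing_defect (g - 1) ?x ?h 1 i b' = (if i = l' then 1 else 0)"
    unfolding nodes' by blast
  define c where "c = ?e * b'"
  have c: "c (j, z) = ?e (j, z) ^ 1 * b' (j, z)" for j z by (simp add: c_def fun_apply)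
  have g2: "1 + (g - 1 - 1) = g - 1" "2 * (g - 1) = 1 + 1 + 2 * (g - 1 - 1)" using g by auto
  have c_form: "c \<in> form_pairs (g - 1)"
    using form_pairs_mult[OF node_equation_form[of x P] b'(1)] unfolding c_def g2(1) .
  have c_defect: "gluing_defect g x h 1 i c = (if i = l then 1 else 0)" if i: "i \<in> {1..g + 1}" for i
    using nodes_split[OF P i]
  proof
    assume "i = P"
    then show ?thesis using gluing_defect_removed_node[of 1 c x P b', OF _ c] l by auto
  next
    assume "\<exists>r\<in>{1..g}. i = skip P r"
    then obtain r where r: "r \<in> {1..g}" "i = skip P r" by blast
    have "r = l' \<longleftrightarrow> i = l" using r l' inj_skip by (auto dest: injD)
    then show ?thesis using gluing_defect_normalization[OF x g1 P r(1) c, of h] b'(2)[OF r(1)] r by simp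
  qed
  have H1: "?e * v \<in> H 1" if v: "v \<in> H' 1" for v
    unfolding H_def
  proof (rule normalization_sections[OF x g1 P])
    show "v \<in> twisted_canonical_sections (g - 1) ?x ?h 1" using v by (simp only: H'_def)
    then have "v \<in> form_pairs (g - 1 - 1)" by (simp add: twisted_canonical_sections_iff)
    from form_pairs_mult[OF node_equation_form[of x P] this]
    show "?e * v \<in> form_pairs (1 * (g - 1))" unfolding g2(1) by simp
  qed (simp_all add: fun_apply)
  have H2: "?e * ?e * w \<in> H 2" if w: "w \<in> H' 2" for w
    unfolding H_def
  proof (rule normalization_sections[OF x g1 P])
    show "w \<in> twisted_canonical_sections (g - 1) ?x ?h 2" using w by (simp only: H'_def)
    then have "w \<in> form_pairs (2 * (g - 1 - 1))" by (simp add: twisted_canonical_sections_iff)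
    from form_pairs_mult[OF form_pairs_mult[OF node_equation_form[of x P] node_equation_form[of x P]] this]
    show "?e * ?e * w \<in> form_pairs (2 * (g - 1))" unfolding g2(2) .
  qed (simp_all add: fun_apply power2_eq_square)
  have "\<exists>v'\<in>H' 1. v = ?e * v'" if "v \<in> set u" for v
    unfolding H'_def by (rule section_vanishing_at_node[where h = h, OF x g P h]) (use that u(2) H_def in auto)
  then obtain d where d: "\<And>v. v \<in> set u \<Longrightarrow> d v \<in> H' 1" "\<And>v. v \<in> set u \<Longrightarrow> v = ?e * d v" by metis
  define u' where "u' = map d u"
  have u': "length u' = Suc p" "set u' \<subseteq> H' 1" "map ((*) ?e) u' = u"
    using u(1) d by (auto simp: u'_def o_def intro!: map_idI)
  have "v' * b' \<in> H' 2" if v': "v' \<in> set u'" for v'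
  proof -
    obtain v where v: "v \<in> set u" "v' = d v" using v' by (auto simp: u'_def)
    have "v (j, z) = ?e (j, z) ^ 1 * v' (j, z)" for j z
      using fun_cong[OF d(2)[OF v(1)], of "(j, z)"] v(2) by (simp add: fun_apply)
    from node_value_normalization[OF x g1 P l'(1) this]
    have "node_value (g - 1) ?x 1 Br1 l' v' = 0" using u(2) v(1) l' by auto
    then show ?thesis unfolding H'_def
      by (intro section_times_dual[where l = l'])
         (use d(1)[OF v(1)] v b' nodes' H'_def in auto)
  qed
  then have "koszul_symb u' b' \<in> koszul_boundaries H' p 2"
    by (rule koszul_vanishes_product[OF van u'(1,2)])
  then have "chain_map ((*) ?e) ((*) (?e * ?e)) (koszul_symb u' b') \<in> koszul_boundaries H p 2"
    by (rule koszul_boundaries_transport[OF _ H1 H2])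
  also have "chain_map ((*) ?e) ((*) (?e * ?e)) (koszul_symb u' b') = koszul_symb u c"
    using koszul_map_chain_map[of "symb u' b'" "(*) (?e * ?e)" "(*) ?e" "(*) ?e"] u'(3)
    by (simp add: symb_in_all mult_ac c_def)
  finally have "koszul_symb u c \<in> koszul_boundaries H p 2" .
  then show ?thesis unfolding H_def
  proof (rule dual_coefficient_irrelevant[rotated -1])
    show "l \<in> {1..g + 1}" using l by blast
    show "length u = Suc p" by (rule u(1))
    show "set u \<subseteq> {v \<in> twisted_canonical_sections g x h 1. node_value g x 1 Br1 l v = 0}"
      using u(2) unfolding H_def by blast
    show "b \<in> form_pairs (g - 1)" "c \<in> form_pairs (g - 1)" by (rule b(1), rule c_form)
    show "gluing_defect g x h 1 i b = (if i = l then 1 else 0)" if "i \<in> {1..g + 1}" for i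
      using that by (rule b(2))
    show "gluing_defect g x h 1 i c = (if i = l then 1 else 0)" if "i \<in> {1..g + 1}" for i
      using that by (rule c_defect)
  qed
qed

section \<open>Sections of the Prym-canonical bundle\<close>

text \<open>The parameters on each line, together with the two fixed points \<open>0\<close> and \<open>\<infinity>\<close>, are different nodes.\<close>

definition nondegenerate :: "nat \<Rightarrow> params \<Rightarrow> bool" where
  "nondegenerate g a \<longleftrightarrow>
     (\<forall>j. inj_on (\<lambda>i. a (i, j)) {1..g - 1} \<and> (\<forall>i\<in>{1..g - 1}. a (i, j) \<noteq> 0))"

lemma independent_prym_nodes:
  assumes "nondegenerate g a" "g \<ge> 1"
  shows "independent_nodes g (prym_node g a)"
  unfolding independent_nodes_def independent_points_def
proof (intro allI conjI ballI impI)
  fix j r s assume "r \<in> {1..g + 1}" "s \<in> {1..g + 1}" "r \<noteq> s"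
  moreover have "a (r, j) \<noteq> a (s, j)" if "r \<le> g - 1" "s \<le> g - 1" "1 \<le> r" "1 \<le> s" "r \<noteq> s"
    using assms(1) that by (auto simp: nondegenerate_def inj_on_def)
  moreover have "a (r, j) \<noteq> 0" if "r \<le> g - 1" "1 \<le> r" for r
    using assms(1) that by (auto simp: nondegenerate_def)
  ultimately show "vanishing_form (prym_node g a r j) (prym_node g a s j) \<noteq> 0"
    using assms(2) by (auto simp: prym_node_def vanishing_form_apply)
qed (auto simp: prym_node_def)

lemma param_prod_nonzero: "nondegenerate g a \<Longrightarrow> param_prod g a j \<noteq> 0"
  by (simp add: param_prod_def nondegenerate_def)

lemma branch_const_nonzero: "nondegenerate g a \<Longrightarrow> d \<noteq> 0 \<Longrightarrow> branch_const g d a j \<noteq> 0"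
  by (cases j) (simp_all add: param_prod_nonzero)

text \<open>The second node where the \<open>i\<close>-th coordinate has a nonzero residue.\<close>

definition pole_node :: "nat \<Rightarrow> nat \<Rightarrow> nat" where
  "pole_node g i = (if i \<le> g div 2 then g + 1 else g)"

definition branch_sign :: "branch \<Rightarrow> complex" where
  "branch_sign j = (case j of Br1 \<Rightarrow> 1 | Br2 \<Rightarrow> -1)"

text \<open>The constant between the \<open>i\<close>-th coordinate and the form with residues \<open>1\<close> and \<open>-1\<close>.\<close>

definition pair_coeff :: "nat \<Rightarrow> complex \<Rightarrow> params \<Rightarrow> branch \<Rightarrow> nat \<Rightarrow> complex" where
  "pair_coeff g d a j i = (if i \<le> g div 2 then -1 else branch_const g d a j / param_prod g a j)"

text \<open>The two restrictions of a coordinate glue to a section only after the sign is changed on one line.\<close>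

definition coordinate_section :: "nat \<Rightarrow> complex \<Rightarrow> params \<Rightarrow> nat \<Rightarrow> curve_section" where
  "coordinate_section g d a i = (\<lambda>(j, z). branch_sign j * prym_map g d a j z i)"

lemma pair_coeff_nonzero: "nondegenerate g a \<Longrightarrow> d \<noteq> 0 \<Longrightarrow> pair_coeff g d a j i \<noteq> 0"
  by (simp add: pair_coeff_def branch_const_nonzero param_prod_nonzero)

lemma branch_sign_nonzero: "branch_sign j \<noteq> 0"
  by (cases j) (simp_all add: branch_sign_def)

text \<open>Both sides are products of the linear forms of all nodes except \<open>i\<close> and \<open>pole_node g i\<close>: the
factors \<open>t\<close> and \<open>- u\<close> are the linear forms of the nodes \<open>g\<close> and \<open>g + 1\<close>.\<close>

lemma prym_map_residue_pair:
  assumes i: "i \<in> {1..g - 1}"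
  shows "prym_map g d a j z i = pair_coeff g d a j i * residue_pair g (prym_node g a) j i (pole_node g i) z"
proof -
  obtain t u where z: "z = (t, u)" by (cases z)
  let ?N = "\<Prod>r\<in>{1..g - 1} - {i}. t - a (r, j) * u"
  have N: "(\<Prod>r\<in>{1..g - 1} - {i}. vanishing_form (prym_node g a r j) z) = ?N"
    by (rule prod.cong) (auto simp: prym_node_def vanishing_form_apply z)
  show ?thesis
  proof (cases "i \<le> g div 2")
    case True
    have set: "{1..g + 1} - {i, g + 1} = insert g ({1..g - 1} - {i})" using i by auto
    have "(\<Prod>r\<in>{1..g + 1} - {i, g + 1}. vanishing_form (prym_node g a r j) z) = t * ?N"
      unfolding set using i N by (subst prod.insert) (auto simp: prym_node_def vanishing_form_apply z)
    moreover have "vanishing_form (prym_node g a (g + 1) j) (prym_node g a i j) = -1"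
      using i by (auto simp add: prym_node_def vanishing_form_apply)
    ultimately show ?thesis using True i
      by (simp add: z residue_pair_def pole_node_def pair_coeff_def prym_map_def Let_def)
  next
    case False
    have set: "{1..g + 1} - {i, g} = insert (g + 1) ({1..g - 1} - {i})" using i by auto
    have "(\<Prod>r\<in>{1..g + 1} - {i, g}. vanishing_form (prym_node g a r j) z) = - u * ?N"
      unfolding set using i N by (subst prod.insert) (auto simp: prym_node_def vanishing_form_apply z)
    moreover have "vanishing_form (prym_node g a g j) (prym_node g a i j) = a (i, j)"
      using i by (auto simp add: prym_node_def vanishing_form_apply)
    ultimately show ?thesis using False i
      by (simp add: z residue_pair_def pole_node_def pair_coeff_def prym_map_def Let_def)
  qed
qed

lemma pole_node_in: "i \<in> {1..g - 1} \<Longrightarrow> pole_node g i \<in> {1..g + 1}"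
  by (auto simp: pole_node_def)

lemma coordinate_section_form:
  assumes "i \<in> {1..g - 1}"
  shows "coordinate_section g d a i \<in> form_pairs (g - 1)"
proof -
  have i: "i \<in> {1..g + 1}" using assms by auto
  have "binary_form (g - 1) (\<lambda>z. branch_sign j * (pair_coeff g d a j i *
      residue_pair g (prym_node g a) j i (pole_node g i) z))" for j
    by (intro binary_form_scale binary_form_residue_pair i pole_node_in assms)
  then show ?thesis
    by (simp add: form_pairs_def coordinate_section_def prym_map_residue_pair[OF assms])
qed

lemma node_value_coordinate_section:
  assumes a: "nondegenerate g a" and i: "i \<in> {1..g - 1}" and l: "l \<in> {1..g + 1}"
  shows "node_value g (prym_node g a) 1 j l (coordinate_section g d a i)
    = branch_sign j * pair_coeff g d a j i * ((if l = i then 1 else 0) - (if l = pole_node g i then 1 else 0))"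
proof -
  have i': "i \<in> {1..g + 1}" and g: "g \<ge> 1" using i by auto
  have "node_value g (prym_node g a) 1 j l (coordinate_section g d a i) =
      branch_sign j * pair_coeff g d a j i *
      node_residue g (\<lambda>r. prym_node g a r j) 1 (residue_pair g (prym_node g a) j i (pole_node g i)) l"
    by (simp add: node_value_def node_residue_def coordinate_section_def prym_map_residue_pair[OF i] del: One_nat_def)
  then show ?thesis
    using node_residue_residue_pair[OF independent_prym_nodes[OF a g] i' pole_node_in[OF i] l] by simp
qed

text \<open>The relation \<open>d\<^sub>1 / A\<^sub>1 = - d\<^sub>2 / A\<^sub>2\<close> between the constants of the two lines is what makes the
coordinates with \<open>i > g div 2\<close> glue with \<open>h = -1\<close>.\<close>

lemma coordinate_section_in:
  assumes a: "nondegenerate g a" and i: "i \<in> {1..g - 1}"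
  shows "coordinate_section g d a i \<in> prym_sections g a 1"
  unfolding prym_sections_def twisted_canonical_sections_iff
proof
  show "coordinate_section g d a i \<in> form_pairs (1 * (g - 1))"
    using coordinate_section_form[OF i] by simp
  show "\<forall>l\<in>{1..g + 1}. gluing_defect g (prym_node g a) (prym_h g) 1 l (coordinate_section g d a i) = 0"
  proof
    fix l assume l: "l \<in> {1..g + 1}"
    have "param_prod g a Br1 \<noteq> 0" "param_prod g a Br2 \<noteq> 0" by (rule param_prod_nonzero[OF a])+
    then show "gluing_defect g (prym_node g a) (prym_h g) 1 l (coordinate_section g d a i) = 0"
      using i l unfolding gluing_defect_def node_value_coordinate_section[OF a i l]
      by (auto simp: pair_coeff_def branch_sign_def pole_node_def prym_h_def)
  qed
qed

lemma prym_h_values: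
  assumes "g \<ge> 2"
  shows "prym_h g (g + 1) = 1" "prym_h g g = -1" "prym_h g l \<noteq> 0"
proof -
  have "\<not> g \<le> g div 2" "\<not> g + 1 \<le> g div 2" using assms by linarith+
  then show "prym_h g (g + 1) = 1" "prym_h g g = -1" by (simp_all add: prym_h_def)
qed (simp add: prym_h_def)

text \<open>On each line only a multiple of the product of the first \<open>g - 1\<close> linear forms is left. The nodes
\<open>g\<close> and \<open>g + 1\<close> have opposite signs and give two independent equations for the two multiples.\<close>

lemma section_eq_zero:
  assumes a: "nondegenerate g a" and g: "g \<ge> 2" and s: "s \<in> prym_sections g a 1"
    and z: "\<And>l. l \<in> {1..g - 1} \<Longrightarrow> node_value g (prym_node g a) 1 Br1 l s = 0"
  shows "s = 0"
proof -
  let ?x = "prym_node g a"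
  have x: "independent_nodes g ?x" by (rule independent_prym_nodes[OF a]) (use g in simp)
  have form: "\<And>j. binary_form (g - 1) (\<lambda>z. s (j, z))"
    and defect: "\<And>l. l \<in> {1..g + 1} \<Longrightarrow> gluing_defect g ?x (prym_h g) 1 l s = 0"
    using s by (simp_all add: prym_sections_def twisted_canonical_sections_iff form_pairs_def)
  have h: "prym_h g l \<noteq> 0" for l by (simp add: prym_h_def)
  have s0: "s (j, ?x l j) = 0" if l: "l \<in> {1..g - 1}" for j l
  proof -
    have l': "l \<in> {1..g + 1}" using l by auto
    have "node_value g ?x 1 j l s = 0"
      using z[OF l] defect[OF l'] h[of l] by (cases j) (simp_all add: gluing_defect_def)
    then show ?thesis using node_value_eq_0_iff[OF x l'] by blast
  qed
  have ind: "independent_points {1..g - 1} (\<lambda>r. ?x r j)" for j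
    by (rule independent_points_subset[of "{1..g + 1}"]) (use x in \<open>auto simp: independent_nodes_def\<close>)
  have "\<exists>c. \<forall>z. s (j, z) = (\<Prod>r\<in>{1..g - 1}. vanishing_form (?x r j) z) * c" for j
  proof -
    obtain f where f: "binary_form 0 f" "\<And>z. s (j, z) = (\<Prod>r\<in>{1..g - 1}. vanishing_form (?x r j) z) * f z"
      using binary_form_divide_prod[OF _ ind[of j], of 0 "\<lambda>z. s (j, z)"] form[of j] s0 by auto
    have "f z = f (0, 0)" for z using f(1) by (cases z) (auto simp: binary_form_def)
    then show ?thesis using f(2) by metis
  qed
  then obtain c where c: "\<And>j z. s (j, z) = (\<Prod>r\<in>{1..g - 1}. vanishing_form (?x r j) z) * c j" by metis
  have nz: "(\<Prod>r\<in>{1..g - 1}. vanishing_form (?x r j) (?x l j)) \<noteq> 0" if "l \<in> {g, g + 1}" for j l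
    using x that unfolding independent_nodes_def independent_points_def by auto
  have set: "{1..g + 1} - {g} = insert (g + 1) {1..g - 1}" "{1..g + 1} - {g + 1} = insert g {1..g - 1}"
    using g by auto
  have "(\<Prod>r\<in>{1..g + 1} - {g}. vanishing_form (?x r j) (?x g j)) = - (\<Prod>r\<in>{1..g - 1}. vanishing_form (?x r j) (?x g j))" for j
    unfolding set using g by (subst prod.insert) (auto simp: prym_node_def vanishing_form_apply)
  then have vg: "node_value g ?x 1 j g s = - c j" for j
    using nz[of g j] by (simp add: node_value_def node_residue_def c del: One_nat_def)
  have "(\<Prod>r\<in>{1..g + 1} - {g + 1}. vanishing_form (?x r j) (?x (g + 1) j)) = (\<Prod>r\<in>{1..g - 1}. vanishing_form (?x r j) (?x (g + 1) j))" for j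
    unfolding set using g by (subst prod.insert) (auto simp: prym_node_def vanishing_form_apply)
  then have vg1: "node_value g ?x 1 j (g + 1) s = c j" for j
    using nz[of "g + 1" j] by (simp add: node_value_def node_residue_def c del: One_nat_def)
  have "- c Br1 + c Br2 = 0" "c Br1 + c Br2 = 0"
    using defect[of g] defect[of "g + 1"] g unfolding gluing_defect_def vg vg1 prym_h_values(1,2)[OF g]
    by auto
  then have "c Br1 = 0" "c Br2 = 0" by (auto simp: add_eq_0_iff2)
  then have "c j = 0" for j by (cases j) auto
  then show "s = 0" by (auto simp: fun_eq_iff fun_apply c)
qed

lemma node_value_sum:
  "finite I \<Longrightarrow> node_value g x q j l (\<Sum>i\<in>I. cscale (c i) (s i)) = (\<Sum>i\<in>I. c i * node_value g x q j l (s i))"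
proof (induction I rule: finite_induct)
  case empty
  then show ?case by (simp add: node_value_def node_residue_def fun_apply)
next
  case (insert i I)
  then show ?case using node_value_linear[of g x q j l "c i" "s i" 1 "\<Sum>i\<in>I. cscale (c i) (s i)"] by simp
qed

lemma section_expansion:
  assumes a: "nondegenerate g a" and g: "g \<ge> 2" and d: "d \<noteq> 0" and s: "s \<in> prym_sections g a 1"
  shows "s = (\<Sum>i\<in>{1..g - 1}. cscale (node_value g (prym_node g a) 1 Br1 i s / pair_coeff g d a Br1 i)
    (coordinate_section g d a i))"
proof -
  let ?c = "\<lambda>i. node_value g (prym_node g a) 1 Br1 i s / pair_coeff g d a Br1 i"
  let ?t = "\<Sum>i\<in>{1..g - 1}. cscale (?c i) (coordinate_section g d a i)"
  note sub = subspace_twisted_canonical_sections[of g "prym_node g a" "prym_h g" 1, folded prym_sections_def]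
  have "s - ?t = 0"
  proof (rule section_eq_zero[OF a g])
    show "s - ?t \<in> prym_sections g a 1"
      using s coordinate_section_in[OF a]
      by (intro cfun.subspace_diff cfun.subspace_sum cfun.subspace_scale sub) blast+
    fix l assume l: "l \<in> {1..g - 1}"
    then have l': "l \<in> {1..g + 1}" by auto
    have "node_value g (prym_node g a) 1 Br1 l ?t
        = (\<Sum>i\<in>{1..g - 1}. ?c i * node_value g (prym_node g a) 1 Br1 l (coordinate_section g d a i))"
      by (rule node_value_sum) simp
    also have "\<dots> = (\<Sum>i\<in>{1..g - 1}. if i = l then ?c i * pair_coeff g d a Br1 i else 0)"
      using l by (intro sum.cong refl) (auto simp: node_value_coordinate_section[OF a _ l'] branch_sign_def pole_node_def simp del: One_nat_def)
    also have "\<dots> = node_value g (prym_node g a) 1 Br1 l s"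
      using l pair_coeff_nonzero[OF a d] by (simp add: sum.delta)
    finally show "node_value g (prym_node g a) 1 Br1 l (s - ?t) = 0" by (simp add: node_value_diff)
  qed
  then show ?thesis by simp
qed

section \<open>Complete linear system and property N\<close>

lemma given_by_complete_system_prym:
  assumes a: "nondegenerate g a" and g: "g \<ge> 2" and d: "d \<noteq> 0"
  shows "given_by_complete_system g d a"
proof -
  let ?s = "coordinate_section g d a" and ?I = "{1..g - 1}"
  have val: "node_value g (prym_node g a) 1 Br1 l (\<Sum>i\<in>?I. cscale (c i) (?s i)) = c l * pair_coeff g d a Br1 l"
    if l: "l \<in> ?I" for c l
  proof -
    have l': "l \<in> {1..g + 1}" using l by auto
    have "node_value g (prym_node g a) 1 Br1 l (\<Sum>i\<in>?I. cscale (c i) (?s i))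
        = (\<Sum>i\<in>?I. c i * node_value g (prym_node g a) 1 Br1 l (?s i))"
      by (rule node_value_sum) simp
    also have "\<dots> = (\<Sum>i\<in>?I. if i = l then c i * pair_coeff g d a Br1 i else 0)"
      using l by (intro sum.cong refl)
        (auto simp: node_value_coordinate_section[OF a _ l'] branch_sign_def pole_node_def simp del: One_nat_def)
    finally show ?thesis using l by (simp add: sum.delta)
  qed
  have inj: "inj_on ?s ?I"
  proof (rule inj_onI)
    fix i i' assume i: "i \<in> ?I" "i' \<in> ?I" "?s i = ?s i'"
    have i'': "i \<in> {1..g + 1}" using i by auto
    show "i = i'"
    proof (rule ccontr)
      assume "i \<noteq> i'"
      moreover have "i \<noteq> pole_node g i" "i \<noteq> pole_node g i'" using i g by (auto simp: pole_node_def)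
      ultimately show False
        using i node_value_coordinate_section[OF a i(1) i'', of Br1 d] node_value_coordinate_section[OF a i(2) i'', of Br1 d]
          pair_coeff_nonzero[OF a d, of Br1 i] by (simp add: branch_sign_def)
    qed
  qed
  have "cfun.independent (?s ` ?I)"
    unfolding cfun.dependent_finite[OF finite_imageI[OF finite_atLeastAtMost]]
  proof
    assume "\<exists>u. (\<exists>v\<in>?s ` ?I. u v \<noteq> 0) \<and> (\<Sum>v\<in>?s ` ?I. cscale (u v) v) = 0"
    then obtain u i where u: "i \<in> ?I" "u (?s i) \<noteq> 0" "(\<Sum>v\<in>?s ` ?I. cscale (u v) v) = 0" by blast
    have "(\<Sum>i\<in>?I. cscale (u (?s i)) (?s i)) = 0" using u(3) unfolding sum.reindex[OF inj] by (simp add: o_def)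
    with val[OF u(1), of "\<lambda>i. u (?s i)"] have "u (?s i) * pair_coeff g d a Br1 i = 0"
      by (simp add: node_value_def node_residue_def fun_apply)
    then show False using u(2) pair_coeff_nonzero[OF a d] by simp
  qed
  moreover have "cfun.span (?s ` ?I) = prym_sections g a 1"
  proof
    show "cfun.span (?s ` ?I) \<subseteq> prym_sections g a 1"
      unfolding prym_sections_def
      by (rule cfun.span_minimal[OF _ subspace_twisted_canonical_sections])
         (use coordinate_section_in[OF a, unfolded prym_sections_def] in blast)
    show "prym_sections g a 1 \<subseteq> cfun.span (?s ` ?I)"
    proof
      fix s assume s: "s \<in> prym_sections g a 1"
      show "s \<in> cfun.span (?s ` ?I)"
        by (subst section_expansion[OF a g d s])
           (intro cfun.span_sum cfun.span_scale cfun.span_base imageI)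
    qed
  qed
  moreover have "\<forall>j. branch_sign j \<noteq> 0 \<and> (\<forall>i\<in>?I. \<forall>z. ?s i (j, z) = branch_sign j * prym_map g d a j z i)"
    by (simp add: branch_sign_nonzero coordinate_section_def)
  ultimately show ?thesis unfolding given_by_complete_system_def using inj by blast
qed

text \<open>No node is a base point. For \<open>l \<le> g - 1\<close> the coordinate that is nonzero at \<open>l\<close> is unique, so the
choice is forced.\<close>

lemma pivot_section:
  assumes a: "nondegenerate g a" and g: "g \<ge> 3" and d: "d \<noteq> 0" and l: "l \<in> {1..g + 1}"
  shows "\<exists>i\<in>{1..g - 1}. (l \<le> g - 1 \<longrightarrow> i = l) \<and>
    node_value g (prym_node g a) 1 Br1 l (coordinate_section g d a i) \<noteq> 0"
proof -
  define i where "i = (if l \<le> g - 1 then l else if l = g then g - 1 else 1)"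
  have i: "i \<in> {1..g - 1}" using l g by (auto simp: i_def)
  have "(if l = i then 1 else 0) - (if l = pole_node g i then 1 else 0) \<noteq> (0 :: complex)"
  proof -
    have "\<not> g - 1 \<le> g div 2" "1 \<le> g div 2" using g by linarith+
    then show ?thesis using l g by (auto simp: i_def pole_node_def)
  qed
  then have "node_value g (prym_node g a) 1 Br1 l (coordinate_section g d a i) \<noteq> 0"
    unfolding node_value_coordinate_section[OF a i l]
    using branch_sign_nonzero pair_coeff_nonzero[OF a d] by simp
  then show ?thesis using i by (intro bexI[of _ i]) (auto simp: i_def)
qed

text \<open>At each node \<open>l\<close> the sections that vanish at \<open>l\<close> are spanned by the \<open>t i\<close>, and a wedge of \<open>p + 1\<close>
of them involves at most \<open>p + 2\<close> coordinates. Since \<open>A\<close> has more elements, all factors vanish at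
some further node of \<open>A\<close>.\<close>

lemma property_N_of_normalizations:
  assumes a: "nondegenerate g a" and g: "g \<ge> 4" and A: "A \<subseteq> {1..g - 1}" "card A \<ge> p + 3"
    and van: "\<And>P. P \<in> A \<Longrightarrow>
        koszul_vanishes (twisted_canonical_sections (g - 1) (prym_node g a \<circ> skip P) (prym_h g \<circ> skip P)) p 2"
  shows "property_N p g a"
proof -
  let ?x = "prym_node g a" and ?h = "prym_h g" and ?s = "coordinate_section g 1 a"
  define H where "H = twisted_canonical_sections g ?x ?h"
  have g2: "g \<ge> 2" and g3: "g \<ge> 3" and g1: "g \<ge> 1" using g by simp_all
  have x: "independent_nodes g ?x" by (rule independent_prym_nodes[OF a g1])
  have H_sub: "cfun.subspace (H q)" for q unfolding H_def by (rule subspace_twisted_canonical_sections)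
  have s_in: "?s i \<in> H 1" if "i \<in> {1..g - 1}" for i
    using coordinate_section_in[OF a that] by (simp add: H_def prym_sections_def)
  have nv: "node_value g ?x 1 j l (?s i) = branch_sign j * pair_coeff g 1 a j i *
      ((if l = i then 1 else 0) - (if l = pole_node g i then 1 else 0))"
    if "i \<in> {1..g - 1}" "l \<in> {1..g + 1}" for i l j
    by (rule node_value_coordinate_section[OF a that])
  have coeff: "branch_sign j * pair_coeff g 1 a j i \<noteq> 0" for i j
    using branch_sign_nonzero pair_coeff_nonzero[OF a] by simp
  have h: "?h (g + 1) = 1" "?h g = -1" "?h l \<noteq> 0" for l using prym_h_values[OF g2] by auto
  have half: "1 \<le> g div 2" "\<not> g - 1 \<le> g div 2" using g by linarith+
  \<comment> \<open>The first coordinate vanishes at the nodes \<open>2, \<dots>, g\<close>, and the sum of the other coordinates at none of them.\<close>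
  have "koszul_vanishes (twisted_canonical_sections g ?x ?h) p 2"
  proof (rule koszul_vanishes_twisted[OF x _ _ h(1,2), where A = "{2..g}" and ?f1.0 = "?s 1" and
        ?f2.0 = "\<Sum>i\<in>{2..g - 1}. cscale 1 (?s i)" and
        c = "\<lambda>j. branch_sign j * pair_coeff g 1 a j 1 * vanishing_form (?x (g + 1) j) (?x 1 j)"], unfold H_def[symmetric])
    show "g + 1 \<in> {1..g + 1}" "g \<in> {1..g + 1}" "{2..g} \<subseteq> {1..g + 1}" "card {2..g} = g - 1" "{2..g} \<noteq> {}"
      using g by auto
    show "?s 1 \<in> H 1" using s_in g by simp
    show "branch_sign j * pair_coeff g 1 a j 1 * vanishing_form (?x (g + 1) j) (?x 1 j) \<noteq> 0" for j
    proof -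
      have "\<not> g + 1 \<le> g - 1" "1 \<le> g - 1" "g + 1 \<noteq> g" using g by linarith+
      then have "vanishing_form (?x (g + 1) j) (?x 1 j) = - 1"
        by (simp add: prym_node_def vanishing_form_apply)
      then show ?thesis using coeff[of j 1] by simp
    qed
    show "?s 1 (j, z) = branch_sign j * pair_coeff g 1 a j 1 * vanishing_form (?x (g + 1) j) (?x 1 j) *
        (\<Prod>r\<in>{2..g}. vanishing_form (?x r j) z)" for j z
    proof -
      have "{1..g + 1} - {1, g + 1} = {2..g}" by auto
      then show ?thesis
        using g half prym_map_residue_pair[of 1 g 1 a j z]
        by (simp add: coordinate_section_def residue_pair_def pole_node_def)
    qed
    show "(\<Sum>i\<in>{2..g - 1}. cscale 1 (?s i)) \<in> H 1"
      by (intro cfun.subspace_sum cfun.subspace_scale H_sub s_in) auto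
    show "(\<Sum>i\<in>{2..g - 1}. cscale 1 (?s i)) (j, ?x r j) \<noteq> 0" if r: "r \<in> {2..g}" for j r
    proof -
      have r': "r \<in> {1..g + 1}" using r by auto
      have "node_value g ?x 1 j r (\<Sum>i\<in>{2..g - 1}. cscale 1 (?s i))
          = (\<Sum>i\<in>{2..g - 1}. 1 * node_value g ?x 1 j r (?s i))"
        by (rule node_value_sum) simp
      also have "\<dots> = (\<Sum>i\<in>{2..g - 1}. branch_sign j * pair_coeff g 1 a j i *
          ((if r = i then 1 else 0) - (if r = pole_node g i then 1 else 0)))"
        by (intro sum.cong refl) (use nv r' in auto)
      also have "\<dots> \<noteq> 0"
      proof (cases "r = g")
        case False
        then have r'': "r \<in> {2..g - 1}" using r by auto
        from False have "(\<Sum>i\<in>{2..g - 1}. branch_sign j * pair_coeff g 1 a j i *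
            ((if r = i then 1 else 0) - (if r = pole_node g i then 1 else 0)))
          = (\<Sum>i\<in>{2..g - 1}. if i = r then branch_sign j * pair_coeff g 1 a j i else 0)"
          using r by (intro sum.cong) (auto simp: pole_node_def)
        also have "\<dots> = branch_sign j * pair_coeff g 1 a j r" using r'' by (simp add: sum.delta)
        finally show ?thesis using coeff by simp
      next
        case True
        define K where "K = - branch_sign j * (branch_const g 1 a j / param_prod g a j)"
        have K: "K \<noteq> 0" using coeff[of j "g - 1"] half(2) by (simp add: K_def pair_coeff_def)
        have "(\<Sum>i\<in>{2..g - 1}. branch_sign j * pair_coeff g 1 a j i *
            ((if r = i then 1 else 0) - (if r = pole_node g i then 1 else 0)))
          = (\<Sum>i\<in>{2..g - 1}. if i \<in> {i. \<not> i \<le> g div 2} then K else 0)"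
          using True g by (intro sum.cong) (auto simp: pole_node_def pair_coeff_def K_def)
        also have "\<dots> = (\<Sum>i\<in>{2..g - 1} \<inter> {i. \<not> i \<le> g div 2}. K)"
          by (rule sum.inter_restrict[symmetric]) simp
        also have "\<dots> = of_nat (card ({2..g - 1} \<inter> {i. \<not> i \<le> g div 2})) * K" by simp
        finally have eq: "(\<Sum>i\<in>{2..g - 1}. branch_sign j * pair_coeff g 1 a j i *
            ((if r = i then 1 else 0) - (if r = pole_node g i then 1 else 0)))
          = of_nat (card ({2..g - 1} \<inter> {i. \<not> i \<le> g div 2})) * K" .
        have "g - 1 \<in> {2..g - 1} \<inter> {i. \<not> i \<le> g div 2}" using g half by auto
        then have "card ({2..g - 1} \<inter> {i. \<not> i \<le> g div 2}) \<noteq> 0" by (metis card_0_eq emptyE finite_Int finite_atLeastAtMost)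
        then show ?thesis unfolding eq using K by simp
      qed
      finally show ?thesis using node_value_eq_0_iff[OF x r'] by blast
    qed
    show "\<exists>e\<in>H 1. node_value g ?x 1 Br1 l e \<noteq> 0" if l: "l \<in> {1..g + 1}" for l
      using pivot_section[OF a g3 _ l, of 1] s_in by auto
  next
    fix l u b
    assume l: "l \<in> {1..g + 1}" and u: "length u = Suc p" "set u \<subseteq> {v \<in> H 1. node_value g ?x 1 Br1 l v = 0}"
      and b: "b \<in> form_pairs (g - 1)" "\<And>i. i \<in> {1..g + 1} \<Longrightarrow> gluing_defect g ?x ?h 1 i b = (if i = l then 1 else 0)"
    obtain i0 where i0: "i0 \<in> {1..g - 1}" "l \<le> g - 1 \<Longrightarrow> i0 = l" "node_value g ?x 1 Br1 l (?s i0) \<noteq> 0"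
      using pivot_section[OF a g3 _ l, of 1] by auto
    \<comment> \<open>The coordinate \<open>i0\<close> is used to make all others vanish at \<open>l\<close>.\<close>
    define c where "c i = node_value g ?x 1 Br1 l (?s i) / node_value g ?x 1 Br1 l (?s i0)" for i
    define t where "t i = ?s i - cscale (c i) (?s i0)" for i
    define S where "S = t ` ({1..g - 1} - {i0})"
    have t: "t i \<in> H 1" "node_value g ?x 1 Br1 l (t i) = 0" if "i \<in> {1..g - 1}" for i
      unfolding t_def using that i0 s_in
      by (auto simp: node_value_diff node_value_cscale c_def intro!: cfun.subspace_diff cfun.subspace_scale H_sub)
    have "cfun.subspace {v \<in> H 1. node_value g ?x 1 Br1 l v = 0}"
      using H_sub[of 1] node_value_linear[of g ?x 1 Br1 l 1 _ 1] node_value_cscale[of g ?x 1 Br1 l 0 0]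
      by (auto simp: cfun.subspace_def node_value_cscale)
    then have span: "cfun.span S \<subseteq> {v \<in> H 1. node_value g ?x 1 Br1 l v = 0}"
      by (rule cfun.span_minimal[rotated]) (use t in \<open>auto simp: S_def\<close>)
    have spans: "v \<in> cfun.span S" if v: "v \<in> H 1" "node_value g ?x 1 Br1 l v = 0" for v
    proof -
      define k where "k i = node_value g ?x 1 Br1 i v / pair_coeff g 1 a Br1 i" for i
      have v': "v = (\<Sum>i\<in>{1..g - 1}. cscale (k i) (?s i))"
        using section_expansion[OF a g2 _ v(1)[unfolded H_def, folded prym_sections_def], of 1] by (simp add: k_def)
      have "(\<Sum>i\<in>{1..g - 1}. k i * node_value g ?x 1 Br1 l (?s i)) = 0"
        using v(2) unfolding v' by (simp add: node_value_sum del: One_nat_def)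
      then have "(\<Sum>i\<in>{1..g - 1}. k i * c i) = 0"
        unfolding c_def by (simp add: sum_divide_distrib[symmetric] del: One_nat_def)
      moreover have "(\<Sum>i\<in>{1..g - 1}. cscale (k i) (t i)) = v - cscale (\<Sum>i\<in>{1..g - 1}. k i * c i) (?s i0)"
        unfolding v' t_def by (simp add: cfun.scale_right_diff_distrib sum_subtractf cfun.scale_sum_left)
      ultimately have v'': "v = (\<Sum>i\<in>{1..g - 1}. cscale (k i) (t i))" by simp
      have "t i0 = 0" using i0(3) by (simp add: t_def c_def)
      then have "t i \<in> cfun.span S" if "i \<in> {1..g - 1}" for i
        using that cfun.span_zero cfun.span_base[of "t i" S] by (cases "i = i0") (auto simp: S_def)
      then show ?thesis unfolding v'' by (intro cfun.span_sum cfun.span_scale) blast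
    qed
    show "koszul_symb u b \<in> koszul_boundaries H p 2"
    proof (rule koszul_symb_spanning_lists[OF _ _ _ u(1)])
      show "cfun.span S \<subseteq> H 1" using span by blast
      show "v * b \<in> H 2" if "v \<in> cfun.span S" for v
        unfolding H_def
        by (rule section_times_dual[OF _ _ b]) (use that span in \<open>auto simp: H_def\<close>)
      show "set u \<subseteq> cfun.span S" using u(2) spans by blast
    next
      fix w assume w: "length w = Suc p" "set w \<subseteq> S"
      obtain I where I: "I \<subseteq> {1..g - 1} - {i0}" "finite I" "card I \<le> Suc p" "set w = t ` I"
      proof -
        obtain I where "I \<subseteq> {1..g - 1} - {i0}" "inj_on t I" "set w = t ` I"
          using w(2) unfolding S_def by (meson subset_image_inj)
        moreover from this have "finite I" using finite_subset by blast
        moreover from calculation have "card I \<le> Suc p"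
          using card_length[of w] w(1) by (simp add: card_image)
        ultimately show ?thesis using that by blast
      qed
      have "card (insert i0 I) \<le> p + 2" using I(2,3) card_insert_le_m1[of "p + 2" I i0] by simp
      then have "\<not> A \<subseteq> insert i0 I" using A(2) I(2) card_mono[of "insert i0 I" A] by auto
      then obtain P where P: "P \<in> A" "P \<noteq> i0" "P \<notin> I" by blast
      then have P1: "P \<in> {1..g - 1}" using A by blast
      then have P2: "P \<in> {1..g + 1}" by auto
      have Pl: "P \<noteq> l" using i0(2) P(2) P1 by auto
      have nvP: "node_value g ?x 1 Br1 P (?s i) = 0" if "i \<in> {1..g - 1}" "i \<noteq> P" for i
        using nv[OF that(1) P2] that P1 by (auto simp: pole_node_def)
      have "node_value g ?x 1 Br1 P (t i) = 0" if "i \<in> I" for i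
      proof -
        have "i \<in> {1..g - 1}" "i \<noteq> P" using that I(1) P(3) by auto
        then show ?thesis
          using nvP[of i] nvP[of i0] i0(1) P(2) by (simp add: t_def node_value_diff node_value_cscale del: One_nat_def)
      qed
      then have ww: "set w \<subseteq> {v \<in> H 1. node_value g ?x 1 Br1 P v = 0 \<and> node_value g ?x 1 Br1 l v = 0}"
        using I t by auto
      show "koszul_symb w b \<in> koszul_boundaries H p 2"
        unfolding H_def
        by (rule node_contribution_from_normalization[OF x g2 P2 h(3) _ _ h(1,2) van[OF P(1)] _ w(1) _ b])
           (use P1 g l Pl ww in \<open>auto simp: H_def\<close>)
    qed
  qed
  then show ?thesis by (simp add: property_N_def prym_sections_def[abs_def])
qed

section \<open>The parametrized curve\<close>

lemma mem_span_pair: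
  assumes "v \<in> cfun.span {A, B}"
  shows "\<exists>\<alpha> \<beta>. v = cscale \<alpha> A + cscale \<beta> B"
proof -
  obtain \<alpha> where "v - cscale \<alpha> A \<in> cfun.span {B}" using assms cfun.span_breakdown_eq[of v A "{B}"] by blast
  then obtain \<beta> where "v - cscale \<alpha> A - cscale \<beta> B \<in> cfun.span {}"
    using cfun.span_breakdown_eq[of "v - cscale \<alpha> A" B "{}"] by blast
  then have "v = cscale \<alpha> A + cscale \<beta> B" by (simp add: algebra_simps)
  then show ?thesis by blast
qed

lemma mem_span_singleton: "v \<in> cfun.span {A} \<Longrightarrow> \<exists>\<alpha>. v = cscale \<alpha> A"
  using mem_span_pair[of v A A] by (auto simp: cfun.scale_left_distrib[symmetric])

lemma span_singleton_cscale:
  assumes "c \<noteq> 0"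
  shows "cfun.span {cscale c v} = cfun.span {v}"
proof
  show "cfun.span {cscale c v} \<subseteq> cfun.span {v}"
    by (rule cfun.span_minimal) (auto intro: cfun.span_scale cfun.span_base)
  have "v = cscale (1 / c) (cscale c v)" using assms by simp
  then have "v \<in> cfun.span {cscale c v}" by (metis cfun.span_scale cfun.span_base singletonI)
  then show "cfun.span {v} \<subseteq> cfun.span {cscale c v}"
    by (intro cfun.span_minimal) auto
qed

lemma span_singleton_eqD:
  assumes "cfun.span {v} = cfun.span {w}" "v \<noteq> 0"
  shows "\<exists>c. c \<noteq> 0 \<and> v = cscale c w"
proof -
  have "v \<in> cfun.span {w}" using assms(1) cfun.span_base[of v "{v}"] by simp
  then obtain c where "v = cscale c w" using mem_span_singleton by blast
  then show ?thesis using assms(2) by (cases "c = 0") auto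
qed

lemma dim_span_pair:
  fixes A B :: "nat \<Rightarrow> complex"
  assumes "A i * B i' - B i * A i' \<noteq> 0"
  shows "cfun.dim (cfun.span {A, B}) = 2"
proof -
  have AB: "A \<noteq> B" using assms by (auto simp: mult.commute)
  have "cfun.independent {A, B}"
    unfolding cfun.dependent_finite[OF finite.insertI[OF finite.insertI[OF finite.emptyI]]]
  proof
    assume "\<exists>u. (\<exists>v\<in>{A, B}. u v \<noteq> 0) \<and> (\<Sum>v\<in>{A, B}. cscale (u v) v) = 0"
    then obtain u where u: "u A \<noteq> 0 \<or> u B \<noteq> 0" "cscale (u A) A + cscale (u B) B = 0"
      using AB by auto
    have e: "u A * A k + u B * B k = 0" for k
      using fun_cong[OF u(2), of k] by (simp add: fun_apply cscale_def)
    have "u A * (A i * B i' - B i * A i') = B i' * (u A * A i + u B * B i) - B i * (u A * A i' + u B * B i')"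
      by (simp add: algebra_simps)
    moreover have "u B * (A i * B i' - B i * A i') = A i * (u A * A i' + u B * B i') - A i' * (u A * A i + u B * B i)"
      by (simp add: algebra_simps)
    ultimately show False using e[of i] e[of i'] u(1) assms by auto
  qed
  then show ?thesis using cfun.dim_span_eq_card_independent AB by fastforce
qed

text \<open>The last equation is Euler's formula.\<close>

lemma binary_form_derivatives:
  assumes "binary_form n f"
  shows "\<exists>ft fu. ((\<lambda>s. f (s, u)) has_field_derivative ft) (at t) \<and>
    ((\<lambda>s. f (t, s)) has_field_derivative fu) (at u) \<and> t * ft + u * fu = of_nat n * f (t, u)"
proof -
  obtain c where c: "\<And>t u. f (t, u) = (\<Sum>i\<le>n. c i * t ^ i * u ^ (n - i))"
    using assms unfolding binary_form_def by blast
  let ?ft = "\<Sum>i\<le>n. c i * (of_nat i * t ^ (i - 1)) * u ^ (n - i)"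
  let ?fu = "\<Sum>i\<le>n. c i * t ^ i * (of_nat (n - i) * u ^ (n - i - 1))"
  have 1: "((\<lambda>s. f (s, u)) has_field_derivative ?ft) (at t)"
    unfolding c by (auto intro!: derivative_eq_intros simp: mult_ac)
  have 2: "((\<lambda>s. f (t, s)) has_field_derivative ?fu) (at u)"
    unfolding c by (auto intro!: derivative_eq_intros simp: mult_ac)
  have pow: "x * (of_nat m * x ^ (m - 1)) = of_nat m * x ^ m" for x :: complex and m
    by (cases m) simp_all
  have "t * (c i * (of_nat i * t ^ (i - 1)) * u ^ (n - i)) + u * (c i * t ^ i * (of_nat (n - i) * u ^ (n - i - 1)))
      = of_nat n * (c i * t ^ i * u ^ (n - i))" if "i \<le> n" for i
  proof -
    have "t * (c i * (of_nat i * t ^ (i - 1)) * u ^ (n - i)) + u * (c i * t ^ i * (of_nat (n - i) * u ^ (n - i - 1)))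
      = c i * u ^ (n - i) * (t * (of_nat i * t ^ (i - 1))) + c i * t ^ i * (u * (of_nat (n - i) * u ^ (n - i - 1)))"
      by (simp only: mult_ac)
    also have "\<dots> = (of_nat i + of_nat (n - i)) * (c i * t ^ i * u ^ (n - i))"
      unfolding pow by (simp only: distrib_left distrib_right mult_ac)
    also have "of_nat i + of_nat (n - i) = (of_nat n :: complex)"
      using that by (simp only: of_nat_add[symmetric] le_add_diff_inverse)
    finally show ?thesis .
  qed
  then have "t * ?ft + u * ?fu = of_nat n * f (t, u)"
    unfolding c sum_distrib_left sum.distrib[symmetric] by (intro sum.cong) auto
  with 1 2 show ?thesis by blast
qed

text \<open>Cramer's rule: a point is determined by two independent linear forms.\<close>

lemma vanishing_form_solve:
  "(fst p * snd q - snd p * fst q) * fst z = fst p * vanishing_form q z - fst q * vanishing_form p z"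
  "(fst p * snd q - snd p * fst q) * snd z = snd p * vanishing_form q z - snd q * vanishing_form p z"
  by (simp_all add: vanishing_form_apply algebra_simps)

text \<open>If near each point two coordinates are a nonvanishing form times two independent linear forms,
these two coordinates already separate points and tangent directions. By Euler's formula their
Jacobian is a nonzero multiple of \<open>E z * E z\<close>.\<close>

lemma embeds_line_of_linear_pairs:
  assumes pairs: "\<And>z. z \<noteq> (0, 0) \<Longrightarrow> \<exists>i i' p q E c c'. vanishing_form p q \<noteq> 0 \<and> binary_form n E \<and> E z \<noteq> 0 \<and>
      c \<noteq> 0 \<and> c' \<noteq> 0 \<and> (\<forall>w. f w i = c * (E w * vanishing_form p w)) \<and> (\<forall>w. f w i' = c' * (E w * vanishing_form q w))"
  shows "embeds_line f"
  unfolding embeds_line_def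
proof (intro conjI allI impI)
  fix z :: "complex \<times> complex" assume z: "z \<noteq> (0, 0)"
  obtain i i' p q E c c' where pq: "vanishing_form p q \<noteq> 0" and E: "binary_form n E" "E z \<noteq> 0"
    and c: "c \<noteq> 0" "c' \<noteq> 0" and f: "\<And>w. f w i = c * (E w * vanishing_form p w)" "\<And>w. f w i' = c' * (E w * vanishing_form q w)"
    using pairs[OF z] by metis
  define W where "W = fst p * snd q - snd p * fst q"
  have W: "W \<noteq> 0" using pq by (simp add: W_def vanishing_form_apply algebra_simps)
  have "vanishing_form p z \<noteq> 0 \<or> vanishing_form q z \<noteq> 0"
  proof (rule ccontr)
    assume "\<not> ?thesis"
    then have "W * fst z = 0" "W * snd z = 0" unfolding W_def vanishing_form_solve by simp_all
    then show False using W z by (cases z) simp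
  qed
  then have "f z i \<noteq> 0 \<or> f z i' \<noteq> 0" unfolding f using E(2) c by auto
  then show fz: "f z \<noteq> 0" by (auto simp: fun_apply)
  obtain t u where tu: "z = (t, u)" by (cases z)
  obtain Et Eu where D: "((\<lambda>s. E (s, u)) has_field_derivative Et) (at t)"
    "((\<lambda>s. E (t, s)) has_field_derivative Eu) (at u)" "t * Et + u * Eu = of_nat n * E (t, u)"
    using binary_form_derivatives[OF E(1)] by blast
  have dt: "deriv (\<lambda>s. b * (E (s, u) * vanishing_form r (s, u))) t = b * (Et * vanishing_form r z + E z * snd r)" for b r
    by (rule DERIV_imp_deriv) (auto simp: vanishing_form_apply tu intro!: derivative_eq_intros D)
  have du: "deriv (\<lambda>s. b * (E (t, s) * vanishing_form r (t, s))) u = b * (Eu * vanishing_form r z - E z * fst r)" for b r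
    by (rule DERIV_imp_deriv) (auto simp: vanishing_form_apply tu intro!: derivative_eq_intros D)
  have "partial_t f z i * partial_u f z i' - partial_u f z i * partial_t f z i'
      = c * c' * (E z * W * (t * Et + u * Eu) + E z * E z * W)"
    unfolding tu partial_t_def partial_u_def prod.case f dt[unfolded tu] du[unfolded tu]
    by (simp add: vanishing_form_apply W_def algebra_simps)
  also have "\<dots> = c * c' * E z * E z * W * of_nat (Suc n)"
    unfolding D(3) tu[symmetric] by (simp add: algebra_simps)
  finally have "partial_t f z i * partial_u f z i' - partial_u f z i * partial_t f z i' \<noteq> 0"
    using c E(2) W by (simp del: of_nat_Suc)
  then show "cfun.dim (tangent_line f z) = 2" unfolding tangent_line_def by (rule dim_span_pair)
  fix w :: "complex \<times> complex" assume "w \<noteq> (0, 0)" and eq: "cfun.span {f z} = cfun.span {f w}"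
  then obtain l where l: "f z = cscale l (f w)" using span_singleton_eqD[OF eq fz] by blast
  define m where "m = l * E w / E z"
  have "f z i = l * f w i" "f z i' = l * f w i'" using l by (simp_all add: cscale_def)
  then have "c * (E z * vanishing_form p z) = c * (l * E w * vanishing_form p w)"
    "c' * (E z * vanishing_form q z) = c' * (l * E w * vanishing_form q w)"
    unfolding f by (simp_all add: mult_ac)
  then have "vanishing_form p z = m * vanishing_form p w" "vanishing_form q z = m * vanishing_form q w"
    using c E(2) by (simp_all add: m_def field_simps)
  then have "W * fst z = m * (W * fst w)" "W * snd z = m * (W * snd w)"
    unfolding W_def vanishing_form_solve by (simp_all add: algebra_simps)
  then have "W * fst z = W * (m * fst w)" "W * snd z = W * (m * snd w)" by (simp_all only: mult.left_commute)
  then show "vanishing_form z w = 0" using W by (simp add: vanishing_form_apply)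
qed

lemma genus_bounds:
  fixes g :: nat
  assumes "g \<ge> 6"
  shows "3 \<le> g div 2" "g div 2 < g - 2"
  using assms by linarith+

context
  fixes g :: nat and d :: complex and a :: params
  assumes a: "nondegenerate g a" and g: "g \<ge> 6" and d: "d \<noteq> 0"
begin

lemma indep_nodes: "independent_nodes g (prym_node g a)"
  by (rule independent_prym_nodes[OF a]) (use g in simp)

lemma node_nonzero: "prym_node g a l j \<noteq> (0, 0)"
  by (simp add: prym_node_def)

lemma common_zero_of_nodes:
  assumes "r \<in> {1..g + 1}" "s \<in> {1..g + 1}" "vanishing_form (prym_node g a r j) z = 0" "vanishing_form (prym_node g a s j) z = 0" "z \<noteq> (0, 0)"
  shows "r = s"
proof (rule ccontr)
  assume "r \<noteq> s"
  then have W: "vanishing_form (prym_node g a r j) (prym_node g a s j) \<noteq> 0"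
    using indep_nodes assms by (auto simp: independent_nodes_def independent_points_def)
  have "vanishing_form (prym_node g a r j) (prym_node g a s j)
      = - (fst (prym_node g a r j) * snd (prym_node g a s j) - snd (prym_node g a r j) * fst (prym_node g a s j))"
    by (simp add: vanishing_form_apply)
  moreover have "(fst (prym_node g a r j) * snd (prym_node g a s j) - snd (prym_node g a r j) * fst (prym_node g a s j)) * fst z = 0"
    "(fst (prym_node g a r j) * snd (prym_node g a s j) - snd (prym_node g a r j) * fst (prym_node g a s j)) * snd z = 0"
    unfolding vanishing_form_solve using assms(3,4) by simp_all
  ultimately have "fst z = 0" "snd z = 0" using W by auto
  then show False using assms(5) by (cases z) simp
qed

text \<open>Two coordinates with the same pole have all linear factors in common except one.\<close>

lemma coordinate_pair:
  assumes i: "i \<in> {1..g - 1}" "i' \<in> {1..g - 1}" "i \<noteq> i'" and pole: "pole_node g i = pole_node g i'"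
    and z: "\<And>r. r \<in> {1..g + 1} - {i, i', pole_node g i} \<Longrightarrow> vanishing_form (prym_node g a r j) z \<noteq> 0"
  shows "\<exists>i i' p q E c c'. vanishing_form p q \<noteq> 0 \<and> binary_form (g - 2) E \<and> E z \<noteq> 0 \<and>
      c \<noteq> 0 \<and> c' \<noteq> 0 \<and> (\<forall>w. prym_map g d a j w i = c * (E w * vanishing_form p w)) \<and>
      (\<forall>w. prym_map g d a j w i' = c' * (E w * vanishing_form q w))"
proof -
  let ?N = "{1..g + 1} - {i, i', pole_node g i}"
  define E where "E w = (\<Prod>r\<in>?N. vanishing_form (prym_node g a r j) w)" for w
  have ne: "pole_node g i \<noteq> i" "pole_node g i \<noteq> i'" using i by (auto simp: pole_node_def)
  have "{i, i', pole_node g i} \<subseteq> {1..g + 1}" using i pole_node_in[OF i(1)] by auto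
  moreover have "card {i, i', pole_node g i} = 3" using ne i(3) by auto
  ultimately have "card ?N = g - 2" by (subst card_Diff_subset) auto
  then have E: "binary_form (g - 2) E" unfolding E_def using binary_form_prod[of ?N "\<lambda>r. prym_node g a r j"] by simp
  have Ez: "E z \<noteq> 0" unfolding E_def using z by auto
  have *: "\<exists>c. c \<noteq> 0 \<and> (\<forall>w. prym_map g d a j w b = c * (E w * vanishing_form (prym_node g a b' j) w))"
    if b: "b \<in> {1..g - 1}" "b' \<in> {1..g - 1}" "{b, b'} = {i, i'}" for b b'
  proof -
    have bb: "b \<noteq> b'" "pole_node g b = pole_node g i" using b(3) i(3) pole by (auto simp: doubleton_eq_iff)
    have N: "?N = {1..g + 1} - {b, pole_node g i} - {b'}" using b(3) by auto
    have "b' \<in> {1..g + 1} - {b, pole_node g i}" using b bb ne by (auto simp: doubleton_eq_iff)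
    then have "(\<Prod>r\<in>{1..g + 1} - {b, pole_node g i}. vanishing_form (prym_node g a r j) w) = vanishing_form (prym_node g a b' j) w * E w" for w
      unfolding E_def N by (intro prod.remove) auto
    moreover have "b \<noteq> pole_node g i" using b(3) ne by (auto simp: doubleton_eq_iff)
    ultimately have "prym_map g d a j w b = pair_coeff g d a j b * vanishing_form (prym_node g a (pole_node g i) j) (prym_node g a b j) *
        (E w * vanishing_form (prym_node g a b' j) w)" for w
      unfolding prym_map_residue_pair[OF b(1)] by (simp add: residue_pair_def bb mult_ac)
    moreover have "vanishing_form (prym_node g a (pole_node g i) j) (prym_node g a b j) \<noteq> 0"
      using indep_nodes b(1) pole_node_in[OF i(1)] \<open>b \<noteq> pole_node g i\<close>
      unfolding independent_nodes_def independent_points_def by auto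
    ultimately show ?thesis using pair_coeff_nonzero[OF a d]
      by (intro exI[of _ "pair_coeff g d a j b * vanishing_form (prym_node g a (pole_node g i) j) (prym_node g a b j)"]) auto
  qed
  obtain c where c: "c \<noteq> 0" "\<forall>w. prym_map g d a j w i = c * (E w * vanishing_form (prym_node g a i' j) w)"
    using *[of i i'] i by blast
  obtain c' where c': "c' \<noteq> 0" "\<forall>w. prym_map g d a j w i' = c' * (E w * vanishing_form (prym_node g a i j) w)"
    using *[of i' i] i by blast
  have "vanishing_form (prym_node g a i' j) (prym_node g a i j) \<noteq> 0"
    using indep_nodes i unfolding independent_nodes_def independent_points_def by auto
  then show ?thesis using E Ez c c' by blast
qed

text \<open>A point lies over at most one node \<open>r\<close>. On both sides of \<open>g div 2\<close> there are at least two
coordinates, so two coordinates with the same pole can be found whose common factors do not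
include the linear form of \<open>r\<close>.\<close>

lemma embeds_prym_map: "embeds_line (prym_map g d a j)"
proof (rule embeds_line_of_linear_pairs[where n = "g - 2"])
  fix z :: "complex \<times> complex" assume z: "z \<noteq> (0, 0)"
  obtain r where r: "r \<in> {1..g + 1}" "\<And>s. s \<in> {1..g + 1} \<Longrightarrow> s \<noteq> r \<Longrightarrow> vanishing_form (prym_node g a s j) z \<noteq> 0"
  proof (cases "\<exists>r\<in>{1..g + 1}. vanishing_form (prym_node g a r j) z = 0")
    case True
    then show ?thesis using that common_zero_of_nodes[OF _ _ _ _ z] by blast
  next
    case False
    then show ?thesis using that[of 1] by simp
  qed
  have "\<exists>i i'. i \<in> {1..g - 1} \<and> i' \<in> {1..g - 1} \<and> i \<noteq> i' \<and> pole_node g i = pole_node g i' \<and> r \<in> {i, i', pole_node g i}"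
  proof -
    consider "r \<le> g div 2" | "g div 2 < r" "r \<le> g - 1" | "r = g" | "r = g + 1" using r(1) by force
    then show ?thesis
    proof cases
      case 1
      then show ?thesis using r(1) genus_bounds[OF g]
        by (intro exI[of _ r] exI[of _ "if r = 1 then 2 else 1"]) (auto simp: pole_node_def)
    next
      case 2
      then show ?thesis using r(1) genus_bounds[OF g]
        by (intro exI[of _ r] exI[of _ "if r = g - 1 then g - 2 else g - 1"]) (auto simp: pole_node_def)
    next
      case 3
      then show ?thesis using genus_bounds[OF g]
        by (intro exI[of _ "g - 1"] exI[of _ "g - 2"]) (auto simp: pole_node_def)
    next
      case 4
      then show ?thesis using genus_bounds[OF g]
        by (intro exI[of _ 1] exI[of _ 2]) (auto simp: pole_node_def)
    qed
  qed
  then obtain i i' where i: "i \<in> {1..g - 1}" "i' \<in> {1..g - 1}" "i \<noteq> i'" "pole_node g i = pole_node g i'"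
    "r \<in> {i, i', pole_node g i}" by blast
  show "\<exists>i i' p q E c c'. vanishing_form p q \<noteq> 0 \<and> binary_form (g - 2) E \<and> E z \<noteq> 0 \<and>
      c \<noteq> 0 \<and> c' \<noteq> 0 \<and> (\<forall>w. prym_map g d a j w i = c * (E w * vanishing_form p w)) \<and>
      (\<forall>w. prym_map g d a j w i' = c' * (E w * vanishing_form q w))"
    by (rule coordinate_pair[OF i(1-4)]) (use r(2) i(5) in auto)
qed

text \<open>The value at a node is the residue times a nonzero number that is common to all coordinates.\<close>

lemma prym_map_at_node:
  assumes l: "l \<in> {1..g + 1}"
  shows "\<exists>c. c \<noteq> 0 \<and> prym_map g d a j (prym_node g a l j) = cscale c (node_image g l)"
proof -
  define D where "D = (\<Prod>r\<in>{1..g + 1} - {l}. vanishing_form (prym_node g a r j) (prym_node g a l j))"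
  have D: "D \<noteq> 0" unfolding D_def by (rule node_denominator_nonzero[OF indep_nodes l])
  have val: "prym_map g d a j (prym_node g a l j) i = pair_coeff g d a j i *
      ((if l = i then 1 else 0) - (if l = pole_node g i then 1 else 0)) * D" if i: "i \<in> {1..g - 1}" for i
  proof -
    have i': "i \<in> {1..g + 1}" using i by auto
    have "residue_pair g (prym_node g a) j i (pole_node g i) (prym_node g a l j) / D
        = (if l = i then 1 else 0) - (if l = pole_node g i then 1 else 0)"
      using node_residue_residue_pair[OF indep_nodes i' pole_node_in[OF i] l, of j]
      unfolding node_residue_def D_def[symmetric] power_one_right .
    then have "residue_pair g (prym_node g a) j i (pole_node g i) (prym_node g a l j)
        = ((if l = i then 1 else 0) - (if l = pole_node g i then 1 else 0)) * D"
      using D by (simp only: divide_eq_eq if_False not_False_eq_True)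
    then show ?thesis unfolding prym_map_residue_pair[OF i] by (simp only: mult.assoc)
  qed
  define K where "K = branch_const g d a j / param_prod g a j"
  have K: "K \<noteq> 0" using branch_const_nonzero[OF a d] param_prod_nonzero[OF a] by (simp add: K_def)
  define c where "c = (if l \<le> g - 1 then pair_coeff g d a j l * D else if l = g then - K * D else D)"
  have "c \<noteq> 0" using D K pair_coeff_nonzero[OF a d] by (simp add: c_def)
  moreover have "prym_map g d a j (prym_node g a l j) i = c * node_image g l i" for i
  proof (cases "i \<in> {1..g - 1}")
    case True
    consider "l \<le> g - 1" | "l = g" | "l = g + 1" using l by force
    then show ?thesis
    proof cases
      case 1
      then show ?thesis unfolding val[OF True] using True by (auto simp: c_def node_image_def pole_node_def)
    next
      case 2
      then show ?thesis unfolding val[OF True] using True genus_bounds[OF g]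
        by (auto simp: c_def node_image_def pole_node_def pair_coeff_def K_def)
    next
      case 3
      then show ?thesis unfolding val[OF True] using True genus_bounds[OF g]
        by (auto simp: c_def node_image_def pole_node_def pair_coeff_def K_def)
    qed
  next
    case False
    then have "prym_map g d a j (prym_node g a l j) i = 0"
      using genus_bounds[OF g] by (cases "prym_node g a l j") (auto simp: prym_map_def Let_def)
    moreover have "node_image g l i = 0" using False l genus_bounds[OF g] by (auto simp: node_image_def)
    ultimately show ?thesis by simp
  qed
  ultimately show ?thesis by (intro exI[of _ c]) (auto simp: fun_eq_iff cscale_def)
qed

lemma span_prym_map_at_node:
  "l \<in> {1..g + 1} \<Longrightarrow> cfun.span {prym_map g d a j (prym_node g a l j)} = cfun.span {node_image g l}"
  using prym_map_at_node[of l j] span_singleton_cscale by metis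

lemma node_image_supports:
  assumes "l \<in> {1..g + 1}" "m \<in> {1..g + 1}" "l < m"
  shows "\<exists>i. (node_image g l i = 0) \<noteq> (node_image g m i = 0)"
proof -
  consider "m \<le> g - 1" | "m = g" | "m = g + 1" "l = g" | "m = g + 1" "l \<le> g - 1" using assms by force
  then show ?thesis
  proof cases
    case 1
    then show ?thesis using assms by (intro exI[of _ l]) (auto simp: node_image_def)
  next
    case 2
    then show ?thesis using assms genus_bounds[OF g]
      by (intro exI[of _ "if l = g - 1 then g - 2 else g - 1"]) (auto simp: node_image_def)
  next
    case 3
    then show ?thesis using assms genus_bounds[OF g] by (intro exI[of _ 1]) (auto simp: node_image_def)
  next
    case 4
    then show ?thesis using assms genus_bounds[OF g]
      by (intro exI[of _ "if l = 1 then 2 else 1"]) (auto simp: node_image_def)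
  qed
qed

lemma node_image_nonzero:
  assumes "l \<in> {1..g + 1}"
  shows "node_image g l \<noteq> 0"
proof -
  have "prym_map g d a Br1 (prym_node g a l Br1) \<noteq> 0"
    using embeds_prym_map[of Br1] node_nonzero unfolding embeds_line_def by blast
  then show ?thesis using prym_map_at_node[OF assms, of Br1] by auto
qed

lemma inj_node_images: "inj_on (\<lambda>l. cfun.span {node_image g l}) {1..g + 1}"
proof -
  have "False" if lm: "l \<in> {1..g + 1}" "m \<in> {1..g + 1}" "l < m" "cfun.span {node_image g l} = cfun.span {node_image g m}" for l m
  proof -
    obtain c where "c \<noteq> 0" "node_image g l = cscale c (node_image g m)"
      using span_singleton_eqD[OF lm(4) node_image_nonzero[OF lm(1)]] by blast
    then have "(node_image g l i = 0) = (node_image g m i = 0)" for i by (simp add: cscale_def)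
    then show False using node_image_supports[OF lm(1-3)] by blast
  qed
  then show ?thesis unfolding inj_on_def by (metis linorder_neqE_nat)
qed

end

text \<open>For distinct parameters: no affine map takes the first three parameters of the first line to those
of the second.\<close>

definition unequal_ratios :: "params \<Rightarrow> bool" where
  "unequal_ratios a \<longleftrightarrow> (a (1, Br1) - a (2, Br1)) * (a (1, Br2) - a (3, Br2))
     \<noteq> (a (1, Br2) - a (2, Br2)) * (a (1, Br1) - a (3, Br1))"

lemma no_affine_match:
  assumes "unequal_ratios a" and m: "\<And>i. i \<in> {1, 2, 3} \<Longrightarrow> p - a (i, Br2) * q = c * (p' - a (i, Br1) * q')" and q: "q \<noteq> 0"
  shows False
proof -
  have d: "q * (a (1, Br2) - a (i, Br2)) = c * q' * (a (1, Br1) - a (i, Br1))" if "i \<in> {1, 2, 3}" for i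
  proof -
    have "q * (a (1, Br2) - a (i, Br2)) = (p - a (i, Br2) * q) - (p - a (1, Br2) * q)"
      by (simp add: algebra_simps)
    also have "\<dots> = c * (p' - a (i, Br1) * q') - c * (p' - a (1, Br1) * q')"
      using m[of 1] m[OF that] by simp
    finally show ?thesis by (simp add: algebra_simps)
  qed
  have "q * ((a (1, Br1) - a (2, Br1)) * (a (1, Br2) - a (3, Br2)))
      = (a (1, Br1) - a (2, Br1)) * (q * (a (1, Br2) - a (3, Br2)))" by (simp add: mult_ac)
  also have "\<dots> = (c * q' * (a (1, Br1) - a (2, Br1))) * (a (1, Br1) - a (3, Br1))"
    using d[of 3] by (simp add: mult_ac)
  also have "\<dots> = q * ((a (1, Br2) - a (2, Br2)) * (a (1, Br1) - a (3, Br1)))"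
    using d[of 2] by (simp add: mult_ac)
  finally show False using q assms(1) by (simp add: unequal_ratios_def)
qed

lemma proportional_points:
  assumes "vanishing_form x z = 0" "x \<noteq> (0, 0)" "z \<noteq> (0, 0)"
  shows "\<exists>c. c \<noteq> 0 \<and> z = (c * fst x, c * snd x)"
proof -
  obtain p q t u where xz: "x = (p, q)" "z = (t, u)" by (cases x, cases z)
  have e: "q * t = p * u" using assms(1) by (simp add: vanishing_form_apply xz)
  show ?thesis
  proof (cases "q = 0")
    case True
    then have "p \<noteq> 0" "u = 0" using e assms(2) xz by auto
    then show ?thesis using True assms(3) xz by (intro exI[of _ "t / p"]) auto
  next
    case False
    then have t: "t = u / q * p" using e by (simp add: field_simps)
    then have "u \<noteq> 0" using assms(3) xz by auto
    then show ?thesis using False t xz by (intro exI[of _ "u / q"]) auto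
  qed
qed

text \<open>By the product rule only the derivative of the vanishing factor contributes.\<close>

lemma partial_of_multiple:
  assumes f: "\<And>w. f w i = vanishing_form p w * q w" and q: "binary_form n q" and z: "vanishing_form p z = 0"
  shows "partial_t f z i = snd p * q z" "partial_u f z i = - fst p * q z"
proof -
  obtain t u where tu: "z = (t, u)" by (cases z)
  obtain qt qu where D: "((\<lambda>s. q (s, u)) has_field_derivative qt) (at t)"
    "((\<lambda>s. q (t, s)) has_field_derivative qu) (at u)"
    using binary_form_derivatives[OF q] by blast
  have z': "snd p * t - fst p * u = 0" using z by (simp add: vanishing_form_apply tu)
  have "((\<lambda>s. (snd p * s - fst p * u) * q (s, u)) has_field_derivative (snd p * q (t, u) + (snd p * t - fst p * u) * qt)) (at t)"
    by (auto intro!: derivative_eq_intros D)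
  then show "partial_t f z i = snd p * q z"
    unfolding partial_t_def tu prod.case f vanishing_form_apply fst_conv snd_conv
    using DERIV_imp_deriv z' by fastforce
  have "((\<lambda>s. (snd p * t - fst p * s) * q (t, s)) has_field_derivative (- fst p * q (t, u) + (snd p * t - fst p * u) * qu)) (at u)"
    by (auto intro!: derivative_eq_intros D)
  then show "partial_u f z i = - fst p * q z"
    unfolding partial_u_def tu prod.case f vanishing_form_apply fst_conv snd_conv
    using DERIV_imp_deriv z' by fastforce
qed

lemma prym_map_first_coordinates:
  assumes "i \<in> {1..g div 2}" "i \<le> g - 1"
  shows "prym_map g d a j z i = (\<Prod>r\<in>{1..g} - {i}. vanishing_form (prym_node g a r j) z)"
proof -
  obtain t u where z: "z = (t, u)" by (cases z)
  have "(\<Prod>r\<in>{1..g - 1} - {i}. vanishing_form (prym_node g a r j) z) = (\<Prod>r\<in>{1..g - 1} - {i}. t - a (r, j) * u)"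
    by (rule prod.cong) (auto simp: prym_node_def vanishing_form_apply z)
  moreover have set: "{1..g} - {i} = insert g ({1..g - 1} - {i})" using assms by auto
  moreover have "vanishing_form (prym_node g a g j) z = t"
    using assms by (auto simp: prym_node_def vanishing_form_apply z)
  ultimately show ?thesis
    unfolding set using assms by (subst prod.insert) (auto simp: prym_map_def Let_def z)
qed

context
  fixes g :: nat and d :: complex and a :: params
  assumes a: "nondegenerate g a" and g: "g \<ge> 6" and d: "d \<noteq> 0" and ratios: "unequal_ratios a"
begin

lemma first_coordinate:
  assumes "i \<in> {1, 2, 3}"
  shows "prym_map g d a j z i = (\<Prod>r\<in>{1..g} - {i}. vanishing_form (prym_node g a r j) z)"
  by (rule prym_map_first_coordinates) (use assms genus_bounds[OF g] in auto)

lemma node_form: "i \<in> {1, 2, 3} \<Longrightarrow> vanishing_form (prym_node g a i j) z = fst z - a (i, j) * snd z"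
  using genus_bounds[OF g] by (auto simp: prym_node_def vanishing_form_apply)

lemma prym_map_homogeneous:
  "prym_map g d a j (c * t, c * u) = cscale (c ^ (g - 1)) (prym_map g d a j (t, u))"
proof
  fix i
  show "prym_map g d a j (c * t, c * u) i = cscale (c ^ (g - 1)) (prym_map g d a j (t, u)) i"
  proof (cases "i \<in> {1..g - 1}")
    case True
    have "binary_form (g - 1) (\<lambda>z. prym_map g d a j z i)"
      unfolding prym_map_residue_pair[OF True]
      by (intro binary_form_scale binary_form_residue_pair pole_node_in True) (use True in auto)
    then show ?thesis using binary_form_homogeneous by (simp add: cscale_def)
  next
    case False
    then show ?thesis using genus_bounds[OF g] by (auto simp: prym_map_def Let_def cscale_def)
  qed
qed

text \<open>Away from the nodes, the \<open>i\<close>-th coordinate with \<open>i \<le> g div 2\<close> is a common factor divided by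
\<open>t - a\<^sub>i u\<close>. If the images of \<open>z\<close> and \<open>w\<close> agree, then \<open>t - a\<^sub>i u\<close> at \<open>w\<close> is a fixed multiple of
the same expression at \<open>z\<close>, and the parameters of the two lines are matched by an affine map.\<close>

lemma components_meet_at_nodes:
  assumes z: "z \<noteq> (0, 0)" and eq: "cfun.span {prym_map g d a Br1 z} = cfun.span {prym_map g d a Br2 w}"
  shows "\<exists>l\<in>{1..g + 1}. cfun.span {prym_map g d a Br1 z} = cfun.span {node_image g l}"
proof (cases "\<exists>l\<in>{1..g + 1}. vanishing_form (prym_node g a l Br1) z = 0")
  case True
  have node_nonzero: "prym_node g a l Br1 \<noteq> (0, 0)" for l by (simp add: prym_node_def)
  from True obtain l where l: "l \<in> {1..g + 1}" "vanishing_form (prym_node g a l Br1) z = 0" by blast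
  obtain c where c: "c \<noteq> 0" "z = (c * fst (prym_node g a l Br1), c * snd (prym_node g a l Br1))"
    using proportional_points[OF l(2) node_nonzero z] by blast
  have "cfun.span {prym_map g d a Br1 z} = cfun.span {prym_map g d a Br1 (prym_node g a l Br1)}"
    unfolding c(2) prym_map_homogeneous using c(1) by (simp add: span_singleton_cscale)
  then show ?thesis using span_prym_map_at_node[OF a g d l(1)] l(1) by blast
next
  case False
  then have nz: "vanishing_form (prym_node g a r Br1) z \<noteq> 0" if "r \<in> {1..g + 1}" for r using that by blast
  have phi: "prym_map g d a Br1 z i \<noteq> 0" if i: "i \<in> {1..g - 1}" for i
  proof -
    have "pole_node g i \<noteq> i" using i by (auto simp: pole_node_def)
    moreover have "i \<in> {1..g + 1}" using i by auto
    ultimately have "vanishing_form (prym_node g a (pole_node g i) Br1) (prym_node g a i Br1) \<noteq> 0"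
      using indep_nodes[OF a g d] pole_node_in[OF i] unfolding independent_nodes_def independent_points_def by auto
    then show ?thesis
      unfolding prym_map_residue_pair[OF i] using pair_coeff_nonzero[OF a d] nz \<open>pole_node g i \<noteq> i\<close>
      by (auto simp: residue_pair_def)
  qed
  have one: "1 \<in> {1..g - 1}" and last: "g - 1 \<in> {1..g - 1}" using g by simp_all
  have fz: "prym_map g d a Br1 z \<noteq> 0" using phi[OF one] by (auto simp: fun_apply)
  obtain c where c: "c \<noteq> 0" "prym_map g d a Br1 z = cscale c (prym_map g d a Br2 w)"
    using span_singleton_eqD[OF eq fz] by blast
  then have phi2: "prym_map g d a Br1 z i = c * prym_map g d a Br2 w i" for i by (simp add: cscale_def)
  have w2: "snd w \<noteq> 0"
  proof
    assume "snd w = 0"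
    then have "prym_map g d a Br2 w (g - 1) = 0" using genus_bounds[OF g] by (cases w) (auto simp: prym_map_def Let_def)
    then show False using phi[OF last] phi2[of "g - 1"] by simp
  qed
  define K1 where "K1 = (\<Prod>r\<in>{1..g}. vanishing_form (prym_node g a r Br1) z)"
  define K2 where "K2 = (\<Prod>r\<in>{1..g}. vanishing_form (prym_node g a r Br2) w)"
  have K1: "K1 \<noteq> 0" unfolding K1_def using nz by auto
  have split: "(\<Prod>r\<in>{1..g}. vanishing_form (prym_node g a r j) y) = (fst y - a (i, j) * snd y) * prym_map g d a j y i"
    if i: "i \<in> {1, 2, 3}" for i j y
    unfolding first_coordinate[OF i] node_form[OF i, symmetric]
    using i genus_bounds[OF g] by (intro prod.remove) auto
  have "fst w - a (i, Br2) * snd w = (K2 * c / K1) * (fst z - a (i, Br1) * snd z)" if i: "i \<in> {1, 2, 3}" for i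
  proof -
    have "K1 = (fst z - a (i, Br1) * snd z) * prym_map g d a Br1 z i"
      unfolding K1_def by (rule split[OF i])
    moreover have "K2 * c = (fst w - a (i, Br2) * snd w) * prym_map g d a Br1 z i"
      unfolding K2_def split[OF i] phi2 by (simp add: mult_ac)
    ultimately have "(fst w - a (i, Br2) * snd w) * K1 = (K2 * c) * (fst z - a (i, Br1) * snd z)" by (simp add: mult_ac)
    then show ?thesis using K1 by (simp add: field_simps)
  qed
  from no_affine_match[OF ratios this w2] show ?thesis by blast
qed

lemma components_intersection:
  "prym_component g d a Br1 \<inter> prym_component g d a Br2 = (\<lambda>l. cfun.span {node_image g l}) ` {1..g + 1}"
proof
  show "prym_component g d a Br1 \<inter> prym_component g d a Br2 \<subseteq> (\<lambda>l. cfun.span {node_image g l}) ` {1..g + 1}"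
  proof
    fix X assume "X \<in> prym_component g d a Br1 \<inter> prym_component g d a Br2"
    then obtain z w where "z \<noteq> (0, 0)" "X = cfun.span {prym_map g d a Br1 z}" "X = cfun.span {prym_map g d a Br2 w}"
      unfolding prym_component_def by blast
    then show "X \<in> (\<lambda>l. cfun.span {node_image g l}) ` {1..g + 1}"
      using components_meet_at_nodes[of z w] by blast
  qed
  show "(\<lambda>l. cfun.span {node_image g l}) ` {1..g + 1} \<subseteq> prym_component g d a Br1 \<inter> prym_component g d a Br2"
  proof
    fix X assume "X \<in> (\<lambda>l. cfun.span {node_image g l}) ` {1..g + 1}"
    then obtain l where l: "l \<in> {1..g + 1}" "X = cfun.span {node_image g l}" by blast
    have "X = cfun.span {prym_map g d a j (prym_node g a l j)} \<and> prym_node g a l j \<noteq> (0, 0)" for j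
      using span_prym_map_at_node[OF a g d l(1), of j] l(2) by (auto simp: prym_node_def)
    then have "X \<in> prym_component g d a j" for j unfolding prym_component_def by blast
    then show "X \<in> prym_component g d a Br1 \<inter> prym_component g d a Br2" by blast
  qed
qed

lemma tangent_transport:
  assumes "tangent_line f z = tangent_line f' z'"
  shows "\<exists>\<alpha> \<beta>. \<forall>i. partial_t f z i = \<alpha> * partial_t f' z' i + \<beta> * partial_u f' z' i"
    and "\<exists>\<alpha> \<beta>. \<forall>i. partial_u f z i = \<alpha> * partial_t f' z' i + \<beta> * partial_u f' z' i"
proof -
  have "\<exists>\<alpha> \<beta>. \<forall>i. v i = \<alpha> * partial_t f' z' i + \<beta> * partial_u f' z' i" if "v \<in> tangent_line f z" for v
    using mem_span_pair[of v "partial_t f' z'" "partial_u f' z'"] that assms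
    by (auto simp: tangent_line_def fun_eq_iff fun_apply cscale_def)
  moreover have "partial_t f z \<in> tangent_line f z" "partial_u f z \<in> tangent_line f z"
    by (auto simp: tangent_line_def intro: cfun.span_base)
  ultimately show "\<exists>\<alpha> \<beta>. \<forall>i. partial_t f z i = \<alpha> * partial_t f' z' i + \<beta> * partial_u f' z' i"
    "\<exists>\<alpha> \<beta>. \<forall>i. partial_u f z i = \<alpha> * partial_t f' z' i + \<beta> * partial_u f' z' i" by blast+
qed

text \<open>Modulo the point itself, the coordinates with \<open>i \<le> g div 2\<close> of the tangent direction are
proportional to the inverses of \<open>t - a\<^sub>i u\<close> at the node. Proportional directions on the two
branches would match the parameters by an affine map.\<close>

lemma transversal_at_finite_node:
  assumes l: "l \<in> {1..g}"
  shows "tangent_line (prym_map g d a Br1) (prym_node g a l Br1) \<noteq> tangent_line (prym_map g d a Br2) (prym_node g a l Br2)"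
proof
  let ?x = "prym_node g a"
  assume "tangent_line (prym_map g d a Br1) (?x l Br1) = tangent_line (prym_map g d a Br2) (?x l Br2)"
  then obtain \<alpha> \<beta> where ab: "\<And>i. partial_t (prym_map g d a Br1) (?x l Br1) i
      = \<alpha> * partial_t (prym_map g d a Br2) (?x l Br2) i + \<beta> * partial_u (prym_map g d a Br2) (?x l Br2) i"
    using tangent_transport(1) by blast
  have snd1: "snd (?x l j) = 1" for j using l by (auto simp: prym_node_def)
  define Q where "Q j i = (\<Prod>r\<in>{1..g} - {i} - {l}. vanishing_form (?x r j) (?x l j))" for j i
  define R where "R j = (\<Prod>r\<in>{1..g} - {l}. vanishing_form (?x r j) (?x l j))" for j
  have R: "R j \<noteq> 0" for j
    using indep_nodes[OF a g d] l unfolding R_def independent_nodes_def independent_points_def by auto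
  define c where "c = \<alpha> - \<beta> * fst (?x l Br2)"
  have Q: "Q Br1 i = c * Q Br2 i" if i: "i \<in> {1, 2, 3}" "i \<noteq> l" for i
  proof -
    have f: "prym_map g d a j w i = vanishing_form (?x l j) w * (\<Prod>r\<in>{1..g} - {i} - {l}. vanishing_form (?x r j) w)" for j w
      unfolding first_coordinate[OF i(1)] using l i(2) by (intro prod.remove) auto
    have q: "binary_form (card ({1..g} - {i} - {l})) (\<lambda>w. \<Prod>r\<in>{1..g} - {i} - {l}. vanishing_form (?x r j) w)" for j
      by (rule binary_form_prod) simp
    have "partial_t (prym_map g d a j) (?x l j) i = snd (?x l j) * Q j i"
      "partial_u (prym_map g d a j) (?x l j) i = - fst (?x l j) * Q j i" for j
      unfolding Q_def
      by (rule partial_of_multiple[where f = "prym_map g d a j" and i = i and p = "?x l j" and z = "?x l j"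
            and q = "\<lambda>w. \<Prod>r\<in>{1..g} - {i} - {l}. vanishing_form (?x r j) w", OF f q vanishing_form_self])+
    then show ?thesis
      using ab[of i] snd1 by (simp add: c_def algebra_simps)
  qed
  have "fst (?x l Br2) - a (i, Br2) * snd (?x l Br2) = (c * R Br2 / R Br1) * (fst (?x l Br1) - a (i, Br1) * snd (?x l Br1))"
    if i: "i \<in> {1, 2, 3}" for i
  proof (cases "i = l")
    case True
    then have "vanishing_form (?x i j) (?x l j) = 0" for j by simp
    then show ?thesis using node_form[OF i] by simp
  next
    case False
    have RQ: "R j = vanishing_form (?x i j) (?x l j) * Q j i" for j
    proof -
      have "{1..g} - {l} - {i} = {1..g} - {i} - {l}" by auto
      moreover have "i \<in> {1..g} - {l}" using i False genus_bounds[OF g] by auto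
      ultimately show ?thesis unfolding R_def Q_def
        using prod.remove[of "{1..g} - {l}" i "\<lambda>r. vanishing_form (?x r j) (?x l j)"] by simp
    qed
    have "vanishing_form (?x i Br2) (?x l Br2) * R Br1
        = vanishing_form (?x i Br1) (?x l Br1) * (c * (vanishing_form (?x i Br2) (?x l Br2) * Q Br2 i))"
      unfolding RQ[of Br1] Q[OF i False] by (simp add: mult_ac)
    then have "vanishing_form (?x i Br2) (?x l Br2) * R Br1 = (c * R Br2) * vanishing_form (?x i Br1) (?x l Br1)"
      unfolding RQ[of Br2, symmetric] by (simp add: mult_ac)
    then show ?thesis unfolding node_form[OF i, symmetric] using R[of Br1] by (simp add: field_simps)
  qed
  from no_affine_match[OF ratios this] snd1 show False by simp
qed

text \<open>All coordinates with \<open>i \<le> g div 2\<close> are equal at the node \<open>[1, 0]\<close>, and their derivatives there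
differ by the differences of the parameters.\<close>

lemma transversal_at_infinity:
  "tangent_line (prym_map g d a Br1) (prym_node g a (g + 1) Br1) \<noteq> tangent_line (prym_map g d a Br2) (prym_node g a (g + 1) Br2)"
proof
  let ?x = "prym_node g a"
  have x: "?x (g + 1) j = (1, 0)" for j using g by (auto simp: prym_node_def)
  assume "tangent_line (prym_map g d a Br1) (?x (g + 1) Br1) = tangent_line (prym_map g d a Br2) (?x (g + 1) Br2)"
  then obtain \<alpha> \<beta> where ab: "\<And>i. partial_u (prym_map g d a Br1) (1, 0) i
      = \<alpha> * partial_t (prym_map g d a Br2) (1, 0) i + \<beta> * partial_u (prym_map g d a Br2) (1, 0) i"
    unfolding x using tangent_transport(2) by blast
  have form: "binary_form (g - 1) (\<lambda>w. prym_map g d a j w i)" if i: "i \<in> {1, 2, 3}" for j i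
  proof -
    have i': "i \<in> {1..g - 1}" using i genus_bounds[OF g] by auto
    show ?thesis unfolding prym_map_residue_pair[OF i']
      by (intro binary_form_scale binary_form_residue_pair pole_node_in i') (use i' in auto)
  qed
  have diffs: "partial_t (prym_map g d a j) (1, 0) 1 - partial_t (prym_map g d a j) (1, 0) i = 0"
    "partial_u (prym_map g d a j) (1, 0) 1 - partial_u (prym_map g d a j) (1, 0) i = a (1, j) - a (i, j)"
    if i: "i \<in> {2, 3}" for i j
  proof -
    let ?q = "\<lambda>w. - (a (1, j) - a (i, j)) * (\<Prod>r\<in>{1..g} - {1, i}. vanishing_form (?x r j) w)"
    have i3: "i \<in> {1, 2, 3}" "(1 :: nat) \<in> {1, 2, 3}" using i by auto
    have split: "prym_map g d a j w b = vanishing_form (?x b' j) w * (\<Prod>r\<in>{1..g} - {1, i}. vanishing_form (?x r j) w)"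
      if b: "b \<in> {1, 2, 3}" "b' \<in> {1, 2, 3}" "{b, b'} = {1, i}" for b b' w
    proof -
      have "b \<noteq> b'" using b(3) i by (auto simp: doubleton_eq_iff)
      then have "b' \<in> {1..g} - {b}" using b(2) genus_bounds[OF g] by auto
      moreover have "{1..g} - {b} - {b'} = {1..g} - {1, i}" using b(3) by auto
      ultimately show ?thesis unfolding first_coordinate[OF b(1)]
        using prod.remove[of "{1..g} - {b}" b' "\<lambda>r. vanishing_form (?x r j) w"] by simp
    qed
    have diff: "prym_map g d a j w 1 - prym_map g d a j w i = vanishing_form (1, 0) w * ?q w" for w
      unfolding split[OF i3(2) i3(1) refl] split[OF i3(1) i3(2) insert_commute] node_form[OF i3(1)] node_form[OF i3(2)]
      by (simp add: vanishing_form_apply algebra_simps)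
    have q: "binary_form (card ({1..g} - {1, i})) ?q"
      by (intro binary_form_scale binary_form_prod) simp
    have q1: "?q (1, 0) = - (a (1, j) - a (i, j))"
    proof -
      have "(\<Prod>r\<in>{1..g} - {1, i}. vanishing_form (?x r j) (1, 0)) = (\<Prod>r\<in>{1..g} - {1, i}. 1)"
        by (rule prod.cong) (auto simp: prym_node_def vanishing_form_apply)
      then show ?thesis by simp
    qed
    let ?f = "\<lambda>w (i' :: nat). prym_map g d a j w 1 - prym_map g d a j w i"
    have pf: "partial_t ?f (1, 0) 0 = snd (1 :: complex, 0 :: complex) * ?q (1, 0)"
      "partial_u ?f (1, 0) 0 = - fst (1 :: complex, 0 :: complex) * ?q (1, 0)"
      by (rule partial_of_multiple[where f = ?f and i = 0 and p = "(1, 0)" and z = "(1, 0)" and q = ?q,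
            OF diff q vanishing_form_self])+
    have "\<exists>ft fu. ((\<lambda>s. prym_map g d a j (s, 0) b) has_field_derivative ft) (at 1) \<and>
        ((\<lambda>s. prym_map g d a j (1, s) b) has_field_derivative fu) (at 0)" if "b \<in> {1, 2, 3}" for b
      using binary_form_derivatives[OF form[OF that, of j], of 0 1] by blast
    then obtain ft fu where D: "\<And>b. b \<in> {1, 2, 3} \<Longrightarrow> ((\<lambda>s. prym_map g d a j (s, 0) b) has_field_derivative ft b) (at 1)"
      "\<And>b. b \<in> {1, 2, 3} \<Longrightarrow> ((\<lambda>s. prym_map g d a j (1, s) b) has_field_derivative fu b) (at 0)" by metis
    have pt: "partial_t (prym_map g d a j) (1, 0) b = ft b" "partial_u (prym_map g d a j) (1, 0) b = fu b"
      if "b \<in> {1, 2, 3}" for b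
      unfolding partial_t_def partial_u_def prod.case using D[OF that] by (auto intro: DERIV_imp_deriv)
    have "partial_t ?f (1, 0) 0 = ft 1 - ft i" "partial_u ?f (1, 0) 0 = fu 1 - fu i"
      unfolding partial_t_def partial_u_def prod.case
      by (intro DERIV_imp_deriv DERIV_diff D i3)+
    then show "partial_t (prym_map g d a j) (1, 0) 1 - partial_t (prym_map g d a j) (1, 0) i = 0"
      "partial_u (prym_map g d a j) (1, 0) 1 - partial_u (prym_map g d a j) (1, 0) i = a (1, j) - a (i, j)"
      unfolding pt[OF i3(1)] pt[OF i3(2)] pf q1 by simp_all
  qed
  have e: "a (1, Br1) - a (i, Br1) = \<beta> * (a (1, Br2) - a (i, Br2))" if i: "i \<in> {2, 3}" for i
  proof -
    have "a (1, Br1) - a (i, Br1) = \<alpha> * (partial_t (prym_map g d a Br2) (1, 0) 1 - partial_t (prym_map g d a Br2) (1, 0) i)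
        + \<beta> * (partial_u (prym_map g d a Br2) (1, 0) 1 - partial_u (prym_map g d a Br2) (1, 0) i)"
      using diffs(2)[OF i, of Br1] unfolding ab[of 1] ab[of i] by (simp add: algebra_simps)
    then show ?thesis unfolding diffs[OF i] by simp
  qed
  show False using ratios e[of 2] e[of 3] by (simp add: unequal_ratios_def)
qed

lemma prym_canonical_binary_curve_if_generic: "prym_canonical_binary_curve g d a"
  unfolding prym_canonical_binary_curve_def
proof (intro conjI allI ballI)
  show "inj_on (\<lambda>i. a (i, j)) {1..g - 1}" for j using a by (simp add: nondegenerate_def)
  show "a (i, j) \<noteq> 0" if "i \<in> {1..g - 1}" for i j using a that unfolding nondegenerate_def by blast
  show "embeds_line (prym_map g d a j)" for j by (rule embeds_prym_map[OF a g d])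
  show "cfun.span {prym_map g d a j (prym_node g a l j)} = cfun.span {node_image g l}" if "l \<in> {1..g + 1}" for l j
    by (rule span_prym_map_at_node[OF a g d that])
  show "inj_on (\<lambda>l. cfun.span {node_image g l}) {1..g + 1}" by (rule inj_node_images[OF a g d])
  show "prym_component g d a Br1 \<inter> prym_component g d a Br2 = (\<lambda>l. cfun.span {node_image g l}) ` {1..g + 1}"
    by (rule components_intersection)
  show "tangent_line (prym_map g d a Br1) (prym_node g a l Br1) \<noteq> tangent_line (prym_map g d a Br2) (prym_node g a l Br2)"
    if "l \<in> {1..g + 1}" for l
    using transversal_at_finite_node[of l] transversal_at_infinity that by (cases "l = g + 1") auto
  show "given_by_complete_system g d a" by (rule given_by_complete_system_prym[OF a _ d]) (use g in simp)
qed

end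

section \<open>Generic choices\<close>

lemma poly_functions_on_line:
  assumes "F \<in> poly_functions n"
  shows "\<exists>p. \<forall>s. F (\<lambda>x. a x + s * (b x - a x)) = poly p s"
  using assms
proof (induction rule: poly_functions.induct)
  case (const c)
  then show ?case by (intro exI[of _ "[:c:]"]) simp
next
  case (var i j)
  then show ?case by (intro exI[of _ "[:a (i, j), b (i, j) - a (i, j):]"]) simp
next
  case (add F G)
  then obtain p q where "\<forall>s. F (\<lambda>x. a x + s * (b x - a x)) = poly p s" "\<forall>s. G (\<lambda>x. a x + s * (b x - a x)) = poly q s"
    by blast
  then show ?case by (intro exI[of _ "p + q"]) simp
next
  case (mult F G)
  then obtain p q where "\<forall>s. F (\<lambda>x. a x + s * (b x - a x)) = poly p s" "\<forall>s. G (\<lambda>x. a x + s * (b x - a x)) = poly q s"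
    by blast
  then show ?case by (intro exI[of _ "p * q"]) simp
qed

lemma poly_functions_cong:
  assumes "F \<in> poly_functions n" "\<And>i j. i \<in> {1..n} \<Longrightarrow> a (i, j) = b (i, j)"
  shows "F a = F b"
  using assms by (induction rule: poly_functions.induct) auto

text \<open>Affine space is irreducible: restrict to the line through \<open>a\<close> and \<open>b\<close> and use that univariate
polynomials have no zero divisors.\<close>

lemma poly_functions_common_nonzero:
  assumes F: "F \<in> poly_functions n" "F a \<noteq> 0" and G: "G \<in> poly_functions n" "G b \<noteq> 0"
  shows "\<exists>c. F c * G c \<noteq> 0"
proof -
  obtain p where p: "\<And>s. F (\<lambda>x. a x + s * (b x - a x)) = poly p s" using poly_functions_on_line[OF F(1)] by blast
  obtain q where q: "\<And>s. G (\<lambda>x. a x + s * (b x - a x)) = poly q s" using poly_functions_on_line[OF G(1)] by blast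
  have "p \<noteq> 0" "q \<noteq> 0" using p[of 0] q[of 1] F(2) G(2) by auto
  then have "p * q \<noteq> 0" by simp
  then obtain s where "poly (p * q) s \<noteq> 0" using poly_all_0_iff_0[of "p * q"] by blast
  then show ?thesis using p[of s] q[of s] by (metis poly_mult)
qed

text \<open>One polynomial suffices, because a nonempty Zariski open set contains the complement of the zero
set of any of its equations that does not vanish identically.\<close>

lemma generically_iff:
  "generically n P \<longleftrightarrow> (\<exists>F\<in>poly_functions n. (\<exists>a. F a \<noteq> 0) \<and> (\<forall>a\<in>param_space n. F a \<noteq> 0 \<longrightarrow> P a))"
proof
  assume "generically n P"
  then obtain S where S: "S \<subseteq> poly_functions n" "param_space n - {a \<in> param_space n. \<forall>F\<in>S. F a = 0} \<noteq> {}"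
    "\<forall>a\<in>param_space n - {a \<in> param_space n. \<forall>F\<in>S. F a = 0}. P a"
    unfolding generically_def zariski_open_def by auto
  then obtain a F where "F \<in> S" "F a \<noteq> 0" by auto
  then show "\<exists>F\<in>poly_functions n. (\<exists>a. F a \<noteq> 0) \<and> (\<forall>a\<in>param_space n. F a \<noteq> 0 \<longrightarrow> P a)"
    using S by blast
next
  assume "\<exists>F\<in>poly_functions n. (\<exists>a. F a \<noteq> 0) \<and> (\<forall>a\<in>param_space n. F a \<noteq> 0 \<longrightarrow> P a)"
  then obtain F a where F: "F \<in> poly_functions n" "F a \<noteq> 0" "\<forall>a\<in>param_space n. F a \<noteq> 0 \<longrightarrow> P a" by blast
  define U where "U = param_space n - {a \<in> param_space n. \<forall>F'\<in>{F}. F' a = 0}"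
  define b where "b = restrict a ({1..n} \<times> UNIV)"
  have "F b = F a" by (rule poly_functions_cong[OF F(1)]) (simp add: b_def)
  moreover have "b \<in> param_space n" by (auto simp: b_def param_space_def)
  ultimately have "b \<in> U" using F(2) by (auto simp: U_def)
  moreover have "zariski_open n U" unfolding zariski_open_def U_def using F(1) by blast
  moreover have "\<forall>a\<in>U. P a" using F(3) by (auto simp: U_def)
  ultimately show "generically n P" unfolding generically_def by blast
qed

lemma generically_nonvanishing: "F \<in> poly_functions n \<Longrightarrow> F a \<noteq> 0 \<Longrightarrow> generically n (\<lambda>a. F a \<noteq> 0)"
  unfolding generically_iff by blast

lemma generically_mono:
  "generically n P \<Longrightarrow> (\<And>a. a \<in> param_space n \<Longrightarrow> P a \<Longrightarrow> Q a) \<Longrightarrow> generically n Q"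
  unfolding generically_iff by blast

lemma generically_conj:
  assumes "generically n P" "generically n Q"
  shows "generically n (\<lambda>a. P a \<and> Q a)"
proof -
  obtain F a where F: "F \<in> poly_functions n" "F a \<noteq> 0" "\<forall>a\<in>param_space n. F a \<noteq> 0 \<longrightarrow> P a"
    using assms(1) unfolding generically_iff by blast
  obtain G b where G: "G \<in> poly_functions n" "G b \<noteq> 0" "\<forall>a\<in>param_space n. G a \<noteq> 0 \<longrightarrow> Q a"
    using assms(2) unfolding generically_iff by blast
  show ?thesis unfolding generically_iff
    using poly_functions_common_nonzero[OF F(1,2) G(1,2)] poly_functions.mult[OF F(1) G(1)] F(3) G(3)
    by (intro bexI[of _ "\<lambda>a. F a * G a"]) auto
qed

lemma generically_ball:
  assumes "finite I" "\<And>i. i \<in> I \<Longrightarrow> generically n (P i)"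
  shows "generically n (\<lambda>a. \<forall>i\<in>I. P i a)"
  using assms
proof (induction I rule: finite_induct)
  case empty
  have "(\<lambda>a. 1) \<in> poly_functions n" by (rule poly_functions.const)
  then show ?case unfolding generically_iff by (intro bexI[of _ "\<lambda>a. 1"]) auto
next
  case (insert i I)
  then show ?case using generically_conj[of n "P i" "\<lambda>a. \<forall>i\<in>I. P i a"] by simp
qed

text \<open>The parameters of the partial normalization at the node \<open>P\<close>.\<close>

definition drop_param :: "nat \<Rightarrow> nat \<Rightarrow> params \<Rightarrow> params" where
  "drop_param n P a = restrict (\<lambda>(i, j). a (skip P i, j)) ({1..n} \<times> UNIV)"

lemma poly_functions_drop_param:
  assumes "F \<in> poly_functions n"
  shows "(\<lambda>a. F (drop_param n P a)) \<in> poly_functions (Suc n)"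
  using assms
proof (induction rule: poly_functions.induct)
  case (var i j)
  then have "(\<lambda>a. drop_param n P a (i, j)) = (\<lambda>a. a (skip P i, j))" by (simp add: drop_param_def)
  moreover have "skip P i \<in> {1..Suc n}" using var by (simp add: skip_def)
  ultimately show ?case by (simp add: poly_functions.var)
qed (auto intro: poly_functions.intros)

lemma generically_drop_param:
  assumes "generically n Q"
  shows "generically (Suc n) (\<lambda>a. Q (drop_param n P a))"
proof -
  obtain F b where F: "F \<in> poly_functions n" "F b \<noteq> 0" "\<forall>a\<in>param_space n. F a \<noteq> 0 \<longrightarrow> Q a"
    using assms unfolding generically_iff by blast
  \<comment> \<open>The value at the index \<open>P\<close> is arbitrary.\<close>
  define a :: params where "a = (\<lambda>(i, j). b (if i < P then i else i - 1, j))"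
  have "F (drop_param n P a) = F b"
    by (rule poly_functions_cong[OF F(1)]) (simp add: drop_param_def a_def skip_def)
  moreover have "drop_param n P c \<in> param_space n" for c by (auto simp: drop_param_def param_space_def)
  ultimately show ?thesis unfolding generically_iff
    using poly_functions_drop_param[OF F(1)] F(2,3)
    by (intro bexI[of _ "\<lambda>a. F (drop_param n P a)"]) (auto intro: exI[of _ a])
qed

lemma poly_functions_diff:
  assumes "F \<in> poly_functions n" "G \<in> poly_functions n"
  shows "(\<lambda>a. F a - G a) \<in> poly_functions n"
  using poly_functions.add[OF assms(1) poly_functions.mult[OF poly_functions.const[of "-1"] assms(2)]] by simp

text \<open>Each condition is the nonvanishing of a polynomial that is nonzero at the parameters \<open>1, 2, 3, \<dots>\<close>
and \<open>1, 4, 9, \<dots>\<close>.\<close>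

lemma generically_nondegenerate:
  assumes "g \<ge> 4"
  shows "generically (g - 1) (\<lambda>a. nondegenerate g a \<and> unequal_ratios a)"
proof -
  let ?n = "g - 1"
  define b :: params where "b = (\<lambda>(i, j). case j of Br1 \<Rightarrow> of_nat i | Br2 \<Rightarrow> of_nat i ^ 2)"
  have inj: "b (i, j) \<noteq> b (i', j)" if "i \<noteq> i'" for i i' j
  proof (cases j)
    case Br1
    then show ?thesis using that by (simp add: b_def)
  next
    case Br2
    have "i ^ 2 \<noteq> i' ^ 2" using that by simp
    then have "of_nat (i ^ 2) \<noteq> (of_nat (i' ^ 2) :: complex)" unfolding of_nat_eq_iff .
    then show ?thesis using Br2 by (simp add: b_def)
  qed
  have fin: "finite (UNIV :: branch set)"
  proof -
    have "UNIV = {Br1, Br2}" using branch.exhaust by auto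
    then show ?thesis by (metis finite.emptyI finite_insert)
  qed
  have "generically ?n (\<lambda>a. \<forall>j\<in>UNIV. \<forall>i\<in>{1..?n}. \<forall>i'\<in>{1..?n} - {i}. a (i, j) - a (i', j) \<noteq> 0)"
  proof (intro generically_ball fin finite_atLeastAtMost finite_Diff)
    fix j i i' assume i: "i \<in> {1..?n}" "i' \<in> {1..?n} - {i}"
    show "generically ?n (\<lambda>a. a (i, j) - a (i', j) \<noteq> 0)"
    proof (rule generically_nonvanishing[where a = b])
      show "(\<lambda>a. a (i, j) - a (i', j)) \<in> poly_functions ?n"
        using i by (intro poly_functions_diff poly_functions.var) auto
      show "b (i, j) - b (i', j) \<noteq> 0" using inj i by auto
    qed
  qed
  moreover have "generically ?n (\<lambda>a. \<forall>j\<in>UNIV. \<forall>i\<in>{1..?n}. a (i, j) \<noteq> 0)"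
  proof (intro generically_ball fin finite_atLeastAtMost)
    fix j i assume i: "i \<in> {1..?n}"
    show "generically ?n (\<lambda>a. a (i, j) \<noteq> 0)"
    proof (rule generically_nonvanishing[where a = b])
      show "(\<lambda>a. a (i, j)) \<in> poly_functions ?n" using i by (rule poly_functions.var)
      show "b (i, j) \<noteq> 0" using i by (cases j) (auto simp: b_def)
    qed
  qed
  moreover have "generically ?n (\<lambda>a. (a (1, Br1) - a (2, Br1)) * (a (1, Br2) - a (3, Br2))
      - (a (1, Br2) - a (2, Br2)) * (a (1, Br1) - a (3, Br1)) \<noteq> 0)"
  proof (rule generically_nonvanishing[where a = b])
    show "(\<lambda>a. (a (1, Br1) - a (2, Br1)) * (a (1, Br2) - a (3, Br2))
      - (a (1, Br2) - a (2, Br2)) * (a (1, Br1) - a (3, Br1))) \<in> poly_functions ?n"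
      using assms by (intro poly_functions_diff poly_functions.mult poly_functions.var) auto
    show "(b (1, Br1) - b (2, Br1)) * (b (1, Br2) - b (3, Br2)) - (b (1, Br2) - b (2, Br2)) * (b (1, Br1) - b (3, Br1)) \<noteq> 0"
      by (simp add: b_def)
  qed
  ultimately have "generically ?n (\<lambda>a. (\<forall>j\<in>UNIV. \<forall>i\<in>{1..?n}. \<forall>i'\<in>{1..?n} - {i}. a (i, j) - a (i', j) \<noteq> 0)
      \<and> (\<forall>j\<in>UNIV. \<forall>i\<in>{1..?n}. a (i, j) \<noteq> 0)
      \<and> (a (1, Br1) - a (2, Br1)) * (a (1, Br2) - a (3, Br2)) - (a (1, Br2) - a (2, Br2)) * (a (1, Br1) - a (3, Br1)) \<noteq> 0)"
    by (intro generically_conj)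
  then show ?thesis
    by (rule generically_mono) (auto simp: nondegenerate_def unequal_ratios_def inj_on_def)
qed

section \<open>Inductive step for property N\<close>

text \<open>Those of the first \<open>g - 1\<close> nodes with gluing sign \<open>1\<close> for even \<open>g\<close> and \<open>-1\<close> for odd \<open>g\<close>: passing
from \<open>g\<close> to \<open>g - 1\<close> lowers the number \<open>g div 2\<close> of sign \<open>1\<close> parameters only if \<open>g\<close> is even.\<close>

definition removable_nodes :: "nat \<Rightarrow> nat set" where
  "removable_nodes g = (if even g then {1..g div 2} else {g div 2 + 1..g - 1})"

lemma twisted_canonical_sections_cong:
  assumes "\<And>r j. r \<in> {1..g + 1} \<Longrightarrow> x r j = x' r j" "\<And>r. r \<in> {1..g + 1} \<Longrightarrow> h r = h' r"
  shows "twisted_canonical_sections g x h q = twisted_canonical_sections g x' h' q"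
proof -
  have "node_residue g (\<lambda>r. x r j) q F l = node_residue g (\<lambda>r. x' r j) q F l" if "l \<in> {1..g + 1}" for j F l
  proof -
    have "(\<Prod>r\<in>{1..g + 1} - {l}. vanishing_form (x r j) (x l j)) = (\<Prod>r\<in>{1..g + 1} - {l}. vanishing_form (x' r j) (x' l j))"
      by (rule prod.cong) (use assms(1) that in auto)
    then show ?thesis using assms(1)[OF that] by (simp add: node_residue_def)
  qed
  then show ?thesis unfolding twisted_canonical_sections_def using assms(2) by auto
qed

lemma prym_sections_drop_param:
  assumes g: "g \<ge> 2" and P: "P \<in> removable_nodes g"
  shows "prym_sections (g - 1) (drop_param (g - 2) P a) q
    = twisted_canonical_sections (g - 1) (prym_node g a \<circ> skip P) (prym_h g \<circ> skip P) q"
  unfolding prym_sections_def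
proof (rule twisted_canonical_sections_cong)
  have P': "1 \<le> P" "P \<le> g - 1" using P g by (auto simp: removable_nodes_def split: if_splits)
  fix r assume "r \<in> {1..g - 1 + 1}"
  then have r: "1 \<le> r" "r \<le> g" using g by auto
  show "prym_node (g - 1) (drop_param (g - 2) P a) r j = (prym_node g a \<circ> skip P) r j" for j
  proof -
    consider "r \<le> g - 2" | "r = g - 1" | "r = g" using r by linarith
    then show ?thesis
    proof cases
      case 1
      then have "skip P r \<le> g - 1" "r \<le> g - 1 - 1" "r \<in> {1..g - 2}" using r g by (auto simp: skip_def)
      then show ?thesis by (simp add: prym_node_def drop_param_def)
    next
      case 2
      then have "skip P r = g" "\<not> g \<le> g - 1" "\<not> r \<le> g - 1 - 1" using P' g by (auto simp: skip_def)
      then show ?thesis using 2 by (simp add: prym_node_def)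
    next
      case 3
      then have "skip P r = g + 1" "\<not> g + 1 \<le> g - 1" "g + 1 \<noteq> g" "\<not> r \<le> g - 1 - 1" "r \<noteq> g - 1"
        using P' g by (auto simp: skip_def)
      then show ?thesis by (simp add: prym_node_def)
    qed
  qed
  show "prym_h (g - 1) r = (prym_h g \<circ> skip P) r"
  proof (cases "even g")
    case True
    then obtain k where k: "g = 2 * k" by blast
    then have "(g - 1) div 2 = k - 1" "g div 2 = k" "1 \<le> P" "P \<le> k" using P g True by (auto simp: removable_nodes_def)
    then show ?thesis using r k by (auto simp: prym_h_def skip_def)
  next
    case False
    then obtain k where k: "g = 2 * k + 1" by (blast elim: oddE)
    then have "(g - 1) div 2 = k" "g div 2 = k" "k + 1 \<le> P" "P \<le> 2 * k" using P g False by (auto simp: removable_nodes_def)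
    then show ?thesis using r k by (auto simp: prym_h_def skip_def)
  qed
qed

theorem theorem3p2:
  fixes g k p :: nat and d d' :: complex
  assumes "g = 2 * k \<or> g = 2 * k + 1"
    and "p + 3 \<le> k"
    and "d \<noteq> 0" and "d' \<noteq> 0"
    and "generically (g - 2) (\<lambda>a'. prym_canonical_binary_curve (g - 1) d' a' \<and> property_N p (g - 1) a')"
  shows "generically (g - 1) (\<lambda>a. prym_canonical_binary_curve g d a \<and> property_N p g a)"
proof -
  let ?A = "removable_nodes g"
  have g: "g \<ge> 6" and suc: "g - 1 = Suc (g - 2)" using assms(1,2) by auto
  have A: "?A \<subseteq> {1..g - 1}" "card ?A = k" "finite ?A"
    using assms(1,2) by (auto simp: removable_nodes_def)
  have "generically (g - 2) (property_N p (g - 1))"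
    by (rule generically_mono[OF assms(5)]) simp
  then have "generically (g - 1) (\<lambda>a. property_N p (g - 1) (drop_param (g - 2) P a))" for P
    unfolding suc by (rule generically_drop_param)
  then have "generically (g - 1) (\<lambda>a. \<forall>P\<in>?A. property_N p (g - 1) (drop_param (g - 2) P a))"
    by (intro generically_ball A)
  moreover have "generically (g - 1) (\<lambda>a. nondegenerate g a \<and> unequal_ratios a)"
    by (rule generically_nondegenerate) (use g in simp)
  ultimately have "generically (g - 1) (\<lambda>a. (\<forall>P\<in>?A. property_N p (g - 1) (drop_param (g - 2) P a))
      \<and> nondegenerate g a \<and> unequal_ratios a)"
    by (rule generically_conj)
  then show ?thesis
  proof (rule generically_mono)
    fix a assume a: "(\<forall>P\<in>?A. property_N p (g - 1) (drop_param (g - 2) P a)) \<and> nondegenerate g a \<and> unequal_ratios a"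
    have "koszul_vanishes (twisted_canonical_sections (g - 1) (prym_node g a \<circ> skip P) (prym_h g \<circ> skip P)) p 2"
      if P: "P \<in> ?A" for P
    proof -
      have "prym_sections (g - 1) (drop_param (g - 2) P a)
          = twisted_canonical_sections (g - 1) (prym_node g a \<circ> skip P) (prym_h g \<circ> skip P)"
        using prym_sections_drop_param[OF _ P] g by (intro ext) simp
      then show ?thesis using a P unfolding property_N_def by metis
    qed
    then have "property_N p g a"
      using a g A assms(2) by (intro property_N_of_normalizations[where A = ?A]) auto
    moreover have "prym_canonical_binary_curve g d a"
      using a g assms(3) by (intro prym_canonical_binary_curve_if_generic) auto
    ultimately show "prym_canonical_binary_curve g d a \<and> property_N p g a" by blast
  qed
qed

end
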